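(* For every $\epsilon>0$ there is a set $A\subset\mathbb{P}$ whose relative density $d_{\mathbb{P}}(A)$ (exists and) is at least $1-\epsilon$ such that $\mathbb{P}-A$ is not piecewise syndetic. In particular, $R:=\mathbb{N}\setminus(\mathbb{P}-A)$ is thickly syndetic, but not prime intersective.
   Context: $\mathbb{N}=\{1,2,3,\dots\}$, $[N]=\{1,\dots,N\}$, $\mathbb{P}$ is the set of primes. For $A,E\subset\mathbb{N}$, $E$ infinite, $\overline{d}_E(A)=\limsup_{N}\frac{|A\cap E\cap[N]|}{|E\cap[N]|}$, $\underline{d}_E(A)=\liminf_{N}\frac{|A\cap E\cap[N]|}{|E\cap[N]|}$, and $d_E(A)$ is their common value when equal. $A-B=\{a-b:a\in A,b\in B\}$. $S\subset\mathbb{N}$ is thick if it contains arbitrarily long intervals of consecutive integers; syndetic if $S-F\supset\mathbb{N}$ for some finite $F$; piecewise syndetic if $S=T\cap R$ with $T$ thick and $R$ syndetic; thickly syndetic if it intersects every piecewise syndetic set (equivalently, for every $N$ there is a syndetic $J$ with $[N]+J\subset S$). A set $S\subset\mathbb{Z}$ has one of these properties if $S\cap\mathbb{N}$ does. $R\subset\mathbb{N}$ is prime intersective if for every $A\subset\mathbb{P}$ with $\overline{d}_{\mathbb{P}}(A)>0$ we have $R\cap(A-A)\neq\varnothing$. *)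

theory Defs
  imports
    Complex_Main
    "HOL-Library.Liminf_Limsup"
    "HOL-Library.Extended_Real"
    "HOL-Computational_Algebra.Primes"
begin

text \<open>
  All sets are sets of integers, since difference sets contain negative numbers. The positive
  integers are \<open>pos_ints\<close> (the constant \<open>\<nat>\<close> of the library contains 0).
\<close>

definition pos_ints :: "int set" where
  "pos_ints = {n. 0 < n}"

definition primes :: "int set" where
  "primes = {p. prime p}"

definition diff_set :: "int set \<Rightarrow> int set \<Rightarrow> int set" where
  "diff_set A B = {a - b | a b. a \<in> A \<and> b \<in> B}"

text \<open>
  The finitely many indices for which \<open>E \<inter> {1..N}\<close> is empty contribute the value 0 and
  affect neither limit when \<open>E\<close> contains a positive integer.
\<close>

definition upper_rel_density :: "int set \<Rightarrow> int set \<Rightarrow> ereal" where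
  "upper_rel_density E A =
     limsup (\<lambda>N::nat. ereal (real (card (A \<inter> E \<inter> {1..int N})) / real (card (E \<inter> {1..int N}))))"

definition lower_rel_density :: "int set \<Rightarrow> int set \<Rightarrow> ereal" where
  "lower_rel_density E A =
     liminf (\<lambda>N::nat. ereal (real (card (A \<inter> E \<inter> {1..int N})) / real (card (E \<inter> {1..int N}))))"

definition has_rel_density :: "int set \<Rightarrow> int set \<Rightarrow> real \<Rightarrow> bool" where
  "has_rel_density E A d \<longleftrightarrow>
     upper_rel_density E A = ereal d \<and> lower_rel_density E A = ereal d"

text \<open>
  The notions of largeness for a set of integers refer to its positive part.
\<close>

definition thick :: "int set \<Rightarrow> bool" where
  "thick S \<longleftrightarrow> (\<forall>L::nat. \<exists>a. {a + 1..a + int L} \<subseteq> S \<inter> pos_ints)"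

definition syndetic :: "int set \<Rightarrow> bool" where
  "syndetic S \<longleftrightarrow> (\<exists>F. finite F \<and> pos_ints \<subseteq> diff_set (S \<inter> pos_ints) F)"

definition piecewise_syndetic :: "int set \<Rightarrow> bool" where
  "piecewise_syndetic S \<longleftrightarrow>
     (\<exists>T R. T \<subseteq> pos_ints \<and> R \<subseteq> pos_ints \<and> thick T \<and> syndetic R \<and> S \<inter> pos_ints = T \<inter> R)"

definition thickly_syndetic :: "int set \<Rightarrow> bool" where
  "thickly_syndetic S \<longleftrightarrow>
     (\<forall>B. B \<subseteq> pos_ints \<and> piecewise_syndetic B \<longrightarrow> S \<inter> pos_ints \<inter> B \<noteq> {})"

text \<open>
  Meant for \<open>R \<subseteq> pos_ints\<close>; a set containing 0 satisfies it trivially.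
\<close>

definition prime_intersective :: "int set \<Rightarrow> bool" where
  "prime_intersective R \<longleftrightarrow>
     (\<forall>A. A \<subseteq> primes \<and> upper_rel_density primes A > 0 \<longrightarrow> R \<inter> diff_set A A \<noteq> {})"

end

theory Submission
  imports
    Defs
    "HOL-Number_Theory.Number_Theory"
    "HOL-Computational_Algebra.Squarefree"
    "HOL-Analysis.Harmonic_Numbers"
    "HOL-Real_Asymp.Real_Asymp"
begin

text \<open>
  Let \<open>q\<close> range over a finite block of primes with large sum of reciprocals. All but a small proportion
  of the primes \<open>a\<close> are 1 modulo some \<open>q\<close> in the block, and if \<open>n + i + 1\<close> is divisible by every \<open>q\<close>, then
  \<open>n + i + a\<close> is composite for these \<open>a\<close>. Using \<open>k\<close> disjoint blocks, one for each \<open>i < k\<close>, a whole residue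
  class of \<open>n\<close> has the property that \<open>n, ..., n + k - 1\<close> avoid the differences of primes and
  non-discarded primes. Discarding at level \<open>k\<close> only primes beyond a threshold (the finitely many smaller
  ones are dealt with by further congruences on \<open>n\<close>) keeps the union of the discarded sets small.

  The relative density has to exist, which is arranged by a greedy choice among the remaining primes. It
  succeeds if in every interval the discarded primes are a small proportion of all primes up to a
  negligible error. An upper bound sieve bounds the discarded primes in an interval by a small multiple
  of its length divided by the logarithm, and the prime number theorem bounds the primes from below. The
  latter is derived from Selberg's formula: a nearly extremal error at \<open>x\<close> forces nearly extremal errors
  of opposite signs at most \<open>x / p\<close> and \<open>x / (p q)\<close>, with \<open>p\<close> and \<open>q\<close> prime, although primes and products of
  two primes occur close to each other.
\<close>

section \<open>Dirichlet products and Moebius inversion\<close>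

definition nats_upto :: "real \<Rightarrow> nat set" where
  "nats_upto x = {n. 0 < n \<and> real n \<le> x}"

lemma nats_upto_eq: "nats_upto x = {1..nat \<lfloor>x\<rfloor>}"
proof -
  have "real n \<le> x \<longleftrightarrow> n \<le> nat \<lfloor>x\<rfloor>" if "n > 0" for n
    using that by linarith
  then show ?thesis by (auto simp: nats_upto_def)
qed

lemma finite_nats_upto [simp, intro]: "finite (nats_upto x)"
  by (simp add: nats_upto_eq)

lemma nats_upto_of_nat: "nats_upto (real n) = {1..n}"
  by (simp add: nats_upto_eq)

lemma nats_upto_empty: "x < 1 \<Longrightarrow> nats_upto x = {}"
  by (auto simp: nats_upto_def)

lemma nats_upto_mono: "x \<le> y \<Longrightarrow> nats_upto x \<subseteq> nats_upto y"
  by (auto simp: nats_upto_def)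

lemma in_nats_upto_divide_iff: "a > 0 \<Longrightarrow> b \<in> nats_upto (x / real a) \<longleftrightarrow> 0 < b \<and> real (a * b) \<le> x"
  by (auto simp: nats_upto_def field_simps)

lemma card_nats_upto: "x \<ge> 0 \<Longrightarrow> real (card (nats_upto x)) \<le> x" "x \<ge> 0 \<Longrightarrow> x - 1 < real (card (nats_upto x))"
  by (auto simp: nats_upto_eq)

lemma sum_nats_upto_divisors:
  "(\<Sum>a\<in>nats_upto x. \<Sum>b\<in>nats_upto (x / real a). F a b) = (\<Sum>n\<in>nats_upto x. \<Sum>d | d dvd n. F d (n div d))"
proof -
  have fin: "finite {d. d dvd n}" if "n \<in> nats_upto x" for n :: nat
    using that by (auto simp: nats_upto_def)
  have "(\<Sum>a\<in>nats_upto x. \<Sum>b\<in>nats_upto (x / real a). F a b)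
      = (\<Sum>(a,b)\<in>(SIGMA a:nats_upto x. nats_upto (x / real a)). F a b)"
    by (rule sum.Sigma) auto
  also have "\<dots> = (\<Sum>(n,d)\<in>(SIGMA n:nats_upto x. {d. d dvd n}). F d (n div d))"
    by (rule sum.reindex_bij_witness[where i = "\<lambda>(n,d). (d, n div d)" and j = "\<lambda>(a,b). (a * b, a)"])
       (auto simp: nats_upto_def field_simps dvd_def split: prod.splits simp flip: of_nat_mult
             intro: order_trans[rotated])
  also have "\<dots> = (\<Sum>n\<in>nats_upto x. \<Sum>d | d dvd n. F d (n div d))"
    using fin by (intro sum.Sigma[symmetric]) auto
  finally show ?thesis .
qed

definition dirichlet_prod :: "(nat \<Rightarrow> 'a) \<Rightarrow> (nat \<Rightarrow> 'a) \<Rightarrow> nat \<Rightarrow> 'a :: comm_semiring_1" where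
  "dirichlet_prod f g n = (\<Sum>d | d dvd n. f d * g (n div d))"

lemma sum_dirichlet_prod:
  "(\<Sum>n\<in>nats_upto x. dirichlet_prod f g n) = (\<Sum>a\<in>nats_upto x. f a * (\<Sum>b\<in>nats_upto (x / real a). g b))"
  by (simp add: dirichlet_prod_def sum_distrib_left sum_nats_upto_divisors)

lemma sum_divisors_div:
  fixes n :: nat
  assumes "n > 0"
  shows "(\<Sum>d | d dvd n. g (n div d)) = (\<Sum>d | d dvd n. g d)"
  by (rule sum.reindex_bij_witness[where i = "\<lambda>d. n div d" and j = "\<lambda>d. n div d"])
     (use assms in \<open>auto elim!: dvdE\<close>)

lemma dirichlet_prod_commute:
  assumes "n > 0"
  shows "dirichlet_prod f g n = dirichlet_prod g f n"
proof -
  have "dirichlet_prod f g n = (\<Sum>d | d dvd n. g (n div d) * f (n div (n div d)))"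
    unfolding dirichlet_prod_def using assms by (intro sum.cong) (auto elim!: dvdE simp: mult.commute)
  then show ?thesis
    using sum_divisors_div[OF assms, of "\<lambda>d. g d * f (n div d)"] by (simp add: dirichlet_prod_def)
qed

lemma sum_nats_upto_swap:
  fixes f g :: "nat \<Rightarrow> 'a :: comm_semiring_1"
  shows "(\<Sum>a\<in>nats_upto x. f a * (\<Sum>b\<in>nats_upto (x / real a). g b))
    = (\<Sum>b\<in>nats_upto x. g b * (\<Sum>a\<in>nats_upto (x / real b). f a))"
  unfolding sum_dirichlet_prod[symmetric]
  by (intro sum.cong refl dirichlet_prod_commute) (simp add: nats_upto_def)

lemma dirichlet_prod_assoc:
  assumes "n > 0"
  shows "dirichlet_prod (dirichlet_prod f g) h n = dirichlet_prod f (dirichlet_prod g h) n"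
proof -
  have fin: "finite {e. e dvd d}" "finite {e. e dvd n div d}" if "d dvd n" for d
    using assms that by (auto elim!: dvdE)
  have "dirichlet_prod (dirichlet_prod f g) h n
      = (\<Sum>(d,e)\<in>(SIGMA d:{d. d dvd n}. {e. e dvd d}). f e * g (d div e) * h (n div d))"
    unfolding dirichlet_prod_def sum_distrib_right using fin assms by (intro sum.Sigma) auto
  also have "\<dots> = (\<Sum>(e,c)\<in>(SIGMA e:{e. e dvd n}. {c. c dvd n div e}). f e * (g c * h (n div e div c)))"
    by (rule sum.reindex_bij_witness[where i = "\<lambda>(e,c). (e * c, e)" and j = "\<lambda>(d,e). (e, d div e)"])
       (use assms in \<open>auto elim!: dvdE simp: mult.assoc\<close>)
  also have "\<dots> = dirichlet_prod f (dirichlet_prod g h) n"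
    unfolding dirichlet_prod_def sum_distrib_left using fin assms by (intro sum.Sigma[symmetric]) auto
  finally show ?thesis .
qed

lemma prime_factors_prod_primes:
  assumes "finite T" "\<And>p. p \<in> T \<Longrightarrow> prime p"
  shows "prime_factors (\<Prod>T :: nat) = T"
proof -
  have "prime_factors (\<Prod>p\<in>T. p) = \<Union>((prime_factors \<circ> (\<lambda>p. p)) ` T)"
    using assms(1) not_prime_0 assms(2)[of 0] by (intro prime_factors_prod) auto
  also have "\<dots> = T"
    using assms by (auto simp: prime_prime_factors)
  finally show ?thesis by simp
qed

lemma prod_prime_factors_squarefree:
  fixes d :: nat
  assumes "squarefree d"
  shows "\<Prod>(prime_factors d) = d"
proof -
  have "d \<noteq> 0" using assms by (intro notI) auto
  have "multiplicity p d = 1" if "p \<in> prime_factors d" for p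
  proof -
    have "multiplicity p d \<le> 1" "multiplicity p d > 0"
      using that assms \<open>d \<noteq> 0\<close> by (auto simp: squarefree_factorial_semiring'' prime_factors_multiplicity)
    then show ?thesis by linarith
  qed
  then have "(\<Prod>p\<in>prime_factors d. p) = (\<Prod>p\<in>prime_factors d. p ^ multiplicity p d)"
    by (intro prod.cong) auto
  then show ?thesis using \<open>d \<noteq> 0\<close> by (simp add: prod_prime_factors)
qed

lemma bij_betw_prod_squarefree_divisors:
  fixes n :: nat
  assumes "n > 0"
  shows "bij_betw (\<lambda>T. \<Prod>T) (Pow (prime_factors n)) {d. d dvd n \<and> squarefree d}"
proof (rule bij_betw_byWitness[where f' = prime_factors])
  show "\<forall>T\<in>Pow (prime_factors n). prime_factors (\<Prod>T) = T"
    by (intro ballI prime_factors_prod_primes) (auto intro: finite_subset[of _ "prime_factors n"])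
  show "\<forall>d\<in>{d. d dvd n \<and> squarefree d}. \<Prod>(prime_factors d) = d"
    by (auto intro: prod_prime_factors_squarefree)
  show "prime_factors ` {d. d dvd n \<and> squarefree d} \<subseteq> Pow (prime_factors n)"
    using assms by (auto intro: dvd_trans simp: prime_factors_dvd)
  show "(\<lambda>T. \<Prod>T) ` Pow (prime_factors n) \<subseteq> {d. d dvd n \<and> squarefree d}"
  proof safe
    fix T assume T: "T \<subseteq> prime_factors n"
    have "\<Prod>T dvd \<Prod>(prime_factors n)" using T by (intro prod_dvd_prod_subset) auto
    also have "\<Prod>(prime_factors n) dvd (\<Prod>p\<in>prime_factors n. p ^ multiplicity p n)"
      by (intro prod_dvd_prod) (auto simp: prime_factors_multiplicity dvd_power)
    also have "\<dots> = n" using assms by (simp add: prod_prime_factors)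
    finally show "\<Prod>T dvd n" .
    have "prime p" if "p \<in> T" for p using that T by auto
    then show "squarefree (\<Prod>T)"
      by (intro squarefree_prod_coprime) (auto intro!: primes_coprime squarefree_prime)
  qed
qed

definition moebius_mu :: "nat \<Rightarrow> real" where
  "moebius_mu n = (if squarefree n then (-1) ^ card (prime_factors n) else 0)"

lemma abs_moebius_mu_le_1: "\<bar>moebius_mu n\<bar> \<le> 1"
  by (simp add: moebius_mu_def power_abs)

lemma sum_moebius_mu_divisors:
  assumes "n > 0"
  shows "(\<Sum>d | d dvd n. moebius_mu d) = (if n = 1 then 1 else 0)"
proof -
  let ?P = "prime_factors n"
  have "(\<Sum>d | d dvd n. moebius_mu d) = (\<Sum>d | d dvd n \<and> squarefree d. (-1) ^ card (prime_factors d))"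
    using assms by (intro sum.mono_neutral_cong_right) (auto simp: moebius_mu_def)
  also have "\<dots> = (\<Sum>T\<in>Pow ?P. (-1) ^ card (prime_factors (\<Prod>T)))"
    using bij_betw_prod_squarefree_divisors[OF assms] by (rule sum.reindex_bij_betw[symmetric])
  also have "\<dots> = (\<Sum>T\<in>Pow ?P. \<Prod>p\<in>T. (-1))"
  proof (intro sum.cong refl)
    fix T assume T: "T \<in> Pow ?P"
    then have "prime_factors (\<Prod>T) = T"
      by (intro prime_factors_prod_primes) (auto intro: finite_subset[of _ ?P])
    then show "(-1) ^ card (prime_factors (\<Prod>T)) = (\<Prod>p\<in>T. (-1::real))" by simp
  qed
  also have "\<dots> = (\<Prod>p\<in>?P. ((-1) + 1))"
    by (subst prod_add) simp_all
  also have "\<dots> = (if n = 1 then 1 else 0)"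
    using assms by (auto simp: card_gt_0_iff prime_factorization_empty_iff)
  finally show ?thesis .
qed

lemma moebius_inversion_nats_upto:
  fixes R :: "real \<Rightarrow> real"
  assumes "x \<ge> 1"
  shows "(\<Sum>d\<in>nats_upto x. moebius_mu d * (\<Sum>n\<in>nats_upto (x / real d). R (x / real d / real n))) = R x"
proof -
  have "(\<Sum>d\<in>nats_upto x. moebius_mu d * (\<Sum>n\<in>nats_upto (x / real d). R (x / real d / real n)))
      = (\<Sum>n\<in>nats_upto x. \<Sum>d | d dvd n. moebius_mu d * R (x / real d / real (n div d)))"
    unfolding sum_distrib_left by (rule sum_nats_upto_divisors)
  also have "\<dots> = (\<Sum>n\<in>nats_upto x. \<Sum>d | d dvd n. moebius_mu d * R (x / real n))"
    by (intro sum.cong) (auto simp: nats_upto_def elim!: dvdE)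
  also have "\<dots> = (\<Sum>n\<in>nats_upto x. if n = 1 then R x else 0)"
    by (intro sum.cong refl)
       (simp add: sum_distrib_right[symmetric] sum_moebius_mu_divisors nats_upto_def)
  also have "\<dots> = R x"
    using assms by (subst sum.delta) (auto, auto simp: nats_upto_def)
  finally show ?thesis .
qed

section \<open>Sums of monotone functions\<close>

lemma antimono_deriv_increment:
  fixes f F :: "real \<Rightarrow> real"
  assumes "\<And>t. t \<ge> a \<Longrightarrow> (F has_real_derivative f t) (at t)" "antimono_on {a..} f" "a \<le> s" "s \<le> t"
  shows "(t - s) * f t \<le> F t - F s" "F t - F s \<le> (t - s) * f s"
proof -
  have "(t - s) * f t \<le> F t - F s \<and> F t - F s \<le> (t - s) * f s"
  proof (cases "s = t")
    case False
    then obtain z where "s < z" "z < t" "F t - F s = (t - s) * f z"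
      using MVT2[of s t F f] assms by force
    then show ?thesis using assms monotone_onD[OF assms(2), of s z] monotone_onD[OF assms(2), of z t]
      by (auto intro!: mult_left_mono)
  qed auto
  then show "(t - s) * f t \<le> F t - F s" "F t - F s \<le> (t - s) * f s" by auto
qed

lemma sum_antimono_bounds:
  fixes f F :: "real \<Rightarrow> real" and m n :: nat
  assumes deriv: "\<And>t. t \<ge> real m \<Longrightarrow> (F has_real_derivative f t) (at t)"
    and anti: "antimono_on {real m..} f" and "m \<le> n"
  shows "(\<Sum>k\<in>{m<..n}. f (real k)) \<le> F (real n) - F (real m)"
    and "F (real n) - F (real m) - (f (real m) - f (real n)) \<le> (\<Sum>k\<in>{m<..n}. f (real k))"
proof -
  have "(\<Sum>k\<in>{m<..n}. f (real k)) \<le> F (real n) - F (real m) \<and>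
     F (real n) - F (real m) - (f (real m) - f (real n)) \<le> (\<Sum>k\<in>{m<..n}. f (real k))"
    using \<open>m \<le> n\<close>
  proof (induction n rule: dec_induct)
    case (step n)
    have "{m<..Suc n} = insert (Suc n) {m<..n}" using step by auto
    then have "(\<Sum>k\<in>{m<..Suc n}. f (real k)) = (\<Sum>k\<in>{m<..n}. f (real k)) + f (real (Suc n))" by simp
    moreover have "f (real (Suc n)) \<le> F (real (Suc n)) - F (real n)" "F (real (Suc n)) - F (real n) \<le> f (real n)"
      using antimono_deriv_increment[OF deriv anti, of "real n" "real (Suc n)"] step by auto
    ultimately show ?case using step.IH by linarith
  qed simp
  then show "(\<Sum>k\<in>{m<..n}. f (real k)) \<le> F (real n) - F (real m)"
    and "F (real n) - F (real m) - (f (real m) - f (real n)) \<le> (\<Sum>k\<in>{m<..n}. f (real k))" by auto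
qed

lemma sum_antimono_asymptotics:
  fixes f F :: "real \<Rightarrow> real"
  assumes deriv: "\<And>t. t \<ge> 1 \<Longrightarrow> (F has_real_derivative f t) (at t)"
    and anti: "antimono_on {1..} f" and nonneg: "\<And>t. t \<ge> 1 \<Longrightarrow> f t \<ge> 0"
  obtains c where "\<And>y. y \<ge> 1 \<Longrightarrow> \<bar>(\<Sum>n\<in>nats_upto y. f (real n)) - F y - c\<bar> \<le> f (real (nat \<lfloor>y\<rfloor>))"
proof -
  define a where "a = (\<lambda>n. (\<Sum>k=1..n. f (real k)) - F (real n))"
  have a: "a n \<le> a m" "a m - f (real m) \<le> a n" if "1 \<le> m" "m \<le> n" for m n
  proof -
    have "{1..n} = {1..m} \<union> {m<..n}" using that by auto
    then have "(\<Sum>k=1..n. f (real k)) = (\<Sum>k=1..m. f (real k)) + (\<Sum>k\<in>{m<..n}. f (real k))"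
      by (simp only:) (rule sum.union_disjoint, auto)
    moreover have "antimono_on {real m..} f" using anti that by (auto intro: monotone_on_subset)
    moreover have "f (real n) \<ge> 0" using that nonneg by simp
    ultimately show "a n \<le> a m" "a m - f (real m) \<le> a n"
      using sum_antimono_bounds[of m F f n] deriv that by (auto simp: a_def)
  qed
  have "decseq (\<lambda>n. a (Suc n))" by (rule decseq_SucI) (rule a, auto)
  moreover have "a 1 - f 1 \<le> a (Suc n)" for n using a(2)[of 1 "Suc n"] by simp
  ultimately obtain c where c: "(\<lambda>n. a (Suc n)) \<longlonglongrightarrow> c" using decseq_convergent by blast
  show ?thesis
  proof (rule that)
    fix y :: real assume y: "y \<ge> 1"
    define n where "n = nat \<lfloor>y\<rfloor>"
    have n: "1 \<le> n" "real n \<le> y" "y - real n \<le> 1" using y by (auto simp: n_def le_nat_iff le_floor_iff) linarith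
    have "\<forall>k\<ge>n. a n - f (real n) \<le> a (Suc k) \<and> a (Suc k) \<le> a n" using a n by auto
    then have "a n - f (real n) \<le> c" "c \<le> a n"
      using LIMSEQ_le_const[OF c] LIMSEQ_le_const2[OF c] by blast+
    moreover have "(y - real n) * f y \<le> F y - F (real n)" "F y - F (real n) \<le> (y - real n) * f (real n)"
      using antimono_deriv_increment[OF deriv anti, of "real n" y] n by auto
    moreover have "0 \<le> (y - real n) * f y" "(y - real n) * f (real n) \<le> f (real n)"
      using n nonneg y by (auto intro!: mult_left_le_one_le)
    moreover have "(\<Sum>k\<in>nats_upto y. f (real k)) = a n + F (real n)" by (simp add: a_def nats_upto_eq n_def)
    ultimately show "\<bar>(\<Sum>k\<in>nats_upto y. f (real k)) - F y - c\<bar> \<le> f (real (nat \<lfloor>y\<rfloor>))"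
      unfolding n_def[symmetric] by linarith
  qed
qed

lemma sum_mono_asymptotics:
  fixes f F :: "real \<Rightarrow> real"
  assumes deriv: "\<And>t. t \<ge> 1 \<Longrightarrow> (F has_real_derivative f t) (at t)"
    and mono: "mono_on {1..} f" and nonneg: "\<And>t. t \<ge> 1 \<Longrightarrow> f t \<ge> 0" and y: "y \<ge> 1"
  shows "\<bar>(\<Sum>n\<in>nats_upto y. f (real n)) - (F y - F 1)\<bar> \<le> f y"
proof -
  define n where "n = nat \<lfloor>y\<rfloor>"
  have n: "1 \<le> n" "real n \<le> y" "y - real n \<le> 1" using y by (auto simp: n_def le_nat_iff le_floor_iff) linarith
  have deriv': "((\<lambda>t. - F t) has_real_derivative - f t) (at t)" if "t \<ge> 1" for t
    using deriv[OF that] by (rule DERIV_minus)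
  have anti: "antimono_on {1..} (\<lambda>t. - f t)" using mono by (auto simp: monotone_on_def)
  have "{1..n} = insert 1 {1<..n}" using n by auto
  then have sum: "(\<Sum>k\<in>nats_upto y. f (real k)) = f 1 + (\<Sum>k\<in>{1<..n}. f (real k))"
    by (simp add: nats_upto_eq n_def)
  have "F (real n) - F 1 \<le> (\<Sum>k\<in>{1<..n}. f (real k))"
    "(\<Sum>k\<in>{1<..n}. f (real k)) \<le> F (real n) - F 1 - (f 1 - f (real n))"
    using sum_antimono_bounds[of 1 "\<lambda>t. - F t" "\<lambda>t. - f t" n] deriv' anti n by (auto simp: sum_negf)
  moreover have "(y - real n) * f (real n) \<le> F y - F (real n)" "F y - F (real n) \<le> (y - real n) * f y"
    using antimono_deriv_increment[OF deriv' anti, of "real n" y] n by auto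
  moreover have "0 \<le> (y - real n) * f (real n)" "(y - real n) * f y \<le> f y"
    using n nonneg y by (auto intro!: mult_left_le_one_le)
  moreover have "0 \<le> f 1" "f 1 \<le> f (real n)" "f (real n) \<le> f y"
    using nonneg monotone_onD[OF mono] n y by auto
  ultimately show ?thesis unfolding sum by linarith
qed

section \<open>Selberg's formula\<close>

lemma real_nat_floor_ge_half: "y \<ge> 1 \<Longrightarrow> y / 2 \<le> real (nat \<lfloor>y\<rfloor>)"
proof -
  assume "y \<ge> 1"
  then have "1 \<le> \<lfloor>y\<rfloor>" by simp
  then show ?thesis by linarith
qed

lemma sum_inverse_asymptotics:
  obtains g where "\<And>y. y \<ge> 1 \<Longrightarrow> \<bar>(\<Sum>n\<in>nats_upto y. 1 / real n) - ln y - g\<bar> \<le> 2 / y"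
proof -
  obtain g where g: "\<And>y. y \<ge> 1 \<Longrightarrow> \<bar>(\<Sum>n\<in>nats_upto y. 1 / real n) - ln y - g\<bar> \<le> 1 / real (nat \<lfloor>y\<rfloor>)"
  proof (rule sum_antimono_asymptotics[of ln "\<lambda>t. 1 / t"])
    show "(ln has_real_derivative 1 / t) (at t)" if "t \<ge> 1" for t :: real
      using that by (auto intro!: derivative_eq_intros)
    show "antimono_on {1..} (\<lambda>t::real. 1 / t)" by (auto simp: monotone_on_def field_simps)
  qed auto
  show ?thesis
  proof (rule that)
    fix y :: real assume y: "y \<ge> 1"
    have "1 / real (nat \<lfloor>y\<rfloor>) \<le> 1 / (y / 2)"
      using real_nat_floor_ge_half[OF y] y by (intro divide_left_mono) auto
    then show "\<bar>(\<Sum>n\<in>nats_upto y. 1 / real n) - ln y - g\<bar> \<le> 2 / y" using g[OF y] by simp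
  qed
qed

lemma antimono_one_plus_ln_divide: "antimono_on {1..} (\<lambda>t::real. (1 + ln t) / t)"
proof (rule monotone_onI)
  fix s t :: real assume st: "s \<in> {1..}" "s \<le> t"
  show "(1 + ln t) / t \<le> (1 + ln s) / s"
  proof (rule DERIV_nonpos_imp_nonincreasing[OF st(2)])
    fix x assume "s \<le> x" "x \<le> t"
    then have "((\<lambda>x. (1 + ln x) / x) has_real_derivative - ln x / x\<^sup>2) (at x)" "- ln x / x\<^sup>2 \<le> 0"
      using st by (auto intro!: derivative_eq_intros simp: field_simps power2_eq_square)
    then show "\<exists>y. ((\<lambda>x. (1 + ln x) / x) has_real_derivative y) (at x) \<and> y \<le> 0" by blast
  qed
qed

lemma sum_one_plus_ln_divide_asymptotics:
  obtains c where
    "\<And>y. y \<ge> 1 \<Longrightarrow> \<bar>(\<Sum>n\<in>nats_upto y. (1 + ln (real n)) / real n) - (ln y + (ln y)\<^sup>2 / 2) - c\<bar> \<le> 2 * (1 + ln y) / y"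
proof -
  obtain c where c: "\<And>y. y \<ge> 1 \<Longrightarrow> \<bar>(\<Sum>n\<in>nats_upto y. (1 + ln (real n)) / real n) - (ln y + (ln y)\<^sup>2 / 2) - c\<bar>
      \<le> (1 + ln (real (nat \<lfloor>y\<rfloor>))) / real (nat \<lfloor>y\<rfloor>)"
  proof (rule sum_antimono_asymptotics[of "\<lambda>t. ln t + (ln t)\<^sup>2 / 2" "\<lambda>t. (1 + ln t) / t"])
    show "((\<lambda>t. ln t + (ln t)\<^sup>2 / 2) has_real_derivative (1 + ln t) / t) (at t)" if "t \<ge> 1" for t :: real
      using that by (auto intro!: derivative_eq_intros simp: field_simps)
  qed (auto intro: antimono_one_plus_ln_divide)
  show ?thesis
  proof (rule that)
    fix y :: real assume y: "y \<ge> 1"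
    have "(1 + ln (real (nat \<lfloor>y\<rfloor>))) / real (nat \<lfloor>y\<rfloor>) \<le> (1 + ln y) / (y / 2)"
      using real_nat_floor_ge_half[OF y] y by (intro frac_le) auto
    then show "\<bar>(\<Sum>n\<in>nats_upto y. (1 + ln (real n)) / real n) - (ln y + (ln y)\<^sup>2 / 2) - c\<bar> \<le> 2 * (1 + ln y) / y"
      using c[OF y] by (simp add: mult.commute)
  qed
qed

lemma sum_ln_asymptotics:
  assumes "x \<ge> 1"
  shows "\<bar>(\<Sum>n\<in>nats_upto x. ln (real n)) - (x * ln x - x)\<bar> \<le> ln x + 1"
proof -
  have "\<bar>(\<Sum>n\<in>nats_upto x. ln (real n)) - ((x * ln x - x) - (1 * ln 1 - 1))\<bar> \<le> ln x"
    using assms by (intro sum_mono_asymptotics[where F = "\<lambda>t. t * ln t - t" and f = ln])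
      (auto intro!: derivative_eq_intros simp: monotone_on_def)
  then show ?thesis by simp
qed

lemma sum_ln_squared_asymptotics:
  assumes "x \<ge> 1"
  shows "\<bar>(\<Sum>n\<in>nats_upto x. (ln (real n))\<^sup>2) - (x * (ln x)\<^sup>2 - 2 * x * ln x + 2 * x)\<bar> \<le> (ln x)\<^sup>2 + 2"
proof -
  have "mono_on {1..} (\<lambda>t::real. (ln t)\<^sup>2)" by (auto simp: monotone_on_def intro!: power_mono)
  then have "\<bar>(\<Sum>n\<in>nats_upto x. (ln (real n))\<^sup>2)
      - ((x * (ln x)\<^sup>2 - 2 * x * ln x + 2 * x) - (1 * (ln 1)\<^sup>2 - 2 * 1 * ln 1 + 2 * 1))\<bar> \<le> (ln x)\<^sup>2"
    using assms
    by (intro sum_mono_asymptotics[where F = "\<lambda>t. t * (ln t)\<^sup>2 - 2 * t * ln t + 2 * t" and f = "\<lambda>t. (ln t)\<^sup>2"])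
      (auto intro!: derivative_eq_intros simp: field_simps power2_eq_square)
  then show ?thesis by simp
qed

lemma sum_scaled_ln_eq:
  assumes "y > 0"
  shows "(\<Sum>n\<in>nats_upto y. 2 * (y / real n) * ln (y / real n) + a * (y / real n) + b)
    = y * (2 * ln y + 2 + a) * (\<Sum>n\<in>nats_upto y. 1 / real n)
      - 2 * y * (\<Sum>n\<in>nats_upto y. (1 + ln (real n)) / real n) + b * real (card (nats_upto y))"
proof -
  have "(\<Sum>n\<in>nats_upto y. 2 * (y / real n) * ln (y / real n) + a * (y / real n) + b)
      = (\<Sum>n\<in>nats_upto y. y * (2 * ln y + 2 + a) * (1 / real n) - 2 * y * ((1 + ln (real n)) / real n) + b)"
  proof (intro sum.cong refl)
    fix n assume "n \<in> nats_upto y"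
    then have n: "real n > 0" by (simp add: nats_upto_def)
    then have lnq: "ln (y / real n) = ln y - ln (real n)" using assms by (simp add: ln_div)
    show "2 * (y / real n) * ln (y / real n) + a * (y / real n) + b
        = y * (2 * ln y + 2 + a) * (1 / real n) - 2 * y * ((1 + ln (real n)) / real n) + b"
      unfolding lnq using n by (simp add: field_simps)
  qed
  then show ?thesis by (simp add: sum.distrib sum_subtractf sum_distrib_left)
qed

lemma abs_linear_error_le:
  fixes a b l r s t :: real
  assumes "l \<ge> 0" "\<bar>r\<bar> \<le> 2" "\<bar>s\<bar> \<le> 2 * (1 + l)" "\<bar>t\<bar> \<le> 1"
  shows "\<bar>(2 * l + 2 + a) * r - 2 * s - b * t\<bar> \<le> (8 + 2 * \<bar>a\<bar> + \<bar>b\<bar>) * (1 + l)"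
proof -
  have "\<bar>2 * l + 2 + a\<bar> \<le> 2 * l + 2 + \<bar>a\<bar>" using assms(1) by linarith
  then have "\<bar>(2 * l + 2 + a) * r\<bar> \<le> (2 * l + 2 + \<bar>a\<bar>) * 2"
    unfolding abs_mult[of "2 * l + 2 + a"] using assms by (intro mult_mono) auto
  moreover have "\<bar>b * t\<bar> \<le> \<bar>b\<bar>"
    unfolding abs_mult using assms(4) by (intro mult_left_le) auto
  ultimately have "\<bar>(2 * l + 2 + a) * r - 2 * s - b * t\<bar> \<le> (2 * l + 2 + \<bar>a\<bar>) * 2 + 2 * (2 * (1 + l)) + \<bar>b\<bar>"
    using assms(3) by linarith
  also have "\<dots> \<le> (8 + 2 * \<bar>a\<bar> + \<bar>b\<bar>) * (1 + l)"
    using mult_nonneg_nonneg[of "\<bar>a\<bar>" l] mult_nonneg_nonneg[of "\<bar>b\<bar>" l] assms(1) by (simp add: algebra_simps)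
  finally show ?thesis .
qed

text \<open>The constants are those for which the sum of \<open>2 t ln t + a t + b\<close> over \<open>t = y / n\<close> has the same
  main terms as the sum of \<open>(ln n)\<^sup>2\<close>.\<close>

lemma sum_scaled_ln_asymptotics:
  obtains a b C :: real where "C \<ge> 0"
    "\<And>y. y \<ge> 1 \<Longrightarrow> \<bar>(\<Sum>n\<in>nats_upto y. 2 * (y / real n) * ln (y / real n) + a * (y / real n) + b)
        - (y * (ln y)\<^sup>2 - 2 * y * ln y + 2 * y)\<bar> \<le> C * (1 + ln y)"
proof -
  obtain g where g: "\<And>y. y \<ge> 1 \<Longrightarrow> \<bar>(\<Sum>n\<in>nats_upto y. 1 / real n) - ln y - g\<bar> \<le> 2 / y"
    by (rule sum_inverse_asymptotics) (rule that)
  obtain c where c: "\<And>y. y \<ge> 1 \<Longrightarrow>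
      \<bar>(\<Sum>n\<in>nats_upto y. (1 + ln (real n)) / real n) - (ln y + (ln y)\<^sup>2 / 2) - c\<bar> \<le> 2 * (1 + ln y) / y"
    by (rule sum_one_plus_ln_divide_asymptotics) (rule that)
  define a where "a = - 2 - 2 * g"
  define b where "b = 2 + 2 * c + 2 * g\<^sup>2"
  define C where "C = 8 + 2 * \<bar>a\<bar> + \<bar>b\<bar>"
  have "\<bar>(\<Sum>n\<in>nats_upto y. 2 * (y / real n) * ln (y / real n) + a * (y / real n) + b)
        - (y * (ln y)\<^sup>2 - 2 * y * ln y + 2 * y)\<bar> \<le> C * (1 + ln y)" if y: "y \<ge> 1" for y
  proof -
    define l where "l = ln y"
    define e1 where "e1 = (\<Sum>n\<in>nats_upto y. 1 / real n) - l - g"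
    define e2 where "e2 = (\<Sum>n\<in>nats_upto y. (1 + ln (real n)) / real n) - (l + l\<^sup>2 / 2) - c"
    define e3 where "e3 = y - real (card (nats_upto y))"
    have l: "l \<ge> 0" using y by (simp add: l_def)
    have "\<bar>e1\<bar> \<le> 2 / y" "\<bar>e2\<bar> \<le> 2 * (1 + l) / y"
      using g[OF y] c[OF y] by (simp_all add: e1_def e2_def l_def)
    then have e1: "\<bar>y * e1\<bar> \<le> 2" and e2: "\<bar>y * e2\<bar> \<le> 2 * (1 + l)"
      using y by (auto simp: abs_mult field_simps)
    have e3: "\<bar>e3\<bar> \<le> 1" using card_nats_upto[of y] y by (auto simp: e3_def)
    have "(\<Sum>n\<in>nats_upto y. 2 * (y / real n) * ln (y / real n) + a * (y / real n) + b)
        = y * (2 * l + 2 + a) * (l + g + e1) - 2 * y * (l + l\<^sup>2 / 2 + c + e2) + b * (y - e3)"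
      using sum_scaled_ln_eq[of y a b] y by (simp add: e1_def e2_def e3_def l_def)
    then have "(\<Sum>n\<in>nats_upto y. 2 * (y / real n) * ln (y / real n) + a * (y / real n) + b)
        - (y * l\<^sup>2 - 2 * y * l + 2 * y) = (2 * l + 2 + a) * (y * e1) - 2 * (y * e2) - b * e3"
      unfolding a_def b_def by (simp add: algebra_simps power2_eq_square)
    then show ?thesis using abs_linear_error_le[OF l e1 e2 e3] by (simp add: C_def l_def)
  qed
  then show ?thesis using that[of C a b] by (simp add: C_def)
qed

lemma ln_squared_le_sqrt: "y \<ge> 1 \<Longrightarrow> (ln y)\<^sup>2 \<le> 16 * sqrt y"
proof -
  assume y: "y \<ge> 1"
  have "(ln y)\<^sup>2 \<le> (y powr (1/4) / (1/4))\<^sup>2" using ln_powr_bound[of y "1/4"] y by (intro power_mono) auto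
  also have "\<dots> = 16 * (y powr (1/4) * y powr (1/4))" by (simp add: power2_eq_square)
  also have "\<dots> = 16 * sqrt y" using y by (simp add: powr_half_sqrt flip: powr_add)
  finally show ?thesis .
qed

lemma sum_ln_squared_comparison:
  obtains a b C :: real where "C \<ge> 0"
    "\<And>y. y \<ge> 1 \<Longrightarrow> \<bar>(\<Sum>n\<in>nats_upto y. (ln (real n))\<^sup>2)
        - (\<Sum>n\<in>nats_upto y. 2 * (y / real n) * ln (y / real n) + a * (y / real n) + b)\<bar> \<le> C * sqrt y"
proof -
  obtain a b C where C: "C \<ge> 0"
    and main: "\<And>y. y \<ge> 1 \<Longrightarrow> \<bar>(\<Sum>n\<in>nats_upto y. 2 * (y / real n) * ln (y / real n) + a * (y / real n) + b)
        - (y * (ln y)\<^sup>2 - 2 * y * ln y + 2 * y)\<bar> \<le> C * (1 + ln y)"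
    by (rule sum_scaled_ln_asymptotics) (rule that)
  have "\<bar>(\<Sum>n\<in>nats_upto y. (ln (real n))\<^sup>2)
        - (\<Sum>n\<in>nats_upto y. 2 * (y / real n) * ln (y / real n) + a * (y / real n) + b)\<bar> \<le> (18 + 18 * C) * sqrt y"
    if y: "y \<ge> 1" for y
  proof -
    have s: "1 \<le> sqrt y" and l: "(ln y)\<^sup>2 \<le> 16 * sqrt y" using y ln_squared_le_sqrt by auto
    have "ln y \<le> 1 + (ln y)\<^sup>2" using zero_le_power2[of "ln y - 1"] ln_ge_zero[OF y]
      by (simp add: power2_diff)
    then have "1 + ln y \<le> 18 * sqrt y" using s l by linarith
    then have "C * (1 + ln y) \<le> C * (18 * sqrt y)" using C by (rule mult_left_mono)
    then have "C * (1 + ln y) \<le> 18 * C * sqrt y" by simp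
    then show ?thesis
      using main[OF y] sum_ln_squared_asymptotics[OF y] s l unfolding distrib_right by linarith
  qed
  then show ?thesis using that[of "18 + 18 * C" a b] C by auto
qed

lemma sum_inverse_sqrt_le: "(\<Sum>k=1..n. 1 / sqrt (real k)) \<le> 2 * sqrt (real n)"
proof (cases "n = 0")
  case False
  have "(\<Sum>k\<in>{1<..n}. 1 / sqrt (real k)) \<le> 2 * sqrt (real n) - 2 * sqrt (real 1)"
  proof (rule sum_antimono_bounds(1)[where F = "\<lambda>t. 2 * sqrt t" and f = "\<lambda>t. 1 / sqrt t"])
    show "((\<lambda>t. 2 * sqrt t) has_real_derivative 1 / sqrt t) (at t)" if "t \<ge> real 1" for t
      using that by (auto intro!: derivative_eq_intros simp: field_simps)
  qed (use False in \<open>auto simp: monotone_on_def intro!: divide_left_mono\<close>)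
  moreover have "{1..n} = insert 1 {1<..n}" using False by auto
  ultimately show ?thesis by simp
qed simp

definition mangoldt_conv :: "nat \<Rightarrow> real" where
  "mangoldt_conv = dirichlet_prod mangoldt mangoldt"

definition mangoldt2 :: "nat \<Rightarrow> real" where
  "mangoldt2 n = mangoldt n * ln (real n) + mangoldt_conv n"

lemma mangoldt_conv_nonneg: "mangoldt_conv n \<ge> 0"
  unfolding mangoldt_conv_def dirichlet_prod_def by (intro sum_nonneg mult_nonneg_nonneg mangoldt_nonneg)

lemma mangoldt_mult_ln_nonneg: "0 \<le> mangoldt n * ln (real n)"
  by (cases "n = 0") (auto intro!: mult_nonneg_nonneg mangoldt_nonneg)

lemma mangoldt2_nonneg: "mangoldt2 n \<ge> 0"
  by (simp add: mangoldt2_def mangoldt_mult_ln_nonneg mangoldt_conv_nonneg)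

lemma sum_mangoldt_conv_divisors:
  assumes "n > 0"
  shows "(\<Sum>d | d dvd n. mangoldt_conv d) = (\<Sum>d | d dvd n. mangoldt d * (ln (real n) - ln (real d)))"
proof -
  have "(\<Sum>d | d dvd n. mangoldt_conv d) = dirichlet_prod mangoldt_conv (\<lambda>_. 1) n"
    by (simp add: dirichlet_prod_def)
  also have "\<dots> = dirichlet_prod mangoldt (dirichlet_prod mangoldt (\<lambda>_. 1)) n"
    unfolding mangoldt_conv_def by (rule dirichlet_prod_assoc[OF assms])
  also have "\<dots> = (\<Sum>d | d dvd n. mangoldt d * (\<Sum>e | e dvd n div d. mangoldt e))"
    by (simp add: dirichlet_prod_def)
  also have "\<dots> = (\<Sum>d | d dvd n. mangoldt d * (ln (real n) - ln (real d)))"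
  proof (intro sum.cong refl)
    fix d assume "d \<in> {d. d dvd n}"
    then obtain m where m: "n = d * m" "d > 0" "m > 0" using assms by (auto elim!: dvdE)
    then show "mangoldt d * (\<Sum>e | e dvd n div d. mangoldt e) = mangoldt d * (ln (real n) - ln (real d))"
      using mangoldt_sum[of m, where ?'a = real] by (simp add: ln_mult)
  qed
  finally show ?thesis .
qed

lemma sum_mangoldt2_divisors:
  assumes "n > 0"
  shows "(\<Sum>d | d dvd n. mangoldt2 d) = (ln (real n))\<^sup>2"
proof -
  have "(\<Sum>d | d dvd n. mangoldt2 d) = (\<Sum>d | d dvd n. mangoldt d * ln (real n))"
    using sum_mangoldt_conv_divisors[OF assms]
    by (simp add: mangoldt2_def sum.distrib sum_subtractf right_diff_distrib)
  then show ?thesis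
    using mangoldt_sum[of n, where ?'a = real] assms by (simp add: power2_eq_square flip: sum_distrib_right)
qed

definition selberg_sum :: "real \<Rightarrow> real" where
  "selberg_sum x = (\<Sum>n\<in>nats_upto x. mangoldt2 n)"

lemma selberg_sum_nonneg: "selberg_sum x \<ge> 0"
  unfolding selberg_sum_def by (intro sum_nonneg mangoldt2_nonneg)

lemma sum_selberg_sum: "(\<Sum>m\<in>nats_upto x. selberg_sum (x / real m)) = (\<Sum>n\<in>nats_upto x. (ln (real n))\<^sup>2)"
proof -
  have "(\<Sum>m\<in>nats_upto x. selberg_sum (x / real m)) = (\<Sum>n\<in>nats_upto x. \<Sum>d | d dvd n. mangoldt2 (n div d))"
    unfolding selberg_sum_def by (rule sum_nats_upto_divisors)
  also have "\<dots> = (\<Sum>n\<in>nats_upto x. (ln (real n))\<^sup>2)"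
    by (intro sum.cong refl) (simp add: sum_divisors_div sum_mangoldt2_divisors nats_upto_def)
  finally show ?thesis .
qed

lemma sum_divide_le_sqrt_imp_abs_le:
  fixes R :: "real \<Rightarrow> real"
  assumes R: "\<And>y. y \<ge> 1 \<Longrightarrow> \<bar>\<Sum>n\<in>nats_upto y. R (y / real n)\<bar> \<le> C * sqrt y" and "C \<ge> 0" "x \<ge> 1"
  shows "\<bar>R x\<bar> \<le> 2 * C * x"
proof -
  have "\<bar>R x\<bar> = \<bar>\<Sum>d\<in>nats_upto x. moebius_mu d * (\<Sum>n\<in>nats_upto (x / real d). R (x / real d / real n))\<bar>"
    by (simp only: moebius_inversion_nats_upto[OF \<open>x \<ge> 1\<close>])
  also have "\<dots> \<le> (\<Sum>d\<in>nats_upto x. C * sqrt (x / real d))"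
  proof (rule order_trans[OF sum_abs sum_mono])
    fix d assume d: "d \<in> nats_upto x"
    have "\<bar>moebius_mu d * (\<Sum>n\<in>nats_upto (x / real d). R (x / real d / real n))\<bar> \<le> 1 * (C * sqrt (x / real d))"
      unfolding abs_mult using d by (intro mult_mono abs_moebius_mu_le_1 R) (auto simp: nats_upto_def)
    then show "\<bar>moebius_mu d * (\<Sum>n\<in>nats_upto (x / real d). R (x / real d / real n))\<bar> \<le> C * sqrt (x / real d)"
      by simp
  qed
  also have "\<dots> = C * sqrt x * (\<Sum>k=1..nat \<lfloor>x\<rfloor>. 1 / sqrt (real k))"
    by (simp add: nats_upto_eq real_sqrt_divide sum_distrib_left)
  also have "\<dots> \<le> C * sqrt x * (2 * sqrt x)"
  proof (intro mult_left_mono)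
    have "2 * sqrt (real (nat \<lfloor>x\<rfloor>)) \<le> 2 * sqrt x" using \<open>x \<ge> 1\<close> by simp
    then show "(\<Sum>k=1..nat \<lfloor>x\<rfloor>. 1 / sqrt (real k)) \<le> 2 * sqrt x"
      using sum_inverse_sqrt_le order_trans by blast
  qed (use assms in auto)
  also have "\<dots> = 2 * C * x" using \<open>x \<ge> 1\<close> by simp
  finally show ?thesis .
qed

theorem selberg_formula:
  obtains C where "C > 0" "\<And>x. x \<ge> 1 \<Longrightarrow> \<bar>selberg_sum x - 2 * x * ln x\<bar> \<le> C * x"
proof -
  obtain a b C where C: "C \<ge> 0"
    and comparison: "\<And>y. y \<ge> 1 \<Longrightarrow> \<bar>(\<Sum>n\<in>nats_upto y. (ln (real n))\<^sup>2)
        - (\<Sum>n\<in>nats_upto y. 2 * (y / real n) * ln (y / real n) + a * (y / real n) + b)\<bar> \<le> C * sqrt y"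
    by (rule sum_ln_squared_comparison) (rule that)
  define R where "R = (\<lambda>y. selberg_sum y - (2 * y * ln y + a * y + b))"
  have R: "\<bar>\<Sum>n\<in>nats_upto y. R (y / real n)\<bar> \<le> C * sqrt y" if "y \<ge> 1" for y
    using comparison[OF that] by (simp add: R_def sum_subtractf sum_selberg_sum)
  have "\<bar>selberg_sum x - 2 * x * ln x\<bar> \<le> (2 * C + \<bar>a\<bar> + \<bar>b\<bar> + 1) * x" if x: "x \<ge> 1" for x
  proof -
    have "\<bar>R x\<bar> \<le> 2 * C * x" using R C x by (rule sum_divide_le_sqrt_imp_abs_le)
    then have "\<bar>selberg_sum x - 2 * x * ln x\<bar> \<le> 2 * C * x + \<bar>a * x + b\<bar>" unfolding R_def by linarith
    also have "\<bar>a * x + b\<bar> \<le> \<bar>a\<bar> * x + \<bar>b\<bar> * x"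
      using x mult_left_mono[of 1 x "\<bar>b\<bar>"] by (intro order_trans[OF abs_triangle_ineq]) (auto simp: abs_mult)
    finally show ?thesis using x by (simp add: algebra_simps)
  qed
  moreover have "2 * C + \<bar>a\<bar> + \<bar>b\<bar> + 1 > 0" using C by linarith
  ultimately show ?thesis using that by blast
qed

section \<open>The Chebyshev function and Mertens' theorem\<close>

definition psi :: "real \<Rightarrow> real" where
  "psi x = (\<Sum>n\<in>nats_upto x. mangoldt n)"

lemma psi_mono: "x \<le> y \<Longrightarrow> psi x \<le> psi y"
  unfolding psi_def by (intro sum_mono2 nats_upto_mono mangoldt_nonneg) auto

lemma psi_nonneg: "psi x \<ge> 0"
  unfolding psi_def by (intro sum_nonneg mangoldt_nonneg)

lemma psi_diff: "x \<le> y \<Longrightarrow> psi y - psi x = (\<Sum>n\<in>nats_upto y - nats_upto x. mangoldt n)"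
  using nats_upto_mono[of x y] by (simp add: psi_def sum_diff)

lemma psi_le_mult_ln: "x \<ge> 1 \<Longrightarrow> psi x \<le> x * ln x"
proof -
  assume x: "x \<ge> 1"
  have "psi x \<le> (\<Sum>n\<in>nats_upto x. ln x)"
    unfolding psi_def
  proof (rule sum_mono)
    fix n assume "n \<in> nats_upto x"
    then have "0 < n" "real n \<le> x" by (auto simp: nats_upto_def)
    then show "mangoldt n \<le> ln x" by (intro order_trans[OF mangoldt_le]) auto
  qed
  also have "\<dots> \<le> x * ln x" using x card_nats_upto[of x] by (simp add: mult_right_mono)
  finally show ?thesis .
qed

lemma sum_mangoldt_conv: "(\<Sum>n\<in>nats_upto x. mangoldt_conv n) = (\<Sum>a\<in>nats_upto x. mangoldt a * psi (x / real a))"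
  by (simp add: mangoldt_conv_def sum_dirichlet_prod psi_def)

lemma selberg_sum_diff:
  assumes "x \<le> y"
  shows "selberg_sum y - selberg_sum x = (\<Sum>n\<in>nats_upto y - nats_upto x. mangoldt n * ln (real n) + mangoldt_conv n)"
  using nats_upto_mono[OF assms] by (simp add: selberg_sum_def mangoldt2_def sum_diff)

lemma psi_diff_le_selberg_sum_diff:
  assumes "1 \<le> x" "x \<le> y"
  shows "ln x * (psi y - psi x) \<le> selberg_sum y - selberg_sum x"
  unfolding psi_diff[OF assms(2)] selberg_sum_diff[OF assms(2)] sum_distrib_left
proof (rule sum_mono)
  fix n assume "n \<in> nats_upto y - nats_upto x"
  then have "x < real n" by (auto simp: nats_upto_def)
  then have "ln x * mangoldt n \<le> ln (real n) * mangoldt n"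
    using assms by (intro mult_right_mono mangoldt_nonneg) auto
  then show "ln x * mangoldt n \<le> mangoldt n * ln (real n) + mangoldt_conv n"
    using mangoldt_conv_nonneg[of n] by (simp add: mult.commute)
qed

lemma chebyshev_upper:
  obtains C where "C > 0" "\<And>x. x \<ge> 0 \<Longrightarrow> psi x \<le> C * x"
proof -
  obtain C where C: "C > 0" "\<And>x. x \<ge> 1 \<Longrightarrow> \<bar>selberg_sum x - 2 * x * ln x\<bar> \<le> C * x"
    by (rule selberg_formula) (rule that)
  have "psi x \<le> (5 + 2 * C) * x" if "x \<ge> 0" for x
  proof -
    consider "x < 1" | "x \<ge> 1" "ln x \<le> 1" | "x \<ge> 1" "ln x > 1" by linarith
    then show ?thesis
    proof cases
      case 1
      then show ?thesis using \<open>x \<ge> 0\<close> C(1) by (simp add: psi_def nats_upto_empty)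
    next
      case 2
      then have "x * ln x \<le> x * (5 + 2 * C)" using C(1) by (intro mult_left_mono) auto
      then show ?thesis using psi_le_mult_ln[OF 2(1)] by (simp add: mult.commute)
    next
      case 3
      then have "x > 1" by (cases "x = 1") auto
      then have s: "1 \<le> sqrt x" "sqrt x \<le> x" using 3 by (auto intro!: real_le_lsqrt simp: power2_eq_square)
      have "ln (sqrt x) * (psi x - psi (sqrt x)) \<le> 2 * x * ln x + C * x"
        using psi_diff_le_selberg_sum_diff[OF s] selberg_sum_nonneg[of "sqrt x"] C(2)[OF 3(1)] by linarith
      also have "\<dots> \<le> (2 + C) * x * ln x"
        using mult_left_mono[of 1 "ln x" "C * x"] C(1) 3 by (simp add: algebra_simps)
      finally have "ln x * (psi x - psi (sqrt x)) \<le> ln x * (2 * (2 + C) * x)"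
        using 3 by (simp add: ln_sqrt algebra_simps)
      then have "psi x - psi (sqrt x) \<le> 2 * (2 + C) * x"
        using \<open>x > 1\<close> by (subst (asm) mult_le_cancel_left_pos) auto
      moreover have "psi (sqrt x) \<le> sqrt x * ln (sqrt x)" using psi_le_mult_ln[OF s(1)] .
      moreover have "sqrt x * ln (sqrt x) \<le> sqrt x * sqrt x"
        using ln_le_minus_one[of "sqrt x"] s by (intro mult_left_mono) auto
      ultimately show ?thesis using 3 by (simp add: algebra_simps)
    qed
  qed
  then show ?thesis using that[of "5 + 2 * C"] C by auto
qed

definition mertens :: "real \<Rightarrow> real" where
  "mertens x = (\<Sum>n\<in>nats_upto x. mangoldt n / real n)"

lemma sum_ln_eq_sum_mangoldt:
  "(\<Sum>n\<in>nats_upto x. ln (real n)) = (\<Sum>d\<in>nats_upto x. mangoldt d * real (card (nats_upto (x / real d))))"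
proof -
  have "(\<Sum>n\<in>nats_upto x. ln (real n)) = (\<Sum>n\<in>nats_upto x. \<Sum>d | d dvd n. mangoldt d)"
    by (intro sum.cong refl) (simp add: mangoldt_sum nats_upto_def)
  also have "\<dots> = (\<Sum>d\<in>nats_upto x. \<Sum>b\<in>nats_upto (x / real d). mangoldt d)"
    by (rule sum_nats_upto_divisors[symmetric])
  finally show ?thesis by (simp add: mult.commute)
qed

lemma mertens_estimate:
  obtains K where "K > 0" "\<And>x. x \<ge> 1 \<Longrightarrow> \<bar>mertens x - ln x\<bar> \<le> K"
proof -
  obtain C where C: "C > 0" "\<And>x. x \<ge> 0 \<Longrightarrow> psi x \<le> C * x" by (rule chebyshev_upper) (rule that)
  have "\<bar>mertens x - ln x\<bar> \<le> C + 3" if x: "x \<ge> 1" for x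
  proof -
    have "\<bar>x * mertens x - (\<Sum>n\<in>nats_upto x. ln (real n))\<bar>
        = \<bar>\<Sum>d\<in>nats_upto x. mangoldt d * (x / real d - real (card (nats_upto (x / real d))))\<bar>"
      by (simp add: sum_ln_eq_sum_mangoldt mertens_def sum_distrib_left sum_subtractf[symmetric] algebra_simps)
    also have "\<dots> \<le> (\<Sum>d\<in>nats_upto x. mangoldt d * 1)"
    proof (rule order_trans[OF sum_abs sum_mono])
      fix d
      have "x / real d \<ge> 0" using x by simp
      then have "\<bar>x / real d - real (card (nats_upto (x / real d)))\<bar> \<le> 1"
        using card_nats_upto[of "x / real d"] by linarith
      then show "\<bar>mangoldt d * (x / real d - real (card (nats_upto (x / real d))))\<bar> \<le> mangoldt d * 1"
        unfolding abs_mult abs_mangoldt by (intro mult_left_mono mangoldt_nonneg)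
    qed
    also have "\<dots> \<le> C * x" using C(2)[of x] x by (simp add: psi_def)
    finally have "\<bar>x * mertens x - x * ln x\<bar> \<le> C * x + x + ln x + 1"
      using sum_ln_asymptotics[OF x] x by linarith
    also have "\<dots> \<le> (C + 3) * x" using ln_le_minus_one[of x] x by (simp add: algebra_simps)
    also have "\<bar>x * mertens x - x * ln x\<bar> = x * \<bar>mertens x - ln x\<bar>"
      using x by (simp add: abs_mult flip: right_diff_distrib)
    finally show ?thesis using x by (simp add: mult.commute)
  qed
  then show ?thesis using that[of "C + 3"] C by auto
qed

lemma sum_inverse_squares_le: "(\<Sum>k=1..n. 1 / (real k)\<^sup>2) \<le> 2"
proof (cases "n = 0")
  case False
  have "(\<Sum>k\<in>{1<..n}. 1 / (real k)\<^sup>2) \<le> - (1 / real n) - - (1 / real 1)"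
  proof (rule sum_antimono_bounds(1)[where F = "\<lambda>t. - (1 / t)" and f = "\<lambda>t. 1 / t\<^sup>2"])
    show "((\<lambda>t. - (1 / t)) has_real_derivative 1 / t\<^sup>2) (at t)" if "t \<ge> real 1" for t
      using that by (auto intro!: derivative_eq_intros simp: power2_eq_square)
  qed (use False in \<open>auto simp: monotone_on_def intro!: divide_left_mono power_mono\<close>)
  also have "- (1 / real n) - - (1 / real 1) \<le> 1" by simp
  finally have "(\<Sum>k\<in>{1<..n}. 1 / (real k)\<^sup>2) \<le> 1" .
  moreover have "{1..n} = insert 1 {1<..n}" using False by auto
  ultimately show ?thesis by simp
qed simp

lemma ln_le_sum_inverse: "x \<ge> 1 \<Longrightarrow> ln x \<le> (\<Sum>n\<in>nats_upto x. 1 / real n)"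
proof -
  assume "x \<ge> 1"
  then have "ln x \<le> ln (real (nat \<lfloor>x\<rfloor>) + 1)" by (subst ln_le_cancel_iff) linarith+
  also have "\<dots> \<le> harm (nat \<lfloor>x\<rfloor>)" by (rule ln_le_harm)
  also have "\<dots> = (\<Sum>n\<in>nats_upto x. 1 / real n)" by (simp add: harm_def nats_upto_eq inverse_eq_divide)
  finally show ?thesis .
qed

lemma sum_mangoldt_ln_divide_le:
  obtains C where "C > 0" "\<And>x. x \<ge> 1 \<Longrightarrow> (\<Sum>n\<in>nats_upto x. mangoldt n * ln (x / real n)) \<le> C * x"
proof -
  obtain C where C: "C > 0" "\<And>x. x \<ge> 0 \<Longrightarrow> psi x \<le> C * x" by (rule chebyshev_upper) (rule that)
  have "(\<Sum>n\<in>nats_upto x. mangoldt n * ln (x / real n)) \<le> 2 * C * x" if x: "x \<ge> 1" for x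
  proof -
    have "(\<Sum>n\<in>nats_upto x. mangoldt n * ln (x / real n))
        \<le> (\<Sum>n\<in>nats_upto x. mangoldt n * (\<Sum>m\<in>nats_upto (x / real n). 1 / real m))"
      by (intro sum_mono mult_left_mono ln_le_sum_inverse mangoldt_nonneg) (auto simp: nats_upto_def)
    also have "\<dots> = (\<Sum>m\<in>nats_upto x. 1 / real m * psi (x / real m))"
      unfolding psi_def by (rule sum_nats_upto_swap)
    also have "\<dots> \<le> (\<Sum>m\<in>nats_upto x. 1 / real m * (C * (x / real m)))"
      using x by (intro sum_mono mult_left_mono C(2)) auto
    also have "\<dots> = C * x * (\<Sum>m=1..nat \<lfloor>x\<rfloor>. 1 / (real m)\<^sup>2)"
      by (simp add: nats_upto_eq sum_distrib_left power2_eq_square)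
    also have "\<dots> \<le> C * x * 2" using C(1) x by (intro mult_left_mono sum_inverse_squares_le) auto
    finally show ?thesis by simp
  qed
  then show ?thesis using that[of "2 * C"] C(1) by auto
qed

section \<open>The error term in the prime number theorem\<close>

definition psi_error :: "real \<Rightarrow> real" where
  "psi_error x = psi x / x - 1"

lemma psi_error_bounded:
  obtains B where "B > 0" "\<And>x. x > 0 \<Longrightarrow> \<bar>psi_error x\<bar> \<le> B"
proof -
  obtain C where C: "C > 0" "\<And>x. x \<ge> 0 \<Longrightarrow> psi x \<le> C * x" by (rule chebyshev_upper) (rule that)
  have "\<bar>psi_error x\<bar> \<le> C + 1" if "x > 0" for x
  proof -
    have "psi x / x \<le> C" "psi x / x \<ge> 0" using C(2)[of x] psi_nonneg[of x] that by (auto simp: field_simps)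
    then show ?thesis unfolding psi_error_def using C(1) by linarith
  qed
  then show ?thesis using that[of "C + 1"] C by auto
qed

definition selberg_relation :: "(real \<Rightarrow> real) \<Rightarrow> real \<Rightarrow> bool" where
  "selberg_relation E K \<longleftrightarrow>
     (\<forall>x\<ge>1. \<bar>E x * ln x + (\<Sum>a\<in>nats_upto x. mangoldt a / real a * E (x / real a))\<bar> \<le> K)"

lemma selberg_relationD:
  "selberg_relation E K \<Longrightarrow> x \<ge> 1 \<Longrightarrow>
    \<bar>E x * ln x + (\<Sum>a\<in>nats_upto x. mangoldt a / real a * E (x / real a))\<bar> \<le> K"
  by (simp add: selberg_relation_def)

lemma selberg_sum_psi:
  assumes "x \<ge> 1"
  shows "selberg_sum x = psi x * ln x - (\<Sum>n\<in>nats_upto x. mangoldt n * ln (x / real n))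
       + (\<Sum>a\<in>nats_upto x. mangoldt a * psi (x / real a))"
proof -
  have "mangoldt n * ln (real n) = mangoldt n * ln x - mangoldt n * ln (x / real n)" if "n \<in> nats_upto x" for n
    using that assms by (simp add: nats_upto_def ln_div right_diff_distrib)
  then have "(\<Sum>n\<in>nats_upto x. mangoldt n * ln (real n))
      = psi x * ln x - (\<Sum>n\<in>nats_upto x. mangoldt n * ln (x / real n))"
    by (simp add: psi_def sum_distrib_right sum_subtractf cong: sum.cong)
  then show ?thesis
    by (simp add: selberg_sum_def mangoldt2_def sum.distrib sum_mangoldt_conv)
qed

lemma selberg_relation_psi_error: obtains K where "selberg_relation psi_error K"
proof -
  obtain C where C: "\<And>x. x \<ge> 1 \<Longrightarrow> \<bar>selberg_sum x - 2 * x * ln x\<bar> \<le> C * x" by (rule selberg_formula) (rule that)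
  obtain C' where C': "\<And>x. x \<ge> 1 \<Longrightarrow> (\<Sum>n\<in>nats_upto x. mangoldt n * ln (x / real n)) \<le> C' * x"
    by (rule sum_mangoldt_ln_divide_le) (rule that)
  obtain K where K: "\<And>x. x \<ge> 1 \<Longrightarrow> \<bar>mertens x - ln x\<bar> \<le> K" by (rule mertens_estimate) (rule that)
  have "\<bar>psi_error x * ln x + (\<Sum>a\<in>nats_upto x. mangoldt a / real a * psi_error (x / real a))\<bar> \<le> C + C' + K"
    if x: "x \<ge> 1" for x
  proof -
    have "0 \<le> (\<Sum>n\<in>nats_upto x. mangoldt n * ln (x / real n))"
      by (intro sum_nonneg mult_nonneg_nonneg mangoldt_nonneg) (auto simp: nats_upto_def)
    then have "\<bar>psi x * ln x + (\<Sum>a\<in>nats_upto x. mangoldt a * psi (x / real a)) - 2 * x * ln x\<bar> \<le> (C + C') * x"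
      using C[OF x] C'[OF x] selberg_sum_psi[OF x] unfolding distrib_right by linarith
    moreover have "psi x * ln x + (\<Sum>a\<in>nats_upto x. mangoldt a * psi (x / real a)) - 2 * x * ln x
        = x * (psi x / x * ln x
          + (\<Sum>a\<in>nats_upto x. mangoldt a / real a * (psi (x / real a) / (x / real a))) - 2 * ln x)"
      using x by (simp add: field_simps sum_distrib_left nats_upto_def)
    ultimately have "\<bar>psi x / x * ln x + (\<Sum>a\<in>nats_upto x. mangoldt a / real a * (psi (x / real a) / (x / real a)))
        - 2 * ln x\<bar> \<le> C + C'"
      using x by (simp add: abs_mult mult.commute)
    moreover have "(\<Sum>a\<in>nats_upto x. mangoldt a / real a * (psi (x / real a) / (x / real a)))
        = (\<Sum>a\<in>nats_upto x. mangoldt a / real a * psi_error (x / real a)) + mertens x"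
      by (simp add: psi_error_def mertens_def ring_distribs sum_subtractf)
    moreover have "psi x / x = psi_error x + 1" by (simp add: psi_error_def)
    ultimately show ?thesis using K[OF x] by (simp add: distrib_right)
  qed
  then show ?thesis using that by (auto simp: selberg_relation_def)
qed

lemma psi_short_interval:
  obtains C where "C > 0" "\<And>x y. 2 \<le> x \<Longrightarrow> x \<le> y \<Longrightarrow> y \<le> 2 * x \<Longrightarrow> psi y - psi x \<le> 2 * (y - x) + C * x / ln x"
proof -
  obtain C where C: "C > 0" "\<And>x. x \<ge> 1 \<Longrightarrow> \<bar>selberg_sum x - 2 * x * ln x\<bar> \<le> C * x"
    by (rule selberg_formula) (rule that)
  have "psi y - psi x \<le> 2 * (y - x) + (4 + 3 * C) * x / ln x" if "2 \<le> x" "x \<le> y" "y \<le> 2 * x" for x y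
  proof -
    have lx: "ln x > 0" using that by simp
    have "ln y - ln x = ln (y / x)" using that by (simp add: ln_div)
    also have "\<dots> \<le> y / x - 1" using ln_le_minus_one[of "y / x"] that by simp
    also have "\<dots> \<le> 1" using that by (simp add: field_simps)
    finally have ly: "ln y \<le> ln x + 1" by simp
    have "ln x * (psi y - psi x) \<le> selberg_sum y - selberg_sum x" using psi_diff_le_selberg_sum_diff that by simp
    also have "\<dots> \<le> 2 * y * ln y - 2 * x * ln x + C * y + C * x" using C(2)[of x] C(2)[of y] that by simp
    also have "\<dots> \<le> 2 * y * (ln x + 1) - 2 * x * ln x + C * (2 * x) + C * x"
      using that ly C by (intro add_mono diff_mono mult_left_mono) auto
    also have "\<dots> \<le> 2 * (y - x) * ln x + (4 + 3 * C) * x" using that by (simp add: algebra_simps)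
    finally show ?thesis using lx by (simp add: field_simps)
  qed
  then show ?thesis using that[of "4 + 3 * C"] C by auto
qed

definition oscillation_le :: "(real \<Rightarrow> real) \<Rightarrow> real \<Rightarrow> real \<Rightarrow> bool" where
  "oscillation_le E h e \<longleftrightarrow> eventually (\<lambda>x. \<forall>y\<in>{x..exp h * x}. \<bar>E y - E x\<bar> \<le> e) at_top"

definition slowly_oscillating :: "(real \<Rightarrow> real) \<Rightarrow> bool" where
  "slowly_oscillating E \<longleftrightarrow> (\<forall>e>0. \<exists>h>0. oscillation_le E h e)"

lemma psi_error_lipschitz:
  obtains C where "C > 0" "\<And>x y. 2 \<le> x \<Longrightarrow> x \<le> y \<Longrightarrow> y \<le> 2 * x \<Longrightarrow>
    \<bar>psi_error y - psi_error x\<bar> \<le> C * ((y - x) / x) + C / ln x"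
proof -
  obtain C where C: "C > 0" "\<And>x y. 2 \<le> x \<Longrightarrow> x \<le> y \<Longrightarrow> y \<le> 2 * x \<Longrightarrow> psi y - psi x \<le> 2 * (y - x) + C * x / ln x"
    by (rule psi_short_interval) (rule that)
  obtain C' where C': "C' > 0" "\<And>x. x \<ge> 0 \<Longrightarrow> psi x \<le> C' * x" by (rule chebyshev_upper) (rule that)
  define M where "M = 2 + C + C'"
  have "\<bar>psi_error y - psi_error x\<bar> \<le> M * ((y - x) / x) + M / ln x" if xy: "2 \<le> x" "x \<le> y" "y \<le> 2 * x" for x y
  proof -
    have lx: "ln x > 0" using xy by simp
    have upper: "(psi y - psi x) / y \<le> 2 * ((y - x) / x) + C / ln x"
    proof -
      have "(psi y - psi x) / y \<le> (2 * (y - x) + C * x / ln x) / x"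
        using xy C(2)[of x y] psi_mono[of x y] by (intro frac_le) auto
      then show ?thesis using xy lx by (simp add: field_simps)
    qed
    have lower: "psi x * (y - x) / (x * y) \<le> C' * ((y - x) / x)"
    proof -
      have "psi x * (y - x) / (x * y) \<le> (C' * x) * (y - x) / (x * x)"
        using C'(1) C'(2)[of x] xy by (intro frac_le mult_right_mono mult_left_mono mult_nonneg_nonneg) auto
      then show ?thesis using xy by simp
    qed
    have "psi_error y - psi_error x = (psi y - psi x) / y - psi x * (y - x) / (x * y)"
      using xy unfolding psi_error_def by (simp add: field_simps)
    moreover have "0 \<le> (psi y - psi x) / y" "0 \<le> psi x * (y - x) / (x * y)"
      using xy psi_mono[of x y] psi_nonneg[of x] by auto
    moreover have "0 \<le> (y - x) / x" "0 \<le> C / ln x" using xy lx C(1) by auto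
    ultimately have "\<bar>psi_error y - psi_error x\<bar> \<le> (2 + C') * ((y - x) / x) + C / ln x"
      using upper lower unfolding distrib_right by linarith
    also have "\<dots> \<le> M * ((y - x) / x) + M / ln x"
      using xy lx C C' by (intro add_mono mult_right_mono divide_right_mono) (auto simp: M_def)
    finally show ?thesis .
  qed
  then show ?thesis using that[of M] C C' by (auto simp: M_def)
qed

lemma slowly_oscillating_psi_error: "slowly_oscillating psi_error"
  unfolding slowly_oscillating_def
proof (intro allI impI)
  fix e :: real assume e: "e > 0"
  obtain C where C: "C > 0" "\<And>x y. 2 \<le> x \<Longrightarrow> x \<le> y \<Longrightarrow> y \<le> 2 * x \<Longrightarrow>
      \<bar>psi_error y - psi_error x\<bar> \<le> C * ((y - x) / x) + C / ln x"
    by (rule psi_error_lipschitz) (rule that)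
  define d where "d = min 1 (e / (2 * C))"
  have d: "0 < d" "d \<le> 1" "C * d \<le> e / 2" using e C(1) by (auto simp: d_def min_def field_simps)
  have "((\<lambda>x. C / ln x) \<longlongrightarrow> 0) at_top" by real_asymp
  then have "eventually (\<lambda>x. C / ln x < e / 2) at_top" using e by (intro order_tendstoD) auto
  then have "oscillation_le psi_error (ln (1 + d)) e"
    unfolding oscillation_le_def using eventually_ge_at_top[of 2]
  proof eventually_elim
    case (elim x)
    show ?case
    proof
      fix y assume "y \<in> {x..exp (ln (1 + d)) * x}"
      then have y: "x \<le> y" "y \<le> (1 + d) * x" using d by auto
      have "(1 + d) * x \<le> 2 * x" using d elim by (intro mult_right_mono) auto
      then have "y \<le> 2 * x" using y by linarith
      then have "\<bar>psi_error y - psi_error x\<bar> \<le> C * ((y - x) / x) + C / ln x"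
        using y elim by (intro C(2)) auto
      also have "C * ((y - x) / x) \<le> C * d" using y elim C(1) by (intro mult_left_mono) (auto simp: field_simps)
      finally show "\<bar>psi_error y - psi_error x\<bar> \<le> e" using d elim by linarith
    qed
  qed
  moreover have "ln (1 + d) > 0" using d by simp
  ultimately show "\<exists>h>0. oscillation_le psi_error h e" by blast
qed

section \<open>The Tauberian argument\<close>

definition log_interval :: "real \<Rightarrow> real \<Rightarrow> nat set" where
  "log_interval s t = {n. 0 < n \<and> s < ln (real n) \<and> ln (real n) \<le> t}"

lemma log_interval_eq_Diff: "log_interval s t = nats_upto (exp t) - nats_upto (exp s)"
proof -
  have "s < ln (real n) \<longleftrightarrow> exp s < real n" "ln (real n) \<le> t \<longleftrightarrow> real n \<le> exp t" if "n > 0" for n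
    using that ln_less_cancel_iff[of "exp s" "real n"] ln_le_cancel_iff[of "real n" "exp t"] by simp_all
  then show ?thesis by (auto simp: log_interval_def nats_upto_def)
qed

lemma finite_log_interval [simp]: "finite (log_interval s t)"
  by (simp add: log_interval_eq_Diff)

lemma log_interval_subset_nats_upto: "x > 0 \<Longrightarrow> t \<le> ln x \<Longrightarrow> log_interval s t \<subseteq> nats_upto x"
  by (auto simp: log_interval_eq_Diff nats_upto_def ln_ge_iff)

lemma sum_log_interval_split:
  fixes f :: "nat \<Rightarrow> real"
  assumes "s \<le> t" "t \<le> u"
  shows "sum f (log_interval s u) = sum f (log_interval s t) + sum f (log_interval t u)"
proof -
  have "log_interval s u = log_interval s t \<union> log_interval t u" "log_interval s t \<inter> log_interval t u = {}"
    using assms by (auto simp: log_interval_def)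
  then show ?thesis by (simp add: sum.union_disjoint)
qed

lemma sum_log_interval_cells:
  fixes f :: "nat \<Rightarrow> real"
  assumes "h \<ge> 0"
  shows "sum f (log_interval v (v + real k * h)) = (\<Sum>j<k. sum f (log_interval (v + real j * h) (v + real j * h + h)))"
proof (induction k)
  case 0
  have "log_interval v v = {}" by (auto simp: log_interval_def)
  then show ?case by simp
next
  case (Suc k)
  have Suc_eq: "v + real (Suc k) * h = v + real k * h + h" by (simp add: algebra_simps)
  show ?case unfolding Suc_eq
    using Suc sum_log_interval_split[of v "v + real k * h" "v + real k * h + h" f] assms by simp
qed

definition prime_weight :: "nat \<Rightarrow> real" where
  "prime_weight n = mangoldt n * ln (real n) / real n"

definition semiprime_weight :: "nat \<Rightarrow> real" where
  "semiprime_weight n = mangoldt_conv n / real n"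

lemma prime_weight_nonneg: "0 \<le> prime_weight n"
  by (simp add: prime_weight_def mangoldt_mult_ln_nonneg)

lemma semiprime_weight_nonneg: "0 \<le> semiprime_weight n"
  by (simp add: semiprime_weight_def mangoldt_conv_nonneg)

lemma prime_weight_plus_semiprime_weight: "prime_weight n + semiprime_weight n = mangoldt2 n / real n"
  by (simp add: prime_weight_def semiprime_weight_def mangoldt2_def add_divide_distrib)

lemma sum_weights_log_interval_lower:
  obtains C where "C > 0" "\<And>v h. 0 \<le> v \<Longrightarrow> 0 \<le> h \<Longrightarrow>
    2 * v * (1 - exp (- h)) - C \<le> (\<Sum>n\<in>log_interval v (v + h). prime_weight n + semiprime_weight n)"
proof -
  obtain C where C: "C > 0" "\<And>x. x \<ge> 1 \<Longrightarrow> \<bar>selberg_sum x - 2 * x * ln x\<bar> \<le> C * x"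
    by (rule selberg_formula) (rule that)
  have "2 * v * (1 - exp (- h)) - 2 * C \<le> (\<Sum>n\<in>log_interval v (v + h). prime_weight n + semiprime_weight n)"
    if vh: "0 \<le> v" "0 \<le> h" for v h
  proof -
    define x where "x = exp v"
    define y where "y = exp (v + h)"
    let ?W = "\<Sum>n\<in>log_interval v (v + h). mangoldt2 n / real n"
    have xy: "1 \<le> x" "x \<le> y" "y > 0" using vh by (auto simp: x_def y_def)
    have "\<bar>selberg_sum x - 2 * x * v\<bar> \<le> C * x" "\<bar>selberg_sum y - 2 * y * (v + h)\<bar> \<le> C * y"
      using C(2)[of x] C(2)[of y] xy by (auto simp: x_def y_def)
    then have "2 * y * (v + h) - C * y - 2 * x * v - C * x \<le> selberg_sum y - selberg_sum x" by linarith
    moreover have "C * x \<le> C * y" "2 * y * v \<le> 2 * y * (v + h)" using xy vh C by auto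
    ultimately have "2 * y * v - 2 * x * v - 2 * C * y \<le> selberg_sum y - selberg_sum x" by linarith
    also have "\<dots> = (\<Sum>n\<in>log_interval v (v + h). mangoldt2 n)"
      using selberg_sum_diff[OF xy(2)] by (simp add: log_interval_eq_Diff mangoldt2_def x_def y_def)
    also have "\<dots> \<le> (\<Sum>n\<in>log_interval v (v + h). y * (mangoldt2 n / real n))"
    proof (rule sum_mono)
      fix n assume "n \<in> log_interval v (v + h)"
      then have "0 < n" "real n \<le> y" by (auto simp: log_interval_eq_Diff nats_upto_def y_def)
      then show "mangoldt2 n \<le> y * (mangoldt2 n / real n)"
        using mult_right_mono[of "real n" y "mangoldt2 n"] mangoldt2_nonneg[of n] by (simp add: field_simps)
    qed
    also have "\<dots> = y * ?W" by (simp add: sum_distrib_left)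
    finally have "2 * v * (1 - x / y) - 2 * C \<le> ?W" using xy by (simp add: field_simps)
    moreover have "x / y = exp (- h)" by (simp add: x_def y_def flip: exp_diff)
    ultimately show ?thesis by (simp add: prime_weight_plus_semiprime_weight)
  qed
  then show ?thesis using that[of "2 * C"] C by auto
qed

lemma sum_prime_weight_log_interval:
  obtains K where "K > 0"
    "\<And>v h. 0 \<le> v \<Longrightarrow> 0 \<le> h \<Longrightarrow> v * (h - K) \<le> sum prime_weight (log_interval v (v + h))"
    "\<And>v h. 0 \<le> v \<Longrightarrow> 0 \<le> h \<Longrightarrow> sum prime_weight (log_interval v (v + h)) \<le> (v + h) * (h + K)"
proof -
  obtain K where K: "K > 0" "\<And>x. x \<ge> 1 \<Longrightarrow> \<bar>mertens x - ln x\<bar> \<le> K"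
    by (rule mertens_estimate) (rule that)
  have "v * (h - 2 * K) \<le> sum prime_weight (log_interval v (v + h)) \<and>
      sum prime_weight (log_interval v (v + h)) \<le> (v + h) * (h + 2 * K)" if vh: "0 \<le> v" "0 \<le> h" for v h
  proof -
    define S where "S = (\<Sum>n\<in>log_interval v (v + h). mangoldt n / real n)"
    have "S = mertens (exp (v + h)) - mertens (exp v)"
      using nats_upto_mono[of "exp v" "exp (v + h)"] vh by (simp add: S_def mertens_def log_interval_eq_Diff sum_diff)
    then have S: "h - 2 * K \<le> S" "S \<le> h + 2 * K"
      using K(2)[of "exp v"] K(2)[of "exp (v + h)"] vh by auto
    have weight: "v * (mangoldt n / real n) \<le> prime_weight n" "prime_weight n \<le> (v + h) * (mangoldt n / real n)"
      if "n \<in> log_interval v (v + h)" for n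
    proof -
      have "v \<le> ln (real n)" "ln (real n) \<le> v + h" "0 \<le> mangoldt n / real n"
        using that mangoldt_nonneg[of n] by (auto simp: log_interval_def)
      then show "v * (mangoldt n / real n) \<le> prime_weight n" "prime_weight n \<le> (v + h) * (mangoldt n / real n)"
        using mult_right_mono[of v "ln (real n)" "mangoldt n / real n"]
          mult_right_mono[of "ln (real n)" "v + h" "mangoldt n / real n"]
        by (simp_all add: prime_weight_def mult.commute)
    qed
    have "v * S \<le> sum prime_weight (log_interval v (v + h))" "sum prime_weight (log_interval v (v + h)) \<le> (v + h) * S"
      unfolding S_def sum_distrib_left using weight by (auto intro!: sum_mono)
    moreover have "v * (h - 2 * K) \<le> v * S" "(v + h) * S \<le> (v + h) * (h + 2 * K)"
      using S vh by (auto intro!: mult_left_mono)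
    ultimately show ?thesis by linarith
  qed
  then show ?thesis using that[of "2 * K"] K by auto
qed

text \<open>If no two neighbours carried both quantities, one of them would be small throughout.\<close>

lemma exists_adjacent_both_large:
  fixes a b :: "nat \<Rightarrow> real"
  assumes nonneg: "\<And>j. a j \<ge> 0" "\<And>j. b j \<ge> 0" and total: "\<And>j. s \<le> a j + b j" and s: "2 * \<theta> \<le> s"
    and sum: "real k * \<theta> \<le> (\<Sum>j<k. a j)" "(\<Sum>j<k. a j) \<le> real k * (s - \<theta>)" and "k > 0"
  shows "\<exists>j<k. \<theta> \<le> a j + a (Suc j) \<and> \<theta> \<le> b j + b (Suc j)"
proof (rule ccontr)
  assume neg: "\<not> ?thesis"
  have both: "\<not> (\<theta> \<le> a i \<and> \<theta> \<le> b i')" if "j < k" "i \<in> {j, Suc j}" "i' \<in> {j, Suc j}" for i i' j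
  proof
    assume "\<theta> \<le> a i \<and> \<theta> \<le> b i'"
    moreover have "a i \<le> a j + a (Suc j)" "b i' \<le> b j + b (Suc j)"
      using that nonneg[of j] nonneg[of "Suc j"] by auto
    ultimately have "\<theta> \<le> a j + a (Suc j) \<and> \<theta> \<le> b j + b (Suc j)" by linarith
    then show False using neg that(1) by blast
  qed
  show False
  proof (cases "\<theta> \<le> a 0")
    case True
    have large: "\<theta> \<le> a j" if "j < k" for j
      using that
    proof (induction j)
      case (Suc j)
      then have "b (Suc j) < \<theta>" using both[of j j "Suc j"] by force
      then show ?case using total[of "Suc j"] s by linarith
    qed (rule True)
    have "s - \<theta> < a j" if "j < k" for j
      using both[of j j j] large[OF that] total[of j] that by force
    then have "(\<Sum>j<k. s - \<theta>) < (\<Sum>j<k. a j)" using \<open>k > 0\<close> by (intro sum_strict_mono) auto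
    then show False using sum by simp
  next
    case False
    have "a j < \<theta>" if "j < k" for j
      using that
    proof (induction j)
      case (Suc j)
      then have "\<theta> \<le> b j" using total[of j] s by linarith
      then show ?case using both[of j "Suc j" j] Suc.prems by force
    qed (use False in simp)
    then have "(\<Sum>j<k. a j) < (\<Sum>j<k. \<theta>)" using \<open>k > 0\<close> by (intro sum_strict_mono) auto
    then show False using sum by simp
  qed
qed

lemma one_minus_exp_minus_ge:
  assumes "0 < h" "h \<le> (1/10 :: real)"
  shows "9/10 * h \<le> 1 - exp (- h)"
proof -
  have "1 + h \<le> exp h" by (rule exp_ge_add_one_self)
  then have "exp (- h) \<le> 1 / (1 + h)" using assms by (simp add: exp_minus field_simps)
  moreover have "9 * (h * h) \<le> 9 * (h * (1/10))" using assms by (intro mult_left_mono) auto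
  then have "1 / (1 + h) \<le> 1 - 9/10 * h" using assms by (simp add: field_simps)
  ultimately show ?thesis by linarith
qed

lemma sum_weights_short_interval_lower:
  obtains C where "C > 0" "\<And>v h. 0 < h \<Longrightarrow> h \<le> 1/10 \<Longrightarrow> C / h \<le> v \<Longrightarrow>
    17/10 * (h * v) \<le> sum prime_weight (log_interval v (v + h)) + sum semiprime_weight (log_interval v (v + h))"
proof -
  obtain C where C: "C > 0" "\<And>v h. 0 \<le> v \<Longrightarrow> 0 \<le> h \<Longrightarrow>
    2 * v * (1 - exp (- h)) - C \<le> (\<Sum>n\<in>log_interval v (v + h). prime_weight n + semiprime_weight n)"
    by (rule sum_weights_log_interval_lower) (rule that)
  have "17/10 * (h * v) \<le> sum prime_weight (log_interval v (v + h)) + sum semiprime_weight (log_interval v (v + h))"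
    if h: "0 < h" "h \<le> 1/10" and v: "10 * C / h \<le> v" for v h
  proof -
    have "0 < 10 * C / h" using C(1) h by simp
    then have "v > 0" using v by linarith
    then have "2 * v * (9/10 * h) \<le> 2 * v * (1 - exp (- h))"
      using one_minus_exp_minus_ge[OF h] by (intro mult_left_mono) auto
    moreover have "2 * v * (9/10 * h) = 18/10 * (h * v)" by simp
    moreover have "10 * C \<le> h * v" using v h by (simp add: field_simps)
    moreover have "2 * v * (1 - exp (- h)) - C
        \<le> sum prime_weight (log_interval v (v + h)) + sum semiprime_weight (log_interval v (v + h))"
      using C(2)[of v h] h \<open>v > 0\<close> by (simp add: sum.distrib)
    ultimately show ?thesis by linarith
  qed
  then show ?thesis using that[of "10 * C"] C(1) by simp
qed

lemma sum_prime_weight_long_interval: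
  obtains K where "K > 0" "\<And>v c. K \<le> c \<Longrightarrow> 4 * c \<le> v \<Longrightarrow>
    1/4 * (v * c) \<le> sum prime_weight (log_interval v (v + c)) \<and>
    sum prime_weight (log_interval v (v + c)) \<le> 29/20 * (v * c)"
proof -
  obtain K where K: "K > 0"
    "\<And>v h. 0 \<le> v \<Longrightarrow> 0 \<le> h \<Longrightarrow> v * (h - K) \<le> sum prime_weight (log_interval v (v + h))"
    "\<And>v h. 0 \<le> v \<Longrightarrow> 0 \<le> h \<Longrightarrow> sum prime_weight (log_interval v (v + h)) \<le> (v + h) * (h + K)"
    by (rule sum_prime_weight_log_interval) (rule that)
  have "1/4 * (v * c) \<le> sum prime_weight (log_interval v (v + c)) \<and>
      sum prime_weight (log_interval v (v + c)) \<le> 29/20 * (v * c)" if c: "10 * K \<le> c" "4 * c \<le> v" for v c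
  proof
    have pos: "0 < c" "0 < v" using c K(1) by linarith+
    then have "v * c > 0" by simp
    then have "1/4 * (v * c) \<le> v * (9/10 * c)" by linarith
    also have "\<dots> \<le> v * (c - K)" using c pos by (intro mult_left_mono) auto
    finally show "1/4 * (v * c) \<le> sum prime_weight (log_interval v (v + c))" using K(2)[of v c] pos by linarith
    have "(v + c) * (c + K) \<le> (5/4 * v) * (11/10 * c)"
      using c pos K(1) by (intro mult_mono) auto
    also have "\<dots> \<le> 29/20 * (v * c)" using \<open>v * c > 0\<close> by linarith
    finally show "sum prime_weight (log_interval v (v + c)) \<le> 29/20 * (v * c)" using K(3)[of v c] pos by linarith
  qed
  then show ?thesis using that[of "10 * K"] K(1) by simp
qed

lemma exists_mixed_window:
  assumes "h > 0" "k > 0" "2 * \<theta> \<le> s"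
    and cell_total: "\<And>u. v \<le> u \<Longrightarrow>
      s \<le> sum prime_weight (log_interval u (u + h)) + sum semiprime_weight (log_interval u (u + h))"
    and block: "real k * \<theta> \<le> sum prime_weight (log_interval v (v + real k * h))"
      "sum prime_weight (log_interval v (v + real k * h)) \<le> real k * (s - \<theta>)"
  shows "\<exists>t\<ge>v. t + 2 * h \<le> v + (real k * h + h) \<and> \<theta> \<le> sum prime_weight (log_interval t (t + 2 * h))
    \<and> \<theta> \<le> sum semiprime_weight (log_interval t (t + 2 * h))"
proof -
  define cell where "cell f j = sum f (log_interval (v + real j * h) (v + real j * h + h))"
    for f :: "nat \<Rightarrow> real" and j
  have adjacent: "cell f j + cell f (Suc j)
      = sum f (log_interval (v + real j * h) (v + real j * h + 2 * h))" for f j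
    using sum_log_interval_split[of "v + real j * h" "v + real j * h + h" "v + real j * h + 2 * h" f] \<open>h > 0\<close>
    by (simp add: cell_def algebra_simps)
  have "\<exists>j<k. \<theta> \<le> cell prime_weight j + cell prime_weight (Suc j)
       \<and> \<theta> \<le> cell semiprime_weight j + cell semiprime_weight (Suc j)"
  proof (rule exists_adjacent_both_large)
    show "s \<le> cell prime_weight j + cell semiprime_weight j" for j
      unfolding cell_def using \<open>h > 0\<close> by (intro cell_total) simp
    have "(\<Sum>j<k. cell prime_weight j) = sum prime_weight (log_interval v (v + real k * h))"
      using sum_log_interval_cells[of h prime_weight v k] \<open>h > 0\<close> by (simp add: cell_def)
    then show "real k * \<theta> \<le> (\<Sum>j<k. cell prime_weight j)" "(\<Sum>j<k. cell prime_weight j) \<le> real k * (s - \<theta>)"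
      using block by simp_all
  qed (use assms in \<open>auto simp: cell_def intro!: sum_nonneg prime_weight_nonneg semiprime_weight_nonneg\<close>)
  then obtain j where j: "j < k" "\<theta> \<le> cell prime_weight j + cell prime_weight (Suc j)"
    "\<theta> \<le> cell semiprime_weight j + cell semiprime_weight (Suc j)" by blast
  have "(real j + 1) * h \<le> real k * h" using j(1) \<open>h > 0\<close> by (intro mult_right_mono) auto
  then show ?thesis
    using j \<open>h > 0\<close> by (intro exI[of _ "v + real j * h"]) (auto simp: adjacent algebra_simps)
qed

text \<open>By Selberg's formula every short interval carries primes or semiprimes, and by Mertens' theorem
  neither kind can fill a long interval alone.\<close>

lemma mixed_window:
  assumes h: "0 < h" "h \<le> 1/10"
  obtains d v0 :: real where "d > 0" "v0 > 0"
    "\<And>v. v \<ge> v0 \<Longrightarrow> \<exists>t\<ge>v. t + 2 * h \<le> v + d \<and> h * v / 4 \<le> sum prime_weight (log_interval t (t + 2 * h))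
       \<and> h * v / 4 \<le> sum semiprime_weight (log_interval t (t + 2 * h))"
proof -
  obtain C where C: "C > 0" "\<And>v h. 0 < h \<Longrightarrow> h \<le> 1/10 \<Longrightarrow> C / h \<le> v \<Longrightarrow>
    17/10 * (h * v) \<le> sum prime_weight (log_interval v (v + h)) + sum semiprime_weight (log_interval v (v + h))"
    by (rule sum_weights_short_interval_lower) (rule that)
  obtain K where K: "K > 0" "\<And>v c. K \<le> c \<Longrightarrow> 4 * c \<le> v \<Longrightarrow> 1/4 * (v * c) \<le> sum prime_weight (log_interval v (v + c)) \<and>
    sum prime_weight (log_interval v (v + c)) \<le> 29/20 * (v * c)"
    by (rule sum_prime_weight_long_interval) (rule that)
  obtain k :: nat where k: "K / h < real k" using reals_Archimedean2 by blast
  define c where "c = real k * h"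
  have c: "K \<le> c" "c > 0" using k h K(1) by (auto simp: c_def field_simps)
  then have "k > 0" by (auto simp: c_def intro: gr0I)
  have "\<exists>t\<ge>v. t + 2 * h \<le> v + (c + h) \<and> h * v / 4 \<le> sum prime_weight (log_interval t (t + 2 * h))
       \<and> h * v / 4 \<le> sum semiprime_weight (log_interval t (t + 2 * h))" if "4 * c + C / h \<le> v" for v
    unfolding c_def
  proof (rule exists_mixed_window[where s = "17/10 * (h * v)"])
    have "C / h > 0" using C(1) h by simp
    then have v: "4 * c \<le> v" "C / h \<le> v" "v > 0" using that c by linarith+
    then show "2 * (h * v / 4) \<le> 17/10 * (h * v)" using h by simp
    show "17/10 * (h * v) \<le> sum prime_weight (log_interval u (u + h)) + sum semiprime_weight (log_interval u (u + h))"
      if "v \<le> u" for u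
    proof -
      have "17/10 * (h * v) \<le> 17/10 * (h * u)" using h that by (intro mult_left_mono) auto
      then show ?thesis using C(2)[OF h, of u] v(2) that by linarith
    qed
    have "real k * (h * v / 4) = 1/4 * (v * c)" "real k * (17/10 * (h * v) - h * v / 4) = 29/20 * (v * c)"
      by (simp_all add: c_def)
    then show "real k * (h * v / 4) \<le> sum prime_weight (log_interval v (v + real k * h))"
      "sum prime_weight (log_interval v (v + real k * h)) \<le> real k * (17/10 * (h * v) - h * v / 4)"
      using K(2)[OF c(1) v(1)] by (simp_all only: c_def)
  qed (use h \<open>k > 0\<close> in auto)
  then show ?thesis using that[of "c + h" "4 * c + C / h"] c C(1) h by (simp add: add_pos_pos)
qed

definition deficit :: "(real \<Rightarrow> real) \<Rightarrow> real \<Rightarrow> real \<Rightarrow> nat \<Rightarrow> real" where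
  "deficit E \<beta> x n = prime_weight n * (\<beta> + E (x / real n)) + semiprime_weight n * (\<beta> - E (x / real n))"

lemma deficit_nonneg:
  assumes "\<And>y. \<bar>E y\<bar> \<le> \<beta>"
  shows "0 \<le> deficit E \<beta> x n"
proof -
  have "0 \<le> \<beta> + E (x / real n)" "0 \<le> \<beta> - E (x / real n)" using assms[of "x / real n"] by linarith+
  then show ?thesis
    by (simp add: deficit_def prime_weight_nonneg semiprime_weight_nonneg)
qed

lemma sum_weighted_lower:
  fixes f g A B :: "nat \<Rightarrow> real"
  assumes "\<And>n. 0 \<le> f n" "\<And>n. 0 \<le> g n" "0 \<le> m" "w \<le> sum f J"
    and A: "\<And>n. n \<in> J \<Longrightarrow> m \<le> A n" and B: "\<And>n. n \<in> J \<Longrightarrow> 0 \<le> B n"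
  shows "m * w \<le> (\<Sum>n\<in>J. f n * A n + g n * B n)"
proof -
  have "m * w \<le> (\<Sum>n\<in>J. m * f n)"
    unfolding sum_distrib_left[symmetric] using assms(3,4) by (intro mult_left_mono)
  also have "\<dots> \<le> (\<Sum>n\<in>J. f n * A n + g n * B n)"
  proof (rule sum_mono)
    fix n assume n: "n \<in> J"
    have "m * f n \<le> A n * f n" using A[OF n] assms(1) by (rule mult_right_mono)
    moreover have "0 \<le> g n * B n" using assms(2) B[OF n] by (rule mult_nonneg_nonneg)
    ultimately show "m * f n \<le> f n * A n + g n * B n" by (simp add: mult.commute)
  qed
  finally show ?thesis .
qed

lemma deficit_window_lower:
  assumes bounded: "\<And>y. \<bar>E y\<bar> \<le> \<beta>" and \<alpha>: "0 \<le> \<alpha>" "\<alpha> \<le> \<beta>"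
    and vary: "\<And>n. n \<in> J \<Longrightarrow> \<bar>E (x / real n) - e0\<bar> \<le> \<alpha> / 2"
    and weight: "w \<le> sum prime_weight J" "w \<le> sum semiprime_weight J"
  shows "\<alpha> / 2 * w \<le> sum (deficit E \<beta> x) J"
proof (cases "e0 \<ge> 0")
  case True
  have "\<alpha> / 2 \<le> \<beta> + E (x / real n)" "0 \<le> \<beta> - E (x / real n)" if "n \<in> J" for n
    using vary[OF that] True \<alpha> bounded[of "x / real n"] by linarith+
  then show ?thesis
    unfolding deficit_def using weight(1) \<alpha>
    by (intro sum_weighted_lower prime_weight_nonneg semiprime_weight_nonneg) auto
next
  case False
  have "\<alpha> / 2 \<le> \<beta> - E (x / real n)" "0 \<le> \<beta> + E (x / real n)" if "n \<in> J" for n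
    using vary[OF that] False \<alpha> bounded[of "x / real n"] by linarith+
  then show ?thesis
    unfolding deficit_def add.commute[of "prime_weight _ * _"] using weight(2) \<alpha>
    by (intro sum_weighted_lower prime_weight_nonneg semiprime_weight_nonneg) auto
qed

lemma deficit_block_lower:
  assumes bounded: "\<And>y. \<bar>E y\<bar> \<le> \<beta>" and \<alpha>: "0 \<le> \<alpha>" "\<alpha> \<le> \<beta>" and x: "x > 0"
    and vary: "\<And>y z. exp (ln x / 2) \<le> y \<Longrightarrow> z \<in> {y..exp (2 * h) * y} \<Longrightarrow> \<bar>E z - E y\<bar> \<le> \<alpha> / 2"
    and window: "v \<le> t" "t + 2 * h \<le> v + d" "v + d \<le> ln x / 2"
    and weight: "w \<le> sum prime_weight (log_interval t (t + 2 * h))"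
      "w \<le> sum semiprime_weight (log_interval t (t + 2 * h))"
  shows "\<alpha> / 2 * w \<le> sum (deficit E \<beta> x) (log_interval v (v + d))"
proof -
  define y where "y = x / exp (t + 2 * h)"
  have "y = exp (ln x - (t + 2 * h))" using x by (simp add: y_def exp_diff)
  then have y: "exp (ln x / 2) \<le> y" using window by simp
  have "\<bar>E (x / real n) - E y\<bar> \<le> \<alpha> / 2" if "n \<in> log_interval t (t + 2 * h)" for n
  proof (rule vary[OF y])
    have n: "0 < n" "exp t < real n" "real n \<le> exp (t + 2 * h)"
      using that by (auto simp: log_interval_eq_Diff nats_upto_def)
    then have "y \<le> x / real n" "x / real n \<le> x / exp t"
      using x unfolding y_def by (auto intro!: divide_left_mono)
    then show "x / real n \<in> {y..exp (2 * h) * y}" by (simp add: y_def exp_add)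
  qed
  then have "\<alpha> / 2 * w \<le> sum (deficit E \<beta> x) (log_interval t (t + 2 * h))"
    by (rule deficit_window_lower[OF bounded \<alpha> _ weight])
  also have "\<dots> \<le> sum (deficit E \<beta> x) (log_interval v (v + d))"
  proof (intro sum_mono2 deficit_nonneg bounded)
    show "log_interval t (t + 2 * h) \<subseteq> log_interval v (v + d)"
      using window by (auto simp: log_interval_def)
  qed simp
  finally show ?thesis .
qed

lemma sum_nats_upto_ge_blocks:
  fixes f :: "nat \<Rightarrow> real"
  assumes nonneg: "\<And>n. 0 \<le> f n" and "x > 0" "d > 0" "8 * d \<le> ln x" "0 \<le> m"
    and block: "\<And>v. ln x / 4 \<le> v \<Longrightarrow> v + d \<le> ln x / 2 \<Longrightarrow> m \<le> sum f (log_interval v (v + d))"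
  shows "ln x / (8 * d) * m \<le> sum f (nats_upto x)"
proof -
  define u where "u = ln x"
  define k where "k = nat \<lfloor>u / (4 * d)\<rfloor>"
  have u: "8 * d \<le> u" "u > 0" using assms(3,4) unfolding u_def by linarith+
  have k: "real k \<le> u / (4 * d)" using u(2) \<open>d > 0\<close> by (simp add: k_def)
  have "u / (4 * d) - 1 \<le> real k" unfolding k_def by linarith
  moreover have "1 \<le> u / (8 * d)" "u / (4 * d) = 2 * (u / (8 * d))" using u \<open>d > 0\<close> by (auto simp: field_simps)
  ultimately have "u / (8 * d) \<le> real k" by linarith
  then have "u / (8 * d) * m \<le> real k * m" using \<open>0 \<le> m\<close> by (intro mult_right_mono)
  also have "\<dots> = (\<Sum>i<k. m)" by simp
  also have "\<dots> \<le> (\<Sum>i<k. sum f (log_interval (u / 4 + real i * d) (u / 4 + real i * d + d)))"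
  proof (rule sum_mono)
    fix i assume "i \<in> {..<k}"
    then have "real (Suc i) \<le> u / (4 * d)" using k by simp
    then have "real (Suc i) * d \<le> u / 4" using \<open>d > 0\<close> by (simp add: field_simps)
    then show "m \<le> sum f (log_interval (u / 4 + real i * d) (u / 4 + real i * d + d))"
      using \<open>d > 0\<close> by (intro block) (auto simp: u_def algebra_simps)
  qed
  also have "\<dots> = sum f (log_interval (u / 4) (u / 4 + real k * d))"
    using sum_log_interval_cells[of d] \<open>d > 0\<close> by simp
  also have "\<dots> \<le> sum f (nats_upto x)"
  proof (intro sum_mono2 nonneg log_interval_subset_nats_upto \<open>x > 0\<close>)
    show "u / 4 + real k * d \<le> ln x" using k \<open>d > 0\<close> u(2) by (simp add: field_simps flip: u_def)
  qed simp
  finally show ?thesis by (simp add: u_def)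
qed

lemma deficit_nats_upto_lower:
  assumes bounded: "\<And>y. \<bar>E y\<bar> \<le> \<beta>" and \<alpha>: "0 \<le> \<alpha>" "\<alpha> \<le> \<beta>" and "x > 0" "h > 0"
    and d: "d > 0" "8 * d \<le> ln x"
    and vary: "\<And>y z. exp (ln x / 2) \<le> y \<Longrightarrow> z \<in> {y..exp (2 * h) * y} \<Longrightarrow> \<bar>E z - E y\<bar> \<le> \<alpha> / 2"
    and window: "\<And>v. ln x / 4 \<le> v \<Longrightarrow> \<exists>t\<ge>v. t + 2 * h \<le> v + d
       \<and> h * v / 4 \<le> sum prime_weight (log_interval t (t + 2 * h))
       \<and> h * v / 4 \<le> sum semiprime_weight (log_interval t (t + 2 * h))"
  shows "\<alpha> * h / (256 * d) * (ln x)\<^sup>2 \<le> sum (deficit E \<beta> x) (nats_upto x)"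
proof -
  have "ln x > 0" using d by linarith
  have "\<alpha> * h / (256 * d) * (ln x)\<^sup>2 = ln x / (8 * d) * (\<alpha> / 2 * (h * (ln x / 4) / 4))"
    using d by (simp add: field_simps power2_eq_square)
  also have "\<dots> \<le> sum (deficit E \<beta> x) (nats_upto x)"
  proof (rule sum_nats_upto_ge_blocks)
    fix v assume v: "ln x / 4 \<le> v" "v + d \<le> ln x / 2"
    obtain t where t: "v \<le> t" "t + 2 * h \<le> v + d"
      "h * v / 4 \<le> sum prime_weight (log_interval t (t + 2 * h))"
      "h * v / 4 \<le> sum semiprime_weight (log_interval t (t + 2 * h))"
      using window[OF v(1)] by blast
    have "\<alpha> / 2 * (h * (ln x / 4) / 4) \<le> \<alpha> / 2 * (h * v / 4)"
      using v \<open>h > 0\<close> \<alpha> by (intro mult_left_mono divide_right_mono) auto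
    also have "\<dots> \<le> sum (deficit E \<beta> x) (log_interval v (v + d))"
      by (rule deficit_block_lower[OF bounded \<alpha> \<open>x > 0\<close> vary t(1,2) v(2) t(3,4)])
    finally show "\<alpha> / 2 * (h * (ln x / 4) / 4) \<le> sum (deficit E \<beta> x) (log_interval v (v + d))" .
  qed (use deficit_nonneg[OF bounded] assms \<open>ln x > 0\<close> in auto)
  finally show ?thesis .
qed

lemma deficit_sum_lower:
  assumes h: "0 < h" "h \<le> 1/10" and "\<alpha> > 0"
  obtains c where "c > 0"
    "\<And>E \<beta>. \<forall>y. \<bar>E y\<bar> \<le> \<beta> \<Longrightarrow> \<alpha> \<le> \<beta> \<Longrightarrow> oscillation_le E (2 * h) (\<alpha> / 2) \<Longrightarrow>
      eventually (\<lambda>x. c * (ln x)\<^sup>2 \<le> sum (deficit E \<beta> x) (nats_upto x)) at_top"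
proof -
  obtain d v0 where d: "d > 0" "v0 > 0" and window: "\<And>v. v \<ge> v0 \<Longrightarrow> \<exists>t\<ge>v. t + 2 * h \<le> v + d
       \<and> h * v / 4 \<le> sum prime_weight (log_interval t (t + 2 * h))
       \<and> h * v / 4 \<le> sum semiprime_weight (log_interval t (t + 2 * h))"
    using h by (rule mixed_window) (rule that)
  have "eventually (\<lambda>x. \<alpha> * h / (256 * d) * (ln x)\<^sup>2 \<le> sum (deficit E \<beta> x) (nats_upto x)) at_top"
    if "\<forall>y. \<bar>E y\<bar> \<le> \<beta>" and "\<alpha> \<le> \<beta>" and slow: "oscillation_le E (2 * h) (\<alpha> / 2)" for E \<beta>
  proof -
    have bounded: "\<bar>E y\<bar> \<le> \<beta>" for y using \<open>\<forall>y. \<bar>E y\<bar> \<le> \<beta>\<close> by blast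
    obtain X where X: "\<forall>y\<ge>X. \<forall>z\<in>{y..exp (2 * h) * y}. \<bar>E z - E y\<bar> \<le> \<alpha> / 2"
      using slow unfolding oscillation_le_def eventually_at_top_linorder by blast
    have "filterlim (\<lambda>x::real. exp (ln x / 2)) at_top at_top" "filterlim (\<lambda>x::real. ln x) at_top at_top"
      by real_asymp+
    then have "eventually (\<lambda>x. exp (ln x / 2) \<ge> X) at_top" "eventually (\<lambda>x. ln x \<ge> max (4 * v0) (8 * d)) at_top"
      unfolding filterlim_at_top by blast+
    then show ?thesis using eventually_gt_at_top[of 0]
    proof eventually_elim
      case (elim x)
      have u: "4 * v0 \<le> ln x" "8 * d \<le> ln x" using elim by simp_all
      show ?case
      proof (rule deficit_nats_upto_lower[OF bounded _ \<open>\<alpha> \<le> \<beta>\<close> elim(3) h(1) d(1) u(2)])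
        show "\<bar>E z - E y\<bar> \<le> \<alpha> / 2" if "exp (ln x / 2) \<le> y" "z \<in> {y..exp (2 * h) * y}" for y z
          using X elim(1) that by auto
        show "\<exists>t\<ge>v. t + 2 * h \<le> v + d \<and> h * v / 4 \<le> sum prime_weight (log_interval t (t + 2 * h))
            \<and> h * v / 4 \<le> sum semiprime_weight (log_interval t (t + 2 * h))" if "ln x / 4 \<le> v" for v
          using u that by (intro window) simp
      qed (use \<open>\<alpha> > 0\<close> in simp)
    qed
  qed
  then show ?thesis using that[of "\<alpha> * h / (256 * d)"] h d \<open>\<alpha> > 0\<close> by auto
qed

context
  fixes E :: "real \<Rightarrow> real" and \<beta> K K1 :: real
  assumes mertens: "\<And>x. x \<ge> 1 \<Longrightarrow> \<bar>mertens x - ln x\<bar> \<le> K"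
    and relation: "selberg_relation E K1"
    and bounded: "\<And>y. \<bar>E y\<bar> \<le> \<beta>"
begin

lemma selberg_constants_nonneg: "0 \<le> \<beta>" "0 \<le> K" "0 \<le> K1" "0 \<le> \<beta> * K + K1"
proof -
  show "0 \<le> \<beta>" "0 \<le> K" using bounded[of 0] mertens[of 1] by linarith+
  moreover show "0 \<le> K1" using selberg_relationD[OF relation, of 1] by linarith
  ultimately show "0 \<le> \<beta> * K + K1" by simp
qed

lemma sum_mangoldt_excess_eq:
  "(\<Sum>a\<in>nats_upto x. mangoldt a / real a * (\<beta> + s * E (x / real a)))
    = \<beta> * mertens x + s * (\<Sum>a\<in>nats_upto x. mangoldt a / real a * E (x / real a))"
  by (simp add: mertens_def sum_distrib_left distrib_left sum.distrib mult_ac)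

lemma sum_mangoldt_lower_excess_le:
  assumes "y \<ge> 1"
  shows "(\<Sum>b\<in>nats_upto y. mangoldt b / real b * (\<beta> - E (y / real b))) \<le> (\<beta> + E y) * ln y + (\<beta> * K + K1)"
proof -
  have "\<beta> * mertens y \<le> \<beta> * (ln y + K)"
    using mertens[OF assms] selberg_constants_nonneg by (intro mult_left_mono) auto
  moreover have "- (\<Sum>b\<in>nats_upto y. mangoldt b / real b * E (y / real b)) \<le> E y * ln y + K1"
    using selberg_relationD[OF relation assms] by linarith
  ultimately show ?thesis using sum_mangoldt_excess_eq[of "-1" y] by (simp add: algebra_simps)
qed

lemma sum_mangoldt_upper_excess_le:
  assumes "x \<ge> 1" "\<beta> - e \<le> E x"
  shows "(\<Sum>a\<in>nats_upto x. mangoldt a / real a * (\<beta> + E (x / real a))) \<le> e * ln x + (\<beta> * K + K1)"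
proof -
  have "\<beta> * mertens x \<le> \<beta> * (ln x + K)"
    using mertens[OF assms(1)] selberg_constants_nonneg by (intro mult_left_mono) auto
  moreover have "(\<Sum>a\<in>nats_upto x. mangoldt a / real a * E (x / real a)) \<le> K1 - E x * ln x"
    using selberg_relationD[OF relation assms(1)] by linarith
  moreover have "(\<beta> - e) * ln x \<le> E x * ln x" using assms by (intro mult_right_mono) auto
  ultimately show ?thesis using sum_mangoldt_excess_eq[of 1 x] by (simp add: algebra_simps)
qed

lemma sum_prime_weight_excess_le:
  "(\<Sum>n\<in>nats_upto x. prime_weight n * (\<beta> + E (x / real n)))
    \<le> ln x * (\<Sum>a\<in>nats_upto x. mangoldt a / real a * (\<beta> + E (x / real a)))"
  unfolding sum_distrib_left
proof (rule sum_mono)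
  fix n assume n: "n \<in> nats_upto x"
  have "0 \<le> \<beta> + E (x / real n)" using bounded[of "x / real n"] by linarith
  then have "ln (real n) * (mangoldt n / real n * (\<beta> + E (x / real n)))
      \<le> ln x * (mangoldt n / real n * (\<beta> + E (x / real n)))"
    using n mangoldt_nonneg[of n] by (intro mult_right_mono) (auto simp: nats_upto_def)
  then show "prime_weight n * (\<beta> + E (x / real n)) \<le> ln x * (mangoldt n / real n * (\<beta> + E (x / real n)))"
    by (simp add: prime_weight_def mult_ac)
qed

lemma sum_semiprime_weight_excess_le:
  assumes x: "x \<ge> 1"
  shows "(\<Sum>n\<in>nats_upto x. semiprime_weight n * (\<beta> - E (x / real n)))
    \<le> ln x * (\<Sum>a\<in>nats_upto x. mangoldt a / real a * (\<beta> + E (x / real a))) + (\<beta> * K + K1) * mertens x"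
proof -
  have "(\<Sum>n\<in>nats_upto x. semiprime_weight n * (\<beta> - E (x / real n)))
      = (\<Sum>n\<in>nats_upto x. \<Sum>d | d dvd n. mangoldt d / real d *
          (mangoldt (n div d) / real (n div d) * (\<beta> - E (x / real d / real (n div d)))))"
    unfolding semiprime_weight_def mangoldt_conv_def dirichlet_prod_def sum_divide_distrib sum_distrib_right
    by (intro sum.cong refl) (auto simp: nats_upto_def elim!: dvdE)
  also have "\<dots> = (\<Sum>a\<in>nats_upto x. mangoldt a / real a *
      (\<Sum>b\<in>nats_upto (x / real a). mangoldt b / real b * (\<beta> - E (x / real a / real b))))"
    unfolding sum_distrib_left by (rule sum_nats_upto_divisors[symmetric])
  also have "\<dots> \<le> (\<Sum>a\<in>nats_upto x. mangoldt a / real a * ((\<beta> + E (x / real a)) * ln x + (\<beta> * K + K1)))"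
  proof (intro sum_mono mult_left_mono divide_nonneg_nonneg mangoldt_nonneg)
    fix a assume "a \<in> nats_upto x"
    then have y: "1 \<le> x / real a" "x / real a \<le> x" using x by (auto simp: nats_upto_def field_simps)
    have "0 \<le> \<beta> + E (x / real a)" using bounded[of "x / real a"] by linarith
    then have "(\<beta> + E (x / real a)) * ln (x / real a) \<le> (\<beta> + E (x / real a)) * ln x"
      using y by (intro mult_left_mono) auto
    then show "(\<Sum>b\<in>nats_upto (x / real a). mangoldt b / real b * (\<beta> - E (x / real a / real b)))
        \<le> (\<beta> + E (x / real a)) * ln x + (\<beta> * K + K1)"
      using sum_mangoldt_lower_excess_le[OF y(1)] by linarith
  qed auto
  also have "\<dots> = ln x * (\<Sum>a\<in>nats_upto x. mangoldt a / real a * (\<beta> + E (x / real a))) + (\<beta> * K + K1) * mertens x"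
    unfolding mertens_def sum_distrib_left sum.distrib[symmetric]
    by (intro sum.cong refl) (simp add: algebra_simps add_divide_distrib)
  finally show ?thesis .
qed

text \<open>If \<open>E\<close> is nearly maximal at \<open>x\<close>, Selberg's formula forces it to be nearly minimal at most \<open>x / p\<close>
  and nearly maximal at most \<open>x / (p q)\<close>.\<close>

lemma deficit_sum_upper:
  assumes x: "x \<ge> 1" and near: "\<beta> - e \<le> E x"
  shows "sum (deficit E \<beta> x) (nats_upto x) \<le> 2 * e * (ln x)\<^sup>2 + (\<beta> * K + K1) * (3 * ln x + K)"
proof -
  let ?Q = "\<Sum>a\<in>nats_upto x. mangoldt a / real a * (\<beta> + E (x / real a))"
  have "sum (deficit E \<beta> x) (nats_upto x) \<le> 2 * (ln x * ?Q) + (\<beta> * K + K1) * mertens x"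
    using sum_prime_weight_excess_le[of x] sum_semiprime_weight_excess_le[OF x]
    unfolding deficit_def sum.distrib by linarith
  moreover have "ln x * ?Q \<le> ln x * (e * ln x + (\<beta> * K + K1))"
    using sum_mangoldt_upper_excess_le[OF assms] x by (intro mult_left_mono) auto
  moreover have "(\<beta> * K + K1) * mertens x \<le> (\<beta> * K + K1) * (ln x + K)"
    using mertens[OF x] selberg_constants_nonneg by (intro mult_left_mono) auto
  ultimately show ?thesis by (simp add: algebra_simps power2_eq_square)
qed

end

lemma eventually_below_bound:
  assumes h: "0 < h" "h \<le> 1/10" and "\<alpha> > 0"
  obtains c where "c > 0"
    "\<And>E \<beta> K1. selberg_relation E K1 \<Longrightarrow> \<forall>y. \<bar>E y\<bar> \<le> \<beta> \<Longrightarrow> \<alpha> \<le> \<beta> \<Longrightarrow>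
      oscillation_le E (2 * h) (\<alpha> / 2) \<Longrightarrow>
      eventually (\<lambda>x. E x \<le> \<beta> - c) at_top"
proof -
  obtain K where K: "\<And>x. x \<ge> 1 \<Longrightarrow> \<bar>mertens x - ln x\<bar> \<le> K" by (rule mertens_estimate) (rule that)
  obtain c where c: "c > 0" and lower: "\<And>E \<beta>. \<forall>y. \<bar>E y\<bar> \<le> \<beta> \<Longrightarrow> \<alpha> \<le> \<beta> \<Longrightarrow>
      oscillation_le E (2 * h) (\<alpha> / 2) \<Longrightarrow>
      eventually (\<lambda>x. c * (ln x)\<^sup>2 \<le> sum (deficit E \<beta> x) (nats_upto x)) at_top"
    using assms by (rule deficit_sum_lower) (rule that)
  have "eventually (\<lambda>x. E x \<le> \<beta> - c / 4) at_top"
    if relation: "selberg_relation E K1" and "\<forall>y. \<bar>E y\<bar> \<le> \<beta>" and "\<alpha> \<le> \<beta>"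
      and slow: "oscillation_le E (2 * h) (\<alpha> / 2)" for E \<beta> K1
  proof -
    have bounded: "\<bar>E y\<bar> \<le> \<beta>" for y using \<open>\<forall>y. \<bar>E y\<bar> \<le> \<beta>\<close> by blast
    define W where "W = \<beta> * K + K1"
    have "((\<lambda>x. W * (3 * ln x + K) / (ln x)\<^sup>2) \<longlongrightarrow> 0) at_top" by real_asymp
    then have "eventually (\<lambda>x. W * (3 * ln x + K) / (ln x)\<^sup>2 < c / 2) at_top" using c by (intro order_tendstoD) auto
    then show ?thesis using lower[OF \<open>\<forall>y. \<bar>E y\<bar> \<le> \<beta>\<close> \<open>\<alpha> \<le> \<beta>\<close> slow] eventually_gt_at_top[of 1]
    proof eventually_elim
      case (elim x)
      have l: "(ln x)\<^sup>2 > 0" using elim by simp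
      show ?case
      proof (rule ccontr)
        assume "\<not> E x \<le> \<beta> - c / 4"
        then have "sum (deficit E \<beta> x) (nats_upto x) \<le> 2 * (c / 4) * (ln x)\<^sup>2 + W * (3 * ln x + K)"
          unfolding W_def using elim by (intro deficit_sum_upper[OF K relation bounded]) auto
        moreover have "W * (3 * ln x + K) < c / 2 * (ln x)\<^sup>2" using elim(1) l by (simp add: field_simps)
        ultimately show False using elim(2) by linarith
      qed
    qed
  qed
  then show ?thesis using that[of "c / 4"] c by auto
qed

lemma selberg_relation_uminus: "selberg_relation E K \<Longrightarrow> selberg_relation (\<lambda>x. - E x) K"
proof -
  have "(- E x) * ln x + (\<Sum>a\<in>nats_upto x. mangoldt a / real a * - E (x / real a))
      = - (E x * ln x + (\<Sum>a\<in>nats_upto x. mangoldt a / real a * E (x / real a)))" for x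
    by (simp add: sum_negf)
  then show "selberg_relation E K \<Longrightarrow> selberg_relation (\<lambda>x. - E x) K"
    unfolding selberg_relation_def by (simp only: abs_minus_cancel)
qed

lemma oscillation_le_uminus: "oscillation_le E h e \<Longrightarrow> oscillation_le (\<lambda>x. - E x) h e"
  by (simp add: oscillation_le_def abs_minus_commute)

lemma oscillation_le_mono:
  assumes "oscillation_le E h e" "h' \<le> h"
  shows "oscillation_le E h' e"
  using assms(1) eventually_ge_at_top[of 0] unfolding oscillation_le_def
proof eventually_elim
  case (elim x)
  have "exp h' * x \<le> exp h * x" using assms(2) elim(2) by (intro mult_right_mono) auto
  then show ?case using elim(1) by auto
qed

lemma oscillation_le_cong:
  assumes "oscillation_le E h e" "eventually (\<lambda>x. E' x = E x) at_top" "h \<ge> 0"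
  shows "oscillation_le E' h e"
proof -
  obtain X where X: "\<And>x. x \<ge> X \<Longrightarrow> E' x = E x"
    using assms(2) by (auto simp: eventually_at_top_linorder)
  show ?thesis
    using assms(1) eventually_ge_at_top[of X] unfolding oscillation_le_def
    by eventually_elim (auto simp: X)
qed

lemma mertens_diff_le:
  assumes "X \<ge> 1" "x \<ge> 1" and K: "\<And>x. x \<ge> 1 \<Longrightarrow> \<bar>mertens x - ln x\<bar> \<le> K"
  shows "mertens x - mertens (x / X) \<le> ln X + 2 * K"
proof (cases "x \<ge> X")
  case True
  then have "ln (x / X) = ln x - ln X" "x / X \<ge> 1" using assms(1) by (auto simp: ln_div)
  then show ?thesis using K[OF \<open>x \<ge> 1\<close>] K[of "x / X"] by linarith
next
  case False
  then have "mertens (x / X) = 0" "ln x \<le> ln X"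
    using assms by (auto simp: mertens_def nats_upto_empty)
  then show ?thesis using K[OF \<open>x \<ge> 1\<close>] K[of 1] by linarith
qed

lemma selberg_relation_finite_support:
  assumes "X \<ge> 1" and bounded: "\<And>y. y > 0 \<Longrightarrow> \<bar>G y\<bar> \<le> B" and support: "\<And>y. y \<ge> X \<Longrightarrow> G y = 0"
  obtains K where "selberg_relation G K"
proof -
  obtain K where K: "\<And>x. x \<ge> 1 \<Longrightarrow> \<bar>mertens x - ln x\<bar> \<le> K" by (rule mertens_estimate) (rule that)
  have B: "B \<ge> 0" using bounded[of 1] by linarith
  have "\<bar>G x * ln x + (\<Sum>a\<in>nats_upto x. mangoldt a / real a * G (x / real a))\<bar> \<le> B * ln X + B * (ln X + 2 * K)"
    if x: "x \<ge> 1" for x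
  proof -
    have subset: "nats_upto (x / X) \<subseteq> nats_upto x"
      using assms(1) x by (intro nats_upto_mono) (simp add: field_simps)
    have "\<bar>G x * ln x\<bar> \<le> B * ln X"
    proof (cases "x \<ge> X")
      case False
      then show ?thesis unfolding abs_mult using bounded[of x] x B by (intro mult_mono) auto
    qed (use support B assms(1) in auto)
    moreover have "\<bar>\<Sum>a\<in>nats_upto x. mangoldt a / real a * G (x / real a)\<bar> \<le> B * (ln X + 2 * K)"
    proof -
      have "(\<Sum>a\<in>nats_upto x. mangoldt a / real a * G (x / real a))
          = (\<Sum>a\<in>nats_upto x - nats_upto (x / X). mangoldt a / real a * G (x / real a))"
      proof (intro sum.mono_neutral_right ballI)
        fix a assume "a \<in> nats_upto x - (nats_upto x - nats_upto (x / X))"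
        then have "X \<le> x / real a" using assms(1) by (auto simp: nats_upto_def field_simps)
        then show "mangoldt a / real a * G (x / real a) = 0" by (simp add: support)
      qed auto
      also have "\<bar>\<dots>\<bar> \<le> (\<Sum>a\<in>nats_upto x - nats_upto (x / X). mangoldt a / real a * B)"
      proof (rule order_trans[OF sum_abs sum_mono])
        fix a assume "a \<in> nats_upto x - nats_upto (x / X)"
        then have "\<bar>G (x / real a)\<bar> \<le> B" using x by (intro bounded) (auto simp: nats_upto_def)
        then show "\<bar>mangoldt a / real a * G (x / real a)\<bar> \<le> mangoldt a / real a * B"
          unfolding abs_mult by (intro mult_mono divide_nonneg_nonneg mangoldt_nonneg) auto
      qed
      also have "\<dots> = B * (mertens x - mertens (x / X))"
        using subset by (simp add: mertens_def sum_distrib_left sum_diff right_diff_distrib mult.commute)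
      also have "\<dots> \<le> B * (ln X + 2 * K)"
        using B by (intro mult_left_mono mertens_diff_le K x assms(1))
      finally show ?thesis .
    qed
    ultimately show ?thesis by linarith
  qed
  then show ?thesis using that by (auto simp: selberg_relation_def)
qed

lemma selberg_relation_diff:
  assumes "selberg_relation E K" "selberg_relation G L"
  shows "selberg_relation (\<lambda>x. E x - G x) (K + L)"
  unfolding selberg_relation_def
proof (intro allI impI)
  fix x :: real assume x: "x \<ge> 1"
  have "(E x - G x) * ln x + (\<Sum>a\<in>nats_upto x. mangoldt a / real a * (E (x / real a) - G (x / real a)))
      = (E x * ln x + (\<Sum>a\<in>nats_upto x. mangoldt a / real a * E (x / real a)))
      - (G x * ln x + (\<Sum>a\<in>nats_upto x. mangoldt a / real a * G (x / real a)))"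
    by (simp add: sum_subtractf left_diff_distrib right_diff_distrib)
  then show "\<bar>(E x - G x) * ln x + (\<Sum>a\<in>nats_upto x. mangoldt a / real a * (E (x / real a) - G (x / real a)))\<bar> \<le> K + L"
    using selberg_relationD[OF assms(1) x] selberg_relationD[OF assms(2) x] by linarith
qed

lemma selberg_relation_truncate:
  assumes "selberg_relation E K" "X \<ge> 1" "\<And>y. y > 0 \<Longrightarrow> \<bar>E y\<bar> \<le> B"
  obtains K' where "selberg_relation (\<lambda>x. if x \<ge> X then E x else 0) K'"
proof -
  have "B \<ge> 0" using assms(3)[of 1] by linarith
  define G where "G = (\<lambda>x. if x \<ge> X then 0 else E x)"
  obtain L where L: "selberg_relation G L"
  proof (rule selberg_relation_finite_support[OF \<open>X \<ge> 1\<close>])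
    show "\<bar>G y\<bar> \<le> B" if "y > 0" for y using assms(3)[OF that] \<open>B \<ge> 0\<close> by (simp add: G_def)
  qed (auto simp: G_def intro: that)
  have "(\<lambda>x. E x - G x) = (\<lambda>x. if x \<ge> X then E x else 0)" by (auto simp: G_def)
  then show ?thesis using selberg_relation_diff[OF assms(1) L] that by simp
qed

lemma eventually_abs_improve:
  assumes bounded: "\<And>x. x > 0 \<Longrightarrow> \<bar>E x\<bar> \<le> B" and slow: "slowly_oscillating E"
    and relation: "selberg_relation E K" and "\<alpha> > 0"
  obtains c where "c > 0" "\<And>\<beta>. \<alpha> \<le> \<beta> \<Longrightarrow> eventually (\<lambda>x. \<bar>E x\<bar> \<le> \<beta>) at_top \<Longrightarrow> eventually (\<lambda>x. \<bar>E x\<bar> \<le> \<beta> - c) at_top"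
proof -
  have "\<alpha> / 2 > 0" using \<open>\<alpha> > 0\<close> by simp
  then obtain h0 where h0: "h0 > 0" "oscillation_le E h0 (\<alpha> / 2)"
    using slow unfolding slowly_oscillating_def by blast
  define h where "h = min (1/10) (h0 / 2)"
  have h: "0 < h" "h \<le> 1/10" using h0(1) by (auto simp: h_def)
  have osc: "oscillation_le E (2 * h) (\<alpha> / 2)" using h0(2) by (rule oscillation_le_mono) (simp add: h_def)
  obtain c where c: "c > 0" and below: "\<And>E \<beta> K1. selberg_relation E K1 \<Longrightarrow> \<forall>y. \<bar>E y\<bar> \<le> \<beta> \<Longrightarrow> \<alpha> \<le> \<beta> \<Longrightarrow>
      oscillation_le E (2 * h) (\<alpha> / 2) \<Longrightarrow> eventually (\<lambda>x. E x \<le> \<beta> - c) at_top"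
    using h \<open>\<alpha> > 0\<close> by (rule eventually_below_bound) (rule that)
  have improve: "eventually (\<lambda>x. \<bar>E x\<bar> \<le> \<beta> - c) at_top" if "\<alpha> \<le> \<beta>" and ev: "eventually (\<lambda>x. \<bar>E x\<bar> \<le> \<beta>) at_top" for \<beta>
  proof -
    obtain X0 where "\<And>x. x \<ge> X0 \<Longrightarrow> \<bar>E x\<bar> \<le> \<beta>" using ev by (auto simp: eventually_at_top_linorder)
    then obtain X where X: "X \<ge> 1" "\<And>x. x \<ge> X \<Longrightarrow> \<bar>E x\<bar> \<le> \<beta>" using that[of "max 1 X0"] by auto
    define F where "F = (\<lambda>x. if x \<ge> X then E x else 0)"
    obtain K' where K': "selberg_relation F K'"
      unfolding F_def using relation X(1) bounded by (rule selberg_relation_truncate)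
    have F: "\<forall>y. \<bar>F y\<bar> \<le> \<beta>" "\<forall>y. \<bar>- F y\<bar> \<le> \<beta>" using X(2) \<open>\<alpha> > 0\<close> \<open>\<alpha> \<le> \<beta>\<close> by (simp_all add: F_def)
    have FE: "eventually (\<lambda>x. F x = E x) at_top"
      using eventually_ge_at_top[of X] by eventually_elim (simp add: F_def)
    have Fosc: "oscillation_le F (2 * h) (\<alpha> / 2)"
      by (rule oscillation_le_cong[OF osc FE]) (use h in simp)
    have "eventually (\<lambda>x. F x \<le> \<beta> - c) at_top" using K' F(1) \<open>\<alpha> \<le> \<beta>\<close> Fosc by (rule below)
    moreover have "eventually (\<lambda>x. - F x \<le> \<beta> - c) at_top"
      using selberg_relation_uminus[OF K'] F(2) \<open>\<alpha> \<le> \<beta>\<close> oscillation_le_uminus[OF Fosc] by (rule below)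
    ultimately show ?thesis using FE by eventually_elim auto
  qed
  show ?thesis by (rule that[OF c improve])
qed

text \<open>The infimum of the eventual bounds for \<open>\<bar>E\<bar>\<close> could be improved if it were positive.\<close>

theorem selberg_relation_imp_tendsto_0:
  assumes bounded: "\<And>x. x > 0 \<Longrightarrow> \<bar>E x\<bar> \<le> B" and slow: "slowly_oscillating E" and relation: "selberg_relation E K"
  shows "(E \<longlongrightarrow> 0) at_top"
proof -
  define Z where "Z = {a. eventually (\<lambda>x. \<bar>E x\<bar> \<le> a) at_top}"
  have nonneg: "0 \<le> a" if "a \<in> Z" for a
  proof -
    have "eventually (\<lambda>x::real. 0 \<le> a) at_top"
      using that unfolding Z_def mem_Collect_eq by eventually_elim linarith
    then show ?thesis by simp
  qed
  then have bdd: "bdd_below Z" by (intro bdd_belowI)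
  have "B \<in> Z" unfolding Z_def using bounded by (auto intro: eventually_mono[OF eventually_gt_at_top[of 0]])
  have "Inf Z = 0"
  proof (rule ccontr)
    assume "Inf Z \<noteq> 0"
    moreover have "0 \<le> Inf Z" using \<open>B \<in> Z\<close> nonneg by (intro cInf_greatest) auto
    ultimately have "Inf Z > 0" by simp
    obtain c where c: "c > 0"
      "\<And>\<beta>. Inf Z \<le> \<beta> \<Longrightarrow> eventually (\<lambda>x. \<bar>E x\<bar> \<le> \<beta>) at_top \<Longrightarrow> eventually (\<lambda>x. \<bar>E x\<bar> \<le> \<beta> - c) at_top"
      using bounded slow relation \<open>Inf Z > 0\<close> by (rule eventually_abs_improve) (assumption, rule that)
    obtain \<beta> where \<beta>: "\<beta> \<in> Z" "\<beta> < Inf Z + c" using cInf_lessD[of Z "Inf Z + c"] \<open>B \<in> Z\<close> c(1) by auto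
    then have "\<beta> - c \<in> Z" using c(2)[of \<beta>] cInf_lower[OF _ bdd, of \<beta>] by (simp add: Z_def)
    then show False using cInf_lower[OF _ bdd, of "\<beta> - c"] \<beta>(2) by linarith
  qed
  show ?thesis
  proof (rule tendstoI)
    fix e :: real assume "e > 0"
    then obtain a where a: "a \<in> Z" "a < e" using cInf_lessD[of Z e] \<open>B \<in> Z\<close> \<open>Inf Z = 0\<close> by auto
    then have "eventually (\<lambda>x. \<bar>E x\<bar> \<le> a) at_top" by (simp add: Z_def)
    then show "eventually (\<lambda>x. dist (E x) 0 < e) at_top" by eventually_elim (use a(2) in simp)
  qed
qed

theorem prime_number_theorem: "((\<lambda>x. psi x / x) \<longlongrightarrow> 1) at_top"
proof -
  obtain B where B: "\<And>x. x > 0 \<Longrightarrow> \<bar>psi_error x\<bar> \<le> B" by (rule psi_error_bounded) (rule that)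
  obtain K where K: "selberg_relation psi_error K" by (rule selberg_relation_psi_error)
  have "(psi_error \<longlongrightarrow> 0) at_top"
    using B slowly_oscillating_psi_error K by (rule selberg_relation_imp_tendsto_0)
  then show ?thesis
    unfolding psi_error_def using LIM_zero_iff by blast
qed

lemma psi_minus_id_le:
  assumes "\<epsilon> > 0"
  obtains M where "M \<ge> 0" "\<And>s. s \<ge> 0 \<Longrightarrow> \<bar>psi s - s\<bar> \<le> M + \<epsilon> * s"
proof -
  have "eventually (\<lambda>x. \<bar>psi x / x - 1\<bar> < \<epsilon>) at_top"
    using prime_number_theorem assms by (simp add: tendsto_iff dist_real_def)
  then obtain X0 where "\<And>x. x \<ge> X0 \<Longrightarrow> \<bar>psi x / x - 1\<bar> < \<epsilon>" by (auto simp: eventually_at_top_linorder)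
  then obtain X where X: "X > 0" "\<And>x. x \<ge> X \<Longrightarrow> \<bar>psi x / x - 1\<bar> < \<epsilon>" using that[of "max 1 X0"] by auto
  have "\<bar>psi s - s\<bar> \<le> psi X + X + \<epsilon> * s" if "s \<ge> 0" for s
  proof (cases "s \<le> X")
    case True
    have "0 \<le> \<epsilon> * s" using assms that by simp
    then show ?thesis using psi_mono[OF True] psi_nonneg[of s] True that by linarith
  next
    case False
    then have "psi s - s = (psi s / s - 1) * s" using X(1) by (simp add: field_simps)
    also have "\<bar>\<dots>\<bar> \<le> \<epsilon> * s" unfolding abs_mult using X(2)[of s] False that by (intro mult_mono) auto
    finally show ?thesis using psi_nonneg[of X] X(1) by linarith
  qed
  then show ?thesis using that[of "psi X + X"] psi_nonneg[of X] X(1) by auto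
qed

section \<open>An upper bound sieve\<close>

lemma sum_mod_mult:
  fixes m k :: nat
  assumes "coprime m k" "m > 0" "k > 0"
  shows "(\<Sum>n<m * k. F (n mod m) (n mod k)) = (\<Sum>a<m. \<Sum>b<k. F a b)"
proof -
  have inj: "inj_on (\<lambda>n. (n mod m, n mod k)) {..<m * k}"
  proof (rule inj_onI)
    fix n n' assume n: "n \<in> {..<m * k}" "n' \<in> {..<m * k}" "(n mod m, n mod k) = (n' mod m, n' mod k)"
    then have "[n = n'] (mod m)" "[n = n'] (mod k)" by (auto simp: unique_euclidean_semiring_class.cong_def)
    then have "[n = n'] (mod m * k)" using assms(1) by (simp add: coprime_cong_mult_nat)
    then show "n = n'" using n by (simp add: unique_euclidean_semiring_class.cong_def)
  qed
  have "(\<lambda>n. (n mod m, n mod k)) ` {..<m * k} = {..<m} \<times> {..<k}"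
    using assms card_image[OF inj] by (intro card_subset_eq) auto
  then have "(\<Sum>(a,b)\<in>{..<m} \<times> {..<k}. F a b) = (\<Sum>n<m * k. F (n mod m) (n mod k))"
    using sum.reindex[OF inj, of "\<lambda>(a,b). F a b"] by simp
  then show ?thesis by (simp add: sum.cartesian_product)
qed

lemma dvd_prod_nat: "finite T \<Longrightarrow> p \<in> T \<Longrightarrow> p dvd \<Prod>(T :: nat set)"
  by (rule dvd_prodI[where f = "\<lambda>x. x"])

lemma sum_prod_periodic:
  fixes f :: "nat \<Rightarrow> nat \<Rightarrow> real"
  assumes "finite T" "\<And>p. p \<in> T \<Longrightarrow> prime p" "\<And>p n. p \<in> T \<Longrightarrow> f p (n mod p) = f p n"
  shows "(\<Sum>n<\<Prod>T. \<Prod>p\<in>T. f p n) = (\<Prod>p\<in>T. \<Sum>n<p. f p n)"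
  using assms
proof (induction T rule: finite_induct)
  case (insert p T)
  define M where "M = \<Prod>T"
  have M: "coprime M p" "M > 0" "p > 0" unfolding M_def using insert
    by (auto intro!: prod_coprime_left primes_coprime prime_gt_0_nat simp: prod_pos prime_gt_0_nat)
  have periodic: "f q (n mod M) = f q n" if "q \<in> T" for q n
  proof -
    have "q dvd M" unfolding M_def using that insert by (intro dvd_prod_nat) auto
    then have "n mod M mod q = n mod q" by (simp add: mod_mod_cancel)
    then show ?thesis using insert.prems(2)[of q "n mod M"] insert.prems(2)[of q n] that by simp
  qed
  have "(\<Sum>n<\<Prod>(insert p T). \<Prod>q\<in>insert p T. f q n) = (\<Sum>n<M * p. (\<Prod>q\<in>T. f q (n mod M)) * f p (n mod p))"
    using insert periodic by (simp add: M_def mult.commute cong: prod.cong)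
  also have "\<dots> = (\<Sum>a<M. \<Sum>b<p. (\<Prod>q\<in>T. f q a) * f p b)" by (rule sum_mod_mult[OF M])
  also have "\<dots> = (\<Prod>q\<in>T. \<Sum>n<q. f q n) * (\<Sum>b<p. f p b)"
    using insert by (simp add: sum_product M_def[symmetric] flip: sum_distrib_left sum_distrib_right)
  finally show ?case using insert by (simp add: mult.commute)
qed simp

lemma sum_periodic_window:
  fixes F :: "nat \<Rightarrow> real"
  assumes "\<And>n. F (n + M) = F n"
  shows "(\<Sum>n\<in>{s..<s + M}. F n) = (\<Sum>n<M. F n)"
proof (cases "M = 0")
  case False
  show ?thesis
  proof (induction s)
    case 0 show ?case by (simp add: atLeast0LessThan)
  next
    case (Suc s)
    have "(\<Sum>n\<in>{Suc s..<Suc s + M}. F n) = (\<Sum>n\<in>{Suc s..<s + M}. F n) + F (s + M)"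
      using False by (simp add: sum.atLeastLessThan_Suc)
    also have "\<dots> = (\<Sum>n\<in>{s..<s + M}. F n)"
      using False sum.atLeast_Suc_lessThan[of s "s + M" F] assms by simp
    finally show ?case using Suc by simp
  qed
qed simp

lemma sum_periodic_le:
  fixes F :: "nat \<Rightarrow> real"
  assumes periodic: "\<And>n. F (n + M) = F n" and bounded: "\<And>n. \<bar>F n\<bar> \<le> 1" and M: "M > 0"
    and nonneg: "(\<Sum>n<M. F n) \<ge> 0"
  shows "(\<Sum>n\<in>{s..<s + X}. F n) \<le> real X / real M * (\<Sum>n<M. F n) + real M"
proof (induction X arbitrary: s rule: less_induct)
  case (less X)
  show ?case
  proof (cases "X < M")
    case True
    have "(\<Sum>n\<in>{s..<s + X}. F n) \<le> (\<Sum>n\<in>{s..<s + X}. 1)" using bounded by (intro sum_mono) (auto simp: abs_le_iff)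
    also have "\<dots> \<le> real M" using True by simp
    also have "\<dots> \<le> real X / real M * (\<Sum>n<M. F n) + real M" using nonneg by simp
    finally show ?thesis .
  next
    case False
    have "(\<Sum>n\<in>{s..<s + X}. F n) = (\<Sum>n\<in>{s..<s + M}. F n) + (\<Sum>n\<in>{s + M..<s + M + (X - M)}. F n)"
      using False sum.atLeastLessThan_concat[of s "s + M" "s + X" F] by simp
    also have "(\<Sum>n\<in>{s..<s + M}. F n) = (\<Sum>n<M. F n)" using periodic by (rule sum_periodic_window)
    also have "(\<Sum>n\<in>{s + M..<s + M + (X - M)}. F n) \<le> real (X - M) / real M * (\<Sum>n<M. F n) + real M"
      using False M by (intro less) auto
    also have "(\<Sum>n<M. F n) + (real (X - M) / real M * (\<Sum>n<M. F n) + real M) = real X / real M * (\<Sum>n<M. F n) + real M"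
      using False M by (simp add: field_simps of_nat_diff)
    finally show ?thesis by simp
  qed
qed

definition small_subsets :: "nat set \<Rightarrow> real \<Rightarrow> nat set set" where
  "small_subsets S x = {T. T \<subseteq> S \<and> real (\<Prod>T) \<le> x}"

definition sqfree_sum :: "(nat \<Rightarrow> real) \<Rightarrow> nat set \<Rightarrow> real \<Rightarrow> real" where
  "sqfree_sum f S x = (\<Sum>T\<in>small_subsets S x. \<Prod>p\<in>T. f p)"

lemma finite_small_subsets [simp, intro]: "finite S \<Longrightarrow> finite (small_subsets S x)"
  unfolding small_subsets_def by (rule finite_subset[of _ "Pow S"]) auto

lemma small_subsets_insert:
  assumes "q \<notin> S" "finite S" "q > 0"
  shows "small_subsets (insert q S) x = small_subsets S x \<union> insert q ` small_subsets S (x / real q)"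
proof (intro equalityI subsetI)
  fix T assume T: "T \<in> small_subsets (insert q S) x"
  show "T \<in> small_subsets S x \<union> insert q ` small_subsets S (x / real q)"
  proof (cases "q \<in> T")
    case True
    define U where "U = T - {q}"
    have U: "T = insert q U" "U \<subseteq> S" "q \<notin> U" using True T by (auto simp: U_def small_subsets_def)
    moreover have "finite U" using U(2) assms(2) by (rule finite_subset)
    ultimately have "U \<in> small_subsets S (x / real q)" using T assms(3) by (simp add: small_subsets_def field_simps)
    then show ?thesis using U by blast
  qed (use T in \<open>auto simp: small_subsets_def\<close>)
next
  fix T assume "T \<in> small_subsets S x \<union> insert q ` small_subsets S (x / real q)"
  then show "T \<in> small_subsets (insert q S) x"
  proof
    assume "T \<in> insert q ` small_subsets S (x / real q)"
    then obtain U where U: "T = insert q U" "U \<subseteq> S" "real (\<Prod>U) \<le> x / real q" by (auto simp: small_subsets_def)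
    moreover have "finite U" "q \<notin> U" using U(2) assms finite_subset by auto
    ultimately show ?thesis using assms(3) by (auto simp: small_subsets_def field_simps)
  qed (auto simp: small_subsets_def)
qed

lemma sqfree_sum_insert:
  assumes "q \<notin> S" "finite S" "q > 0"
  shows "sqfree_sum f (insert q S) x = sqfree_sum f S x + f q * sqfree_sum f S (x / real q)"
proof -
  have notin: "q \<notin> T" "finite T" if "T \<in> small_subsets S y" for T y
    using that assms finite_subset by (auto simp: small_subsets_def)
  have "sqfree_sum f (insert q S) x
      = sqfree_sum f S x + (\<Sum>T\<in>insert q ` small_subsets S (x / real q). \<Prod>p\<in>T. f p)"
    unfolding sqfree_sum_def small_subsets_insert[OF assms]
    using assms notin by (intro sum.union_disjoint) auto
  also have "(\<Sum>T\<in>insert q ` small_subsets S (x / real q). \<Prod>p\<in>T. f p)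
      = (\<Sum>T\<in>small_subsets S (x / real q). \<Prod>p\<in>insert q T. f p)"
  proof (rule sum.reindex_cong[OF _ refl refl])
    show "inj_on (insert q) (small_subsets S (x / real q))"
      using notin by (intro inj_onI) (metis insert_ident)
  qed
  also have "\<dots> = f q * sqfree_sum f S (x / real q)"
    using notin by (simp add: sqfree_sum_def sum_distrib_left)
  finally show ?thesis .
qed

lemma sqfree_sum_nonneg:
  assumes "\<And>p. p \<in> S \<Longrightarrow> 0 \<le> f p"
  shows "0 \<le> sqfree_sum f S x"
  unfolding sqfree_sum_def using assms by (intro sum_nonneg prod_nonneg) (auto simp: small_subsets_def)

lemma sqfree_sum_mono:
  assumes "finite S" "\<And>p. p \<in> S \<Longrightarrow> 0 \<le> f p" "x \<le> y"
  shows "sqfree_sum f S x \<le> sqfree_sum f S y"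
  unfolding sqfree_sum_def using assms
  by (intro sum_mono2 prod_nonneg) (auto simp: small_subsets_def)

lemma sqfree_sum_Un_ge:
  assumes "finite B" "finite S" "B \<inter> S = {}"
    and "\<And>p. p \<in> B \<union> S \<Longrightarrow> 0 \<le> f p" "\<And>p. p \<in> B \<Longrightarrow> 0 < p" and "x \<ge> 0"
  shows "(\<Prod>q\<in>B. 1 + f q) * sqfree_sum f S (x / real (\<Prod>B)) \<le> sqfree_sum f (B \<union> S) x"
  using assms
proof (induction B arbitrary: x rule: finite_induct)
  case (insert q B)
  have q: "real q \<ge> 1" using insert.prems(4)[of q] by simp
  have fq: "0 \<le> f q" using insert.prems by simp
  have mono: "sqfree_sum f (B \<union> S) (x / real q) \<le> sqfree_sum f (B \<union> S) x"
    using insert q mult_left_mono[OF q \<open>0 \<le> x\<close>] by (intro sqfree_sum_mono) (auto simp: field_simps)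
  have "(\<Prod>p\<in>insert q B. 1 + f p) * sqfree_sum f S (x / real (\<Prod>(insert q B)))
      = (1 + f q) * ((\<Prod>p\<in>B. 1 + f p) * sqfree_sum f S (x / real q / real (\<Prod>B)))"
    using insert by (simp add: mult.assoc)
  also have "\<dots> \<le> (1 + f q) * sqfree_sum f (B \<union> S) (x / real q)"
    using insert fq by (intro mult_left_mono insert.IH) auto
  also have "\<dots> \<le> sqfree_sum f (B \<union> S) x + f q * sqfree_sum f (B \<union> S) (x / real q)"
    using mono by (simp add: distrib_right)
  also have "\<dots> = sqfree_sum f (insert q (B \<union> S)) x"
    using insert by (intro sqfree_sum_insert[symmetric]) auto
  finally show ?case by simp
qed simp

lemma card_small_subsets_le:
  assumes "finite P" "\<And>p. p \<in> P \<Longrightarrow> prime p"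
  shows "card (small_subsets P (real D)) \<le> D"
proof -
  have "inj_on (\<lambda>T. \<Prod>T) (small_subsets P (real D))"
  proof (rule inj_on_inverseI[where g = prime_factors])
    fix T assume "T \<in> small_subsets P (real D)"
    then show "prime_factors (\<Prod>T) = T"
      using assms finite_subset[OF _ assms(1)] by (intro prime_factors_prod_primes) (auto simp: small_subsets_def)
  qed
  then have "card (small_subsets P (real D)) = card ((\<lambda>T. \<Prod>T) ` small_subsets P (real D))" by (simp add: card_image)
  also have "\<dots> \<le> card {1..D}"
  proof (intro card_mono image_subsetI)
    fix T assume T: "T \<in> small_subsets P (real D)"
    have "\<Prod>T > 0" using T assms(2) prime_gt_0_nat by (intro prod_pos) (auto simp: small_subsets_def)
    moreover have "real (\<Prod>T) \<le> real D" using T by (simp only: small_subsets_def mem_Collect_eq)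
    then have "\<Prod>T \<le> D" by (simp only: of_nat_le_iff)
    ultimately show "\<Prod>T \<in> {1..D}" by simp
  qed simp
  finally show ?thesis by simp
qed

locale sieve =
  fixes P :: "nat set" and \<Omega> :: "nat \<Rightarrow> nat set"
  assumes finite_P: "finite P" and prime_P: "\<And>p. p \<in> P \<Longrightarrow> prime p"
    and residues: "\<And>p. p \<in> P \<Longrightarrow> \<Omega> p \<subseteq> {..<p}" and card_residues: "\<And>p. p \<in> P \<Longrightarrow> 2 * card (\<Omega> p) \<le> p"
begin

definition odds :: "nat \<Rightarrow> real" where
  "odds p = real (card (\<Omega> p)) / (real p - real (card (\<Omega> p)))"

text \<open>For \<open>n\<close> uniform modulo \<open>p\<close> the variables \<open>score p n\<close> have mean 0 and variance \<open>odds p\<close>, and they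
  are independent for different \<open>p\<close>; on sifted \<open>n\<close> they are constant. This replaces the
  diagonalisation of the quadratic form in Selberg's sieve.\<close>

definition score :: "nat \<Rightarrow> nat \<Rightarrow> real" where
  "score p n = (if n mod p \<in> \<Omega> p then -1 else odds p)"

definition score_prod :: "nat set \<Rightarrow> nat \<Rightarrow> real" where
  "score_prod T n = (\<Prod>p\<in>T. score p n)"

lemma card_residues_less: "p \<in> P \<Longrightarrow> card (\<Omega> p) < p"
  using card_residues[of p] prime_gt_0_nat[OF prime_P, of p] by linarith

lemma odds_bounds:
  assumes "p \<in> P"
  shows "0 \<le> odds p" "odds p \<le> 1"
  using card_residues[OF assms] card_residues_less[OF assms] by (auto simp: odds_def field_simps)

lemma abs_score_le_1: "p \<in> P \<Longrightarrow> \<bar>score p n\<bar> \<le> 1"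
  using odds_bounds[of p] by (auto simp: score_def)

lemma score_mod [simp]: "score p (n mod p) = score p n"
  by (simp add: score_def)

lemma sum_residues_if:
  assumes "p \<in> P"
  shows "(\<Sum>n<p. if n mod p \<in> \<Omega> p then a else b)
    = real (card (\<Omega> p)) * a + (real p - real (card (\<Omega> p))) * (b :: real)"
proof -
  have "finite (\<Omega> p)" using residues[OF assms] finite_subset by blast
  have "(\<Sum>n<p. if n mod p \<in> \<Omega> p then a else b) = (\<Sum>n<p. if n \<in> \<Omega> p then a else b)"
    by (intro sum.cong) auto
  also have "\<dots> = (\<Sum>n\<in>\<Omega> p. a) + (\<Sum>n\<in>{..<p} - \<Omega> p. b)"
    using residues[OF assms] by (subst sum.If_cases) (auto simp: Int_absorb1 Diff_eq)
  finally show ?thesis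
    using residues[OF assms] \<open>finite (\<Omega> p)\<close> card_residues_less[OF assms] by (simp add: card_Diff_subset of_nat_diff)
qed

lemma sum_score:
  assumes "p \<in> P"
  shows "(\<Sum>n<p. score p n) = 0" "(\<Sum>n<p. score p n * score p n) = real p * odds p"
proof -
  define w where "w = real (card (\<Omega> p))"
  define v where "v = real p - w"
  have v: "v > 0" using card_residues_less[OF assms] by (simp add: v_def w_def)
  have odds: "odds p = w / v" by (simp add: odds_def v_def w_def)
  show "(\<Sum>n<p. score p n) = 0"
    using v unfolding score_def sum_residues_if[OF assms] by (simp add: odds flip: v_def w_def)
  have "(\<Sum>n<p. score p n * score p n) = (\<Sum>n<p. if n mod p \<in> \<Omega> p then 1 else odds p * odds p)"
    by (intro sum.cong) (auto simp: score_def)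
  also have "\<dots> = w + v * (w / v * (w / v))"
    unfolding sum_residues_if[OF assms] by (simp add: odds flip: v_def w_def)
  also have "\<dots> = (w + v) * (w / v)" using v by (simp add: field_simps)
  finally show "(\<Sum>n<p. score p n * score p n) = real p * odds p" by (simp add: odds v_def)
qed

lemma score_prod_add_period:
  assumes "finite T" "\<Prod>T dvd M"
  shows "score_prod T (n + M) = score_prod T n"
  unfolding score_prod_def
proof (intro prod.cong refl)
  fix p assume "p \<in> T"
  then have "p dvd M" using assms dvd_prod_nat dvd_trans by blast
  then have "(n + M) mod p = n mod p" by (auto elim!: dvdE)
  then show "score p (n + M) = score p n" by (metis score_mod)
qed

lemma abs_score_prod_le_1: "T \<subseteq> P \<Longrightarrow> \<bar>score_prod T n\<bar> \<le> 1"
  unfolding score_prod_def abs_prod using abs_score_le_1 by (intro prod_le_1) auto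

lemma sum_score_prod_mult_period:
  assumes T: "T1 \<subseteq> P" "T2 \<subseteq> P"
  shows "(\<Sum>n<\<Prod>(T1 \<union> T2). score_prod T1 n * score_prod T2 n)
    = (if T1 = T2 then real (\<Prod>T1) * (\<Prod>p\<in>T1. odds p) else 0)"
proof -
  let ?T = "T1 \<union> T2"
  define f where "f = (\<lambda>p n. (if p \<in> T1 then score p n else 1) * (if p \<in> T2 then score p n else 1))"
  have fin: "finite T1" "finite T2" using T finite_P finite_subset by blast+
  have in_P: "p \<in> P" if "p \<in> ?T" for p using that T by auto
  have "score_prod T1 n * score_prod T2 n = (\<Prod>p\<in>?T. f p n)" for n
  proof -
    have "score_prod T1 n = (\<Prod>p\<in>?T. if p \<in> T1 then score p n else 1)"
      "score_prod T2 n = (\<Prod>p\<in>?T. if p \<in> T2 then score p n else 1)"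
      unfolding score_prod_def using fin by (auto intro!: prod.mono_neutral_cong_left)
    then show ?thesis by (simp add: f_def prod.distrib)
  qed
  moreover have "(\<Sum>n<\<Prod>?T. \<Prod>p\<in>?T. f p n) = (\<Prod>p\<in>?T. \<Sum>n<p. f p n)"
    using fin in_P prime_P by (intro sum_prod_periodic) (auto simp: f_def)
  moreover have "(\<Prod>p\<in>?T. \<Sum>n<p. f p n) = (if T1 = T2 then real (\<Prod>T1) * (\<Prod>p\<in>T1. odds p) else 0)"
  proof (cases "T1 = T2")
    case True
    then have "(\<Prod>p\<in>?T. \<Sum>n<p. f p n) = (\<Prod>p\<in>T1. real p * odds p)"
      using sum_score(2) T by (intro prod.cong) (auto simp: f_def)
    then show ?thesis using True by (simp add: prod.distrib)
  next
    case False
    then obtain p where p: "p \<in> ?T" "p \<notin> T1 \<or> p \<notin> T2" by auto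
    then have "(\<Sum>n<p. f p n) = (\<Sum>n<p. score p n)" by (intro sum.cong) (auto simp: f_def)
    also have "\<dots> = 0" using sum_score(1) in_P p by auto
    finally show ?thesis using p False fin by (auto intro!: prod_zero)
  qed
  ultimately show ?thesis by simp
qed

lemma sum_score_prod_mult_le:
  assumes T: "T1 \<subseteq> P" "T2 \<subseteq> P"
  shows "(\<Sum>n\<in>{s..<s + X}. score_prod T1 n * score_prod T2 n)
     \<le> (if T1 = T2 then real X * (\<Prod>p\<in>T1. odds p) else 0) + real (\<Prod>T1 * \<Prod>T2)"
proof -
  define M where "M = \<Prod>(T1 \<union> T2)"
  have fin: "finite T1" "finite T2" using T finite_P finite_subset by blast+
  have pos: "0 < \<Prod>S" if "S \<subseteq> P" for S
    using that prime_P prime_gt_0_nat by (intro prod_pos) auto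
  have M: "M > 0" unfolding M_def using T by (intro pos) auto
  have "0 < \<Prod>(T1 \<inter> T2)" using T by (intro pos) auto
  then have "1 \<le> \<Prod>(T1 \<inter> T2)" by linarith
  then have "M * 1 \<le> M * \<Prod>(T1 \<inter> T2)" by (rule mult_le_mono2)
  also have "\<dots> = \<Prod>T1 * \<Prod>T2" unfolding M_def using prod.union_inter[OF fin, of "\<lambda>x. x"] by simp
  finally have M_le: "real M \<le> real (\<Prod>T1 * \<Prod>T2)" by (simp only: mult_1_right of_nat_le_iff)
  have "\<Prod>T1 dvd M" "\<Prod>T2 dvd M" unfolding M_def using fin by (auto intro!: prod_dvd_prod_subset)
  then have periodic: "score_prod T1 (n + M) * score_prod T2 (n + M) = score_prod T1 n * score_prod T2 n" for n
    using fin by (simp add: score_prod_add_period)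
  have bounded: "\<bar>score_prod T1 n * score_prod T2 n\<bar> \<le> 1" for n
    unfolding abs_mult using abs_score_prod_le_1 T by (intro mult_le_one) auto
  have full: "(\<Sum>n<M. score_prod T1 n * score_prod T2 n) = (if T1 = T2 then real M * (\<Prod>p\<in>T1. odds p) else 0)"
    using sum_score_prod_mult_period[OF T] by (auto simp: M_def)
  have "0 \<le> (\<Sum>n<M. score_prod T1 n * score_prod T2 n)"
    unfolding full using odds_bounds T by (auto intro!: mult_nonneg_nonneg prod_nonneg)
  then have "(\<Sum>n\<in>{s..<s + X}. score_prod T1 n * score_prod T2 n)
      \<le> real X / real M * (\<Sum>n<M. score_prod T1 n * score_prod T2 n) + real M"
    by (rule sum_periodic_le[where F = "\<lambda>n. score_prod T1 n * score_prod T2 n", OF periodic bounded M])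
  also have "real X / real M * (\<Sum>n<M. score_prod T1 n * score_prod T2 n)
      = (if T1 = T2 then real X * (\<Prod>p\<in>T1. odds p) else 0)"
    unfolding full using M by simp
  finally show ?thesis using M_le by linarith
qed

lemma second_moment_le:
  fixes D s X :: nat
  defines "S \<equiv> small_subsets P (real D)"
  shows "(\<Sum>n\<in>{s..<s + X}. (\<Sum>T\<in>S. score_prod T n)\<^sup>2) \<le> real X * sqfree_sum odds P (real D) + real D ^ 4"
proof -
  have "(\<Sum>n\<in>{s..<s + X}. (\<Sum>T\<in>S. score_prod T n)\<^sup>2)
      = (\<Sum>n\<in>{s..<s + X}. \<Sum>T1\<in>S. \<Sum>T2\<in>S. score_prod T1 n * score_prod T2 n)"
    by (simp add: power2_eq_square sum_product)
  also have "\<dots> = (\<Sum>T1\<in>S. \<Sum>n\<in>{s..<s + X}. \<Sum>T2\<in>S. score_prod T1 n * score_prod T2 n)"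
    by (rule sum.swap)
  also have "\<dots> = (\<Sum>T1\<in>S. \<Sum>T2\<in>S. \<Sum>n\<in>{s..<s + X}. score_prod T1 n * score_prod T2 n)"
    by (intro sum.cong refl sum.swap)
  also have "\<dots> \<le> (\<Sum>T1\<in>S. \<Sum>T2\<in>S. (if T1 = T2 then real X * (\<Prod>p\<in>T1. odds p) else 0) + real D * real D)"
  proof (intro sum_mono)
    fix T1 T2 assume T: "T1 \<in> S" "T2 \<in> S"
    then have sub: "T1 \<subseteq> P" "T2 \<subseteq> P" and "real (\<Prod>T1) \<le> real D" "real (\<Prod>T2) \<le> real D"
      unfolding S_def small_subsets_def by blast+
    then have "real (\<Prod>T1 * \<Prod>T2) \<le> real D * real D"
      unfolding of_nat_mult by (intro mult_mono of_nat_0_le_iff)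
    then show "(\<Sum>n\<in>{s..<s + X}. score_prod T1 n * score_prod T2 n)
        \<le> (if T1 = T2 then real X * (\<Prod>p\<in>T1. odds p) else 0) + real D * real D"
      using sum_score_prod_mult_le[OF sub, of s X] by linarith
  qed
  also have "\<dots> = real X * sqfree_sum odds P (real D) + real (card S) * (real (card S) * (real D * real D))"
    using finite_P by (simp add: S_def sum.distrib sqfree_sum_def sum_distrib_left)
  also have "\<dots> \<le> real X * sqfree_sum odds P (real D) + real D * (real D * (real D * real D))"
    using card_small_subsets_le[OF finite_P prime_P, of D] by (intro add_left_mono mult_mono) (auto simp: S_def)
  finally show ?thesis by (simp add: power4_eq_xxxx mult_ac)
qed

theorem card_sifted_le:
  assumes "D \<ge> 1"
  shows "real (card {n\<in>{s..<s + X}. \<forall>p\<in>P. n mod p \<notin> \<Omega> p}) \<le> real X / sqfree_sum odds P (real D) + real D ^ 4"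
proof -
  define Z where "Z = {n\<in>{s..<s + X}. \<forall>p\<in>P. n mod p \<notin> \<Omega> p}"
  define L where "L = sqfree_sum odds P (real D)"
  let ?S = "small_subsets P (real D)"
  have "(\<Sum>T\<in>{{}}. \<Prod>p\<in>T. odds p) \<le> L"
    unfolding L_def sqfree_sum_def using assms finite_P odds_bounds
    by (intro sum_mono2) (auto intro!: prod_nonneg simp: small_subsets_def)
  then have L: "L \<ge> 1" by simp
  have "(\<Sum>T\<in>?S. score_prod T n) = L" if "n \<in> Z" for n
    unfolding L_def sqfree_sum_def score_prod_def using that
    by (intro sum.cong prod.cong) (auto simp: Z_def small_subsets_def score_def)
  then have "real (card Z) * L\<^sup>2 = (\<Sum>n\<in>Z. (\<Sum>T\<in>?S. score_prod T n)\<^sup>2)" by simp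
  also have "\<dots> \<le> (\<Sum>n\<in>{s..<s + X}. (\<Sum>T\<in>?S. score_prod T n)\<^sup>2)"
    by (intro sum_mono2) (auto simp: Z_def)
  also have "\<dots> \<le> real X * L + real D ^ 4" unfolding L_def by (rule second_moment_le)
  also have "real D ^ 4 \<le> real D ^ 4 * L\<^sup>2" using L by (simp add: mult_le_cancel_left1)
  finally have "real (card Z) * L\<^sup>2 \<le> (real X / L + real D ^ 4) * L\<^sup>2"
    using L by (simp add: algebra_simps power2_eq_square)
  then show ?thesis using L by (simp add: Z_def L_def mult_le_cancel_right)
qed

end

definition smooth_nats :: "nat set \<Rightarrow> real \<Rightarrow> nat set" where
  "smooth_nats S x = {n \<in> nats_upto x. prime_factors n \<subseteq> S}"

definition smooth_sum :: "nat set \<Rightarrow> real \<Rightarrow> real" where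
  "smooth_sum S x = (\<Sum>n\<in>smooth_nats S x. 1 / real n)"

definition euler_product :: "nat set \<Rightarrow> real" where
  "euler_product B = (\<Prod>q\<in>B. real q / (real q - 1))"

lemma finite_smooth_nats [simp]: "finite (smooth_nats S x)"
  by (simp add: smooth_nats_def)

lemma euler_product_pos:
  assumes "\<And>q. q \<in> B \<Longrightarrow> prime q"
  shows "0 < euler_product B"
  unfolding euler_product_def
proof (rule prod_pos)
  fix q assume "q \<in> B"
  then have "1 < q" using assms prime_gt_1_nat by blast
  then show "0 < real q / (real q - 1)" by simp
qed

lemma smooth_sum_mono: "x \<le> y \<Longrightarrow> smooth_sum S x \<le> smooth_sum S y"
  unfolding smooth_sum_def using nats_upto_mono[of x y] by (intro sum_mono2) (auto simp: smooth_nats_def)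

lemma smooth_nats_insert:
  assumes q: "prime q" "q \<notin> S"
  shows "smooth_nats (insert q S) x = smooth_nats S x \<union> (\<lambda>m. q * m) ` smooth_nats (insert q S) (x / real q)"
    and "smooth_nats S x \<inter> (\<lambda>m. q * m) ` smooth_nats (insert q S) (x / real q) = {}"
proof -
  have q0: "q > 0" using q prime_gt_0_nat by blast
  have factors: "prime_factors (q * m) = insert q (prime_factors m)" if "m > 0" for m
    using q q0 that by (simp add: prime_factors_product prime_prime_factors)
  have mult: "q * m \<in> smooth_nats (insert q S) x \<longleftrightarrow> m \<in> smooth_nats (insert q S) (x / real q)" for m
  proof (cases "m = 0")
    case False
    then show ?thesis
      using q0 factors[of m] by (simp add: smooth_nats_def in_nats_upto_divide_iff) (simp add: nats_upto_def)
  qed (simp add: smooth_nats_def nats_upto_def)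
  show "smooth_nats (insert q S) x = smooth_nats S x \<union> (\<lambda>m. q * m) ` smooth_nats (insert q S) (x / real q)"
  proof (intro equalityI subsetI)
    fix n assume n: "n \<in> smooth_nats (insert q S) x"
    show "n \<in> smooth_nats S x \<union> (\<lambda>m. q * m) ` smooth_nats (insert q S) (x / real q)"
    proof (cases "q dvd n")
      case True
      then show ?thesis using n mult by (auto elim!: dvdE)
    next
      case False
      then show ?thesis using n by (auto simp: smooth_nats_def prime_factors_dvd)
    qed
  next
    fix n assume "n \<in> smooth_nats S x \<union> (\<lambda>m. q * m) ` smooth_nats (insert q S) (x / real q)"
    then show "n \<in> smooth_nats (insert q S) x" using mult by (auto simp: smooth_nats_def)
  qed
  have "q \<in> prime_factors (q * m)" if "m \<in> smooth_nats (insert q S) (x / real q)" for m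
    using that factors[of m] by (simp add: smooth_nats_def nats_upto_def)
  then show "smooth_nats S x \<inter> (\<lambda>m. q * m) ` smooth_nats (insert q S) (x / real q) = {}"
    using q(2) by (auto simp: smooth_nats_def)
qed

lemma smooth_sum_insert:
  assumes q: "prime q" "q \<notin> S"
  shows "smooth_sum (insert q S) x = smooth_sum S x + smooth_sum (insert q S) (x / real q) / real q"
proof -
  let ?A = "smooth_nats (insert q S) (x / real q)"
  have "smooth_sum (insert q S) x = smooth_sum S x + (\<Sum>n\<in>(\<lambda>m. q * m) ` ?A. 1 / real n)"
    unfolding smooth_sum_def smooth_nats_insert(1)[OF q, of x]
    using smooth_nats_insert(2)[OF q, of x] by (intro sum.union_disjoint) auto
  also have "(\<Sum>n\<in>(\<lambda>m. q * m) ` ?A. 1 / real n) = (\<Sum>m\<in>?A. 1 / real m / real q)"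
    using prime_gt_0_nat[OF q(1)] by (subst sum.reindex) (auto intro!: inj_onI sum.cong simp: mult.commute)
  finally show ?thesis by (simp add: smooth_sum_def sum_divide_distrib)
qed

lemma smooth_sum_insert_le:
  assumes q: "prime q" "q \<notin> S"
  shows "smooth_sum (insert q S) x \<le> real q / (real q - 1) * smooth_sum S x"
proof (cases "x \<ge> 0")
  case True
  have q2: "q \<ge> 2" using q prime_ge_2_nat by blast
  have "smooth_sum (insert q S) (x / real q) \<le> smooth_sum (insert q S) x"
    using q2 True mult_left_mono[of 1 "real q" x] by (intro smooth_sum_mono) (auto simp: field_simps)
  then have "smooth_sum (insert q S) x \<le> smooth_sum S x + smooth_sum (insert q S) x / real q"
    using smooth_sum_insert[OF q, of x] q2 by (simp add: divide_right_mono)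
  then show ?thesis using q2 by (simp add: field_simps)
qed (simp add: smooth_sum_def smooth_nats_def nats_upto_empty)

lemma smooth_nats_empty: "smooth_nats {} x = (if x \<ge> 1 then {1} else {})"
  by (auto simp: smooth_nats_def nats_upto_def prime_factorization_empty_iff)

lemma smooth_sum_le_sqfree_sum:
  assumes "finite S" "\<And>p. p \<in> S \<Longrightarrow> prime p"
  shows "smooth_sum S x \<le> sqfree_sum (\<lambda>p. 1 / (real p - 1)) S x"
  using assms
proof (induction S arbitrary: x rule: finite_induct)
  case empty
  have "small_subsets {} x = (if x \<ge> 1 then {{}} else {})" by (auto simp: small_subsets_def)
  then show ?case by (simp add: smooth_sum_def smooth_nats_empty sqfree_sum_def)
next
  case (insert q S)
  let ?f = "\<lambda>p. 1 / (real p - 1)"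
  have q: "prime q" "q \<notin> S" "q \<ge> 2" using insert prime_ge_2_nat by auto
  have "smooth_sum (insert q S) (x / real q) / real q \<le> real q / (real q - 1) * smooth_sum S (x / real q) / real q"
    by (intro divide_right_mono smooth_sum_insert_le q) auto
  also have "\<dots> = ?f q * smooth_sum S (x / real q)" using q by simp
  also have "\<dots> \<le> ?f q * sqfree_sum ?f S (x / real q)"
    using insert q by (intro mult_left_mono insert.IH) auto
  finally have "smooth_sum (insert q S) x \<le> smooth_sum S x + ?f q * sqfree_sum ?f S (x / real q)"
    using smooth_sum_insert[OF q(1,2), of x] by linarith
  also have "\<dots> \<le> sqfree_sum ?f S x + ?f q * sqfree_sum ?f S (x / real q)" using insert by simp
  also have "\<dots> = sqfree_sum ?f (insert q S) x"
    using insert q by (intro sqfree_sum_insert[symmetric]) auto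
  finally show ?case .
qed

lemma smooth_sum_Un_le:
  assumes "finite B" "\<And>p. p \<in> B \<Longrightarrow> prime p" "B \<inter> S = {}"
  shows "smooth_sum (B \<union> S) x \<le> euler_product B * smooth_sum S x"
  using assms
proof (induction B rule: finite_induct)
  case empty
  show ?case by (simp add: euler_product_def)
next
  case (insert q B)
  have q: "prime q" "q \<notin> B \<union> S" "q \<ge> 2" using insert prime_ge_2_nat by auto
  have "smooth_sum (insert q B \<union> S) x \<le> real q / (real q - 1) * smooth_sum (B \<union> S) x"
    using smooth_sum_insert_le[OF q(1,2)] by simp
  also have "\<dots> \<le> real q / (real q - 1) * (euler_product B * smooth_sum S x)"
    using insert q by (intro mult_left_mono insert.IH) auto
  finally show ?case using insert by (simp add: euler_product_def mult.assoc)
qed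

lemma ln_le_smooth_sum:
  assumes "x \<ge> 1" "\<And>p. prime p \<Longrightarrow> real p \<le> x \<Longrightarrow> p \<in> S"
  shows "ln x \<le> smooth_sum S x"
proof -
  have "p \<in> S" if "n \<in> nats_upto x" "p \<in> prime_factors n" for n p
  proof -
    have "p \<le> n" "prime p" "real n \<le> x" using that by (auto simp: nats_upto_def prime_factors_dvd dvd_imp_le)
    then show ?thesis using assms(2)[of p] by simp
  qed
  then have "smooth_nats S x = nats_upto x" by (auto simp: smooth_nats_def)
  then show ?thesis using ln_le_sum_inverse[OF assms(1)] by (simp add: smooth_sum_def)
qed

lemma euler_product_unbounded:
  fixes y :: nat and K :: real
  obtains B where "finite B" "\<And>q. q \<in> B \<Longrightarrow> prime q \<and> q > y" "euler_product B \<ge> K"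
proof -
  define Y where "Y = {p. prime p \<and> p \<le> y}"
  define z where "z = max (real y + 1) (exp (K * euler_product Y))"
  define B where "B = {p. prime p \<and> p > y \<and> real p \<le> z}"
  have "B \<subseteq> nats_upto z" unfolding B_def nats_upto_def using prime_gt_0_nat by blast
  then have "finite B" by (rule finite_subset) (rule finite_nats_upto)
  moreover have "finite Y" unfolding Y_def by simp
  ultimately have fin: "finite Y" "finite B" by blast+
  have Y: "euler_product Y > 0" by (rule euler_product_pos) (simp add: Y_def)
  have z: "z \<ge> 1" "z \<ge> exp (K * euler_product Y)" by (auto simp: z_def)
  have "K * euler_product Y \<le> ln z" using z by (subst ln_ge_iff) auto
  also have "\<dots> \<le> smooth_sum (B \<union> Y \<union> {}) z" using z by (intro ln_le_smooth_sum) (auto simp: B_def Y_def)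
  also have "\<dots> \<le> euler_product (B \<union> Y) * smooth_sum {} z"
    using fin by (intro smooth_sum_Un_le) (auto simp: B_def Y_def)
  also have "\<dots> = euler_product (B \<union> Y)" using z by (simp add: smooth_sum_def smooth_nats_empty)
  also have "\<dots> = euler_product B * euler_product Y"
    unfolding euler_product_def by (rule prod.union_disjoint[OF fin(2,1)]) (auto simp: B_def Y_def)
  finally have large: "K \<le> euler_product B" using Y by simp
  show ?thesis by (rule that[OF fin(2) _ large]) (simp add: B_def)
qed

lemma sqfree_sum_ge_euler_product:
  fixes f :: "nat \<Rightarrow> real"
  assumes P: "finite P" "\<And>p. p \<in> P \<Longrightarrow> prime p" "\<And>p. prime p \<Longrightarrow> real p \<le> D \<Longrightarrow> p \<in> P"
    and B: "B \<subseteq> P" "real (\<Prod>B) < D"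
    and f: "\<And>p. p \<in> P - B \<Longrightarrow> f p = 1 / (real p - 1)" "\<And>q. q \<in> B \<Longrightarrow> (real q / (real q - 1))\<^sup>2 \<le> 1 + f q"
  shows "euler_product B * ln (D / real (\<Prod>B)) \<le> sqfree_sum f P D"
proof -
  define x where "x = D / real (\<Prod>B)"
  have fin: "finite B" using B(1) P(1) by (rule finite_subset)
  have "\<Prod>B > 0" using B P prime_gt_0_nat by (intro prod_pos) auto
  then have prod_ge: "real (\<Prod>B) \<ge> 1" by (simp del: of_nat_prod)
  then have x: "x \<ge> 1" "x \<le> D" using B(2) mult_left_mono[OF prod_ge, of D] by (simp_all add: x_def field_simps)
  have BP: "B \<union> (P - B) = P" using B by auto
  have K: "euler_product B > 0" using B P by (intro euler_product_pos) auto
  have q1: "real q - 1 > 0" if "q \<in> P" for q using prime_gt_1_nat[OF P(2)[OF that]] by simp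
  have f_nonneg: "0 \<le> f p" if "p \<in> P" for p
  proof (cases "p \<in> B")
    case True
    have "1 \<le> real p / (real p - 1)" using q1[OF that] by (simp add: field_simps)
    then have "1 \<le> (real p / (real p - 1))\<^sup>2" by (rule one_le_power)
    then show ?thesis using f(2)[OF True] by simp
  qed (use f(1)[of p] q1[OF that] that in auto)
  have cong: "sqfree_sum f (P - B) x = sqfree_sum (\<lambda>p. 1 / (real p - 1)) (P - B) x"
    unfolding sqfree_sum_def using f(1) by (intro sum.cong prod.cong refl) (auto simp: small_subsets_def)
  have "ln x \<le> smooth_sum (B \<union> (P - B)) x" unfolding BP using x P(3) by (intro ln_le_smooth_sum) auto
  also have "\<dots> \<le> euler_product B * smooth_sum (P - B) x" using fin B P by (intro smooth_sum_Un_le) auto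
  also have "\<dots> \<le> euler_product B * sqfree_sum f (P - B) x"
    unfolding cong using K P by (intro mult_left_mono smooth_sum_le_sqfree_sum) auto
  finally have "euler_product B * ln x \<le> (euler_product B)\<^sup>2 * sqfree_sum f (P - B) x"
    using K by (simp add: power2_eq_square mult.assoc)
  also have "\<dots> \<le> (\<Prod>q\<in>B. 1 + f q) * sqfree_sum f (P - B) x"
    unfolding euler_product_def prod_power_distrib
    using f(2) f_nonneg by (intro mult_right_mono prod_mono sqfree_sum_nonneg) auto
  also have "\<dots> \<le> sqfree_sum f (B \<union> (P - B)) D"
    unfolding x_def using fin P B f_nonneg x prime_gt_0_nat by (intro sqfree_sum_Un_ge) auto
  finally show ?thesis unfolding BP x_def .
qed

definition avoiding :: "nat set \<Rightarrow> nat set" where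
  "avoiding B = {p. \<forall>q\<in>B. p mod q \<noteq> 1}"

definition avoiding_residues :: "nat set \<Rightarrow> nat \<Rightarrow> nat set" where
  "avoiding_residues B p = (if p \<in> B then {0, 1} else {0})"

lemma card_avoiding_residues: "card (avoiding_residues B p) = (if p \<in> B then 2 else 1)"
  by (simp add: avoiding_residues_def)

lemma sieve_avoiding_residues:
  assumes "finite B" "\<And>q. q \<in> B \<Longrightarrow> prime q \<and> q > 3"
  shows "sieve ({p. prime p \<and> p \<le> D} \<union> B) (avoiding_residues B)"
proof
  fix p assume p: "p \<in> {p. prime p \<and> p \<le> D} \<union> B"
  then show "prime p" using assms(2) by auto
  then show "avoiding_residues B p \<subseteq> {..<p}" using prime_gt_1_nat[of p] by (auto simp: avoiding_residues_def)
  show "2 * card (avoiding_residues B p) \<le> p"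
    using p assms(2)[of p] prime_ge_2_nat[of p] by (auto simp: card_avoiding_residues)
qed (use assms(1) in simp)

lemma primes_avoiding_subset_sifted:
  fixes D :: nat
  assumes "\<And>q. q \<in> B \<Longrightarrow> prime q"
  defines "P \<equiv> {p. prime p \<and> p \<le> D} \<union> B"
  shows "{p \<in> I. prime p \<and> p \<in> avoiding B}
    \<subseteq> {n \<in> I. \<forall>p\<in>P. n mod p \<notin> avoiding_residues B p} \<union> {1..D} \<union> B"
proof
  fix p assume p: "p \<in> {p \<in> I. prime p \<and> p \<in> avoiding B}"
  have "p mod r \<notin> avoiding_residues B r" if "p \<notin> {1..D} \<union> B" "r \<in> P" for r
  proof -
    have "prime r" using that(2) assms(1) by (auto simp: P_def)
    then have "\<not> r dvd p" using primes_dvd_imp_eq[of r p] p that prime_gt_0_nat[of p] by (auto simp: P_def)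
    then show ?thesis using p by (auto simp: avoiding_residues_def avoiding_def dvd_eq_mod_eq_0)
  qed
  then show "p \<in> {n \<in> I. \<forall>p\<in>P. n mod p \<notin> avoiding_residues B p} \<union> {1..D} \<union> B" using p by blast
qed

lemma square_divide_minus_one_le:
  fixes t :: real
  assumes "t > 2"
  shows "(t / (t - 1))\<^sup>2 \<le> t / (t - 2)"
proof -
  have "t\<^sup>2 * (t - 2) \<le> t * (t - 1)\<^sup>2" using assms by (simp add: power2_eq_square algebra_simps)
  then show ?thesis using assms by (simp add: power_divide divide_le_eq le_divide_eq)
qed

lemma card_primes_avoiding_le:
  fixes B :: "nat set" and D s X :: nat
  assumes B: "finite B" "\<And>q. q \<in> B \<Longrightarrow> prime q \<and> q > 3" and D: "D > \<Prod>B"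
  shows "real (card {p\<in>{s..<s + X}. prime p \<and> p \<in> avoiding B})
     \<le> real X / (euler_product B * ln (real D / real (\<Prod>B))) + real D ^ 4 + real D + real (card B)"
proof -
  define P where "P = {p. prime p \<and> p \<le> D} \<union> B"
  interpret sieve P "avoiding_residues B"
    unfolding P_def using B by (rule sieve_avoiding_residues)
  let ?A = "{p\<in>{s..<s + X}. prime p \<and> p \<in> avoiding B}"
  let ?Z = "{n\<in>{s..<s + X}. \<forall>p\<in>P. n mod p \<notin> avoiding_residues B p}"
  have "?A \<subseteq> ?Z \<union> {1..D} \<union> B" unfolding P_def using B(2) by (intro primes_avoiding_subset_sifted) auto
  then have "card ?A \<le> card (?Z \<union> {1..D} \<union> B)" using B(1) by (intro card_mono) auto
  also have "\<dots> \<le> card ?Z + D + card B"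
    using card_Un_le[of "?Z \<union> {1..D}" B] card_Un_le[of ?Z "{1..D}"] by simp
  finally have A_le: "real (card ?A) \<le> real (card ?Z) + real D + real (card B)" by linarith
  have mass: "euler_product B * ln (real D / real (\<Prod>B)) \<le> sqfree_sum odds P (real D)"
  proof (rule sqfree_sum_ge_euler_product[OF finite_P prime_P])
    fix q assume q: "q \<in> B"
    then have q3: "real q > 3" using B by auto
    then have "1 + odds q = real q / (real q - 2)" using q by (simp add: odds_def card_avoiding_residues field_simps)
    then show "(real q / (real q - 1))\<^sup>2 \<le> 1 + odds q" using square_divide_minus_one_le[of "real q"] q3 by simp
  next
    show "real (\<Prod>B) < real D" using D by (simp only: of_nat_less_iff)
  qed (auto simp: P_def odds_def card_avoiding_residues)
  have "0 < \<Prod>B" using B by (auto intro!: prod_pos simp: prime_gt_0_nat)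
  then have "1 < real D / real (\<Prod>B)" using D by (simp add: less_divide_eq del: of_nat_prod)
  then have pos: "0 < euler_product B * ln (real D / real (\<Prod>B))" using B euler_product_pos[of B] by simp
  have "real X / sqfree_sum odds P (real D) \<le> real X / (euler_product B * ln (real D / real (\<Prod>B)))"
    by (rule divide_left_mono[OF mass _ mult_pos_pos[OF order.strict_trans2[OF pos mass] pos]]) simp
  moreover have "real (card ?Z) \<le> real X / sqfree_sum odds P (real D) + real D ^ 4"
    using D by (intro card_sifted_le) simp
  ultimately show ?thesis using A_le by linarith
qed

section \<open>Sparse subsets\<close>

definition count_between :: "nat set \<Rightarrow> nat \<Rightarrow> nat \<Rightarrow> real" where
  "count_between E s N = real (card (E \<inter> {s<..N}))"

lemma count_between_nonneg [simp]: "0 \<le> count_between E s N"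
  by (simp add: count_between_def)

lemma count_between_mono:
  assumes "E \<subseteq> E'" "s' \<le> s"
  shows "count_between E s N \<le> count_between E' s' N"
  unfolding count_between_def using assms by (intro of_nat_mono card_mono) auto

lemma count_between_Un_le: "count_between (A \<union> B) s N \<le> count_between A s N + count_between B s N"
  unfolding count_between_def Int_Un_distrib2 of_nat_add[symmetric] by (intro of_nat_mono card_Un_le)

lemma count_between_UN_le:
  assumes "finite I"
  shows "count_between (\<Union>i\<in>I. A i) s N \<le> (\<Sum>i\<in>I. count_between (A i) s N)"
proof -
  have Int_eq: "(\<Union>i\<in>I. A i) \<inter> {s<..N} = (\<Union>i\<in>I. A i \<inter> {s<..N})" by auto
  show ?thesis
    unfolding count_between_def of_nat_sum[symmetric] Int_eq by (intro of_nat_mono card_UN_le assms)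
qed

lemma count_between_split:
  assumes "s \<le> N"
  shows "count_between E 0 N = count_between E 0 s + count_between E s N"
proof -
  have "E \<inter> {0<..N} = (E \<inter> {0<..s}) \<union> (E \<inter> {s<..N})" using assms by auto
  moreover have "(E \<inter> {0<..s}) \<inter> (E \<inter> {s<..N}) = {}" by auto
  ultimately show ?thesis by (simp add: count_between_def card_Un_disjoint)
qed

lemma count_between_Diff: "count_between (E - A) s N = count_between E s N - count_between (E \<inter> A) s N"
proof -
  have "(E - A) \<inter> {s<..N} = E \<inter> {s<..N} - E \<inter> A \<inter> {s<..N}" by auto
  moreover have "card (E \<inter> A \<inter> {s<..N}) \<le> card (E \<inter> {s<..N})" by (intro card_mono) auto
  ultimately show ?thesis
    by (simp add: count_between_def card_Diff_subset of_nat_diff inf.coboundedI1 Int_lower1 le_infI1)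
qed

definition sparse_in :: "nat set \<Rightarrow> real \<Rightarrow> nat set \<Rightarrow> bool" where
  "sparse_in E \<delta> A \<longleftrightarrow> (\<forall>\<kappa>>0. eventually (\<lambda>N. \<forall>s\<le>N.
     count_between (E \<inter> A) s N \<le> \<delta> * count_between E s N + \<kappa> * count_between E 0 N) sequentially)"

lemma sparse_inD:
  "sparse_in E \<delta> A \<Longrightarrow> \<kappa> > 0 \<Longrightarrow> eventually (\<lambda>N. \<forall>s\<le>N.
     count_between (E \<inter> A) s N \<le> \<delta> * count_between E s N + \<kappa> * count_between E 0 N) sequentially"
  by (simp add: sparse_in_def)

lemma sparse_in_empty: "sparse_in E 0 {}"
  by (simp add: sparse_in_def count_between_def)

lemma sparse_in_mono:
  assumes "sparse_in E \<delta> A" "\<delta> \<le> \<delta>'" "A' \<subseteq> A"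
  shows "sparse_in E \<delta>' A'"
  unfolding sparse_in_def
proof (intro allI impI)
  fix \<kappa> :: real assume "\<kappa> > 0"
  from sparse_inD[OF assms(1) this]
  show "eventually (\<lambda>N. \<forall>s\<le>N. count_between (E \<inter> A') s N
      \<le> \<delta>' * count_between E s N + \<kappa> * count_between E 0 N) sequentially"
  proof eventually_elim
    case (elim N)
    show ?case
    proof (intro allI impI)
      fix s assume "s \<le> N"
      have "count_between (E \<inter> A') s N \<le> count_between (E \<inter> A) s N"
        using assms(3) by (intro count_between_mono) auto
      moreover have "\<delta> * count_between E s N \<le> \<delta>' * count_between E s N"
        using assms(2) by (intro mult_right_mono) auto
      ultimately show "count_between (E \<inter> A') s N \<le> \<delta>' * count_between E s N + \<kappa> * count_between E 0 N"
        using elim \<open>s \<le> N\<close> by fastforce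
    qed
  qed
qed

lemma sparse_in_Un:
  assumes "sparse_in E \<delta> A" "sparse_in E \<delta>' B"
  shows "sparse_in E (\<delta> + \<delta>') (A \<union> B)"
  unfolding sparse_in_def
proof (intro allI impI)
  fix \<kappa> :: real assume "\<kappa> > 0"
  then have "\<kappa> / 2 > 0" by simp
  from sparse_inD[OF assms(1) this] sparse_inD[OF assms(2) this]
  show "eventually (\<lambda>N. \<forall>s\<le>N. count_between (E \<inter> (A \<union> B)) s N
      \<le> (\<delta> + \<delta>') * count_between E s N + \<kappa> * count_between E 0 N) sequentially"
  proof eventually_elim
    case (elim N)
    show ?case
    proof (intro allI impI)
      fix s assume "s \<le> N"
      then have "count_between (E \<inter> A) s N \<le> \<delta> * count_between E s N + \<kappa> / 2 * count_between E 0 N"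
        "count_between (E \<inter> B) s N \<le> \<delta>' * count_between E s N + \<kappa> / 2 * count_between E 0 N"
        using elim by auto
      then show "count_between (E \<inter> (A \<union> B)) s N \<le> (\<delta> + \<delta>') * count_between E s N + \<kappa> * count_between E 0 N"
        using count_between_Un_le[of "E \<inter> A" "E \<inter> B" s N] by (simp add: Int_Un_distrib distrib_right)
    qed
  qed
qed

lemma sparse_in_UN:
  fixes k :: nat
  assumes "\<And>i. i < k \<Longrightarrow> sparse_in E (\<delta> i) (A i)"
  shows "sparse_in E (\<Sum>i<k. \<delta> i) (\<Union>i<k. A i)"
  using assms
proof (induction k)
  case 0
  show ?case by (simp add: sparse_in_empty)
next
  case (Suc k)
  then have "sparse_in E ((\<Sum>i<k. \<delta> i) + \<delta> k) ((\<Union>i<k. A i) \<union> A k)" by (intro sparse_in_Un) auto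
  then show ?case by (simp add: lessThan_Suc Un_commute add.commute)
qed

lemma sparse_in_truncate:
  assumes "sparse_in E \<delta> A" "\<delta> > 0"
  obtains M where "M \<ge> m" "\<And>N. count_between (E \<inter> (A \<inter> {M<..})) 0 N \<le> 2 * \<delta> * count_between E 0 N"
proof -
  obtain N0 where N0: "\<forall>N\<ge>N0. \<forall>s\<le>N. count_between (E \<inter> A) s N \<le> \<delta> * count_between E s N + \<delta> * count_between E 0 N"
    using sparse_inD[OF assms] unfolding eventually_sequentially by blast
  define M where "M = max N0 m"
  have "count_between (E \<inter> (A \<inter> {M<..})) 0 N \<le> 2 * \<delta> * count_between E 0 N" for N
  proof (cases "N \<ge> N0")
    case True
    have "count_between (E \<inter> (A \<inter> {M<..})) 0 N \<le> count_between (E \<inter> A) 0 N"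
      by (intro count_between_mono) auto
    then show ?thesis using N0[rule_format, OF True, of 0] by simp
  next
    case False
    then have "E \<inter> (A \<inter> {M<..}) \<inter> {0<..N} = {}" by (auto simp: M_def)
    then show ?thesis using assms(2) by (simp add: count_between_def)
  qed
  then show ?thesis using that[of M] by (simp add: M_def)
qed

lemma sparse_in_UN_infinite:
  fixes X :: "nat \<Rightarrow> nat set" and \<eta> \<mu> :: "nat \<Rightarrow> real"
  assumes sparse: "\<And>k. sparse_in E (\<eta> k) (X k)" and sum: "\<And>n. (\<Sum>k<n. \<eta> k) \<le> \<delta>"
    and global: "\<And>k N. count_between (E \<inter> X k) 0 N \<le> \<mu> k * count_between E 0 N" and "summable \<mu>"
    and beyond: "\<And>k x. x \<in> X k \<Longrightarrow> k < x"
  shows "sparse_in E \<delta> (\<Union>k. X k)"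
  unfolding sparse_in_def
proof (intro allI impI)
  fix \<kappa> :: real assume "\<kappa> > 0"
  then have \<kappa>: "\<kappa> / 2 > 0" by simp
  obtain k0 where k0: "\<And>m n. m \<ge> k0 \<Longrightarrow> norm (sum \<mu> {m..n}) < \<kappa> / 2"
    using summable_partial_sum_bound[OF \<open>summable \<mu>\<close> \<kappa>] by blast
  have "sparse_in E \<delta> (\<Union>k<k0. X k)"
    using sparse_in_UN[of k0, OF sparse] sum by (rule sparse_in_mono) simp
  from sparse_inD[OF this \<kappa>]
  show "eventually (\<lambda>N. \<forall>s\<le>N. count_between (E \<inter> (\<Union>k. X k)) s N
      \<le> \<delta> * count_between E s N + \<kappa> * count_between E 0 N) sequentially"
  proof eventually_elim
    case (elim N)
    show ?case
    proof (intro allI impI)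
      fix s assume "s \<le> N"
      have "E \<inter> (\<Union>k. X k) \<inter> {s<..N} = (E \<inter> (\<Union>k<k0. X k) \<union> (\<Union>k\<in>{k0..N}. E \<inter> X k)) \<inter> {s<..N}"
        using beyond by (fastforce simp: not_less)
      then have "count_between (E \<inter> (\<Union>k. X k)) s N = count_between (E \<inter> (\<Union>k<k0. X k) \<union> (\<Union>k\<in>{k0..N}. E \<inter> X k)) s N"
        by (simp add: count_between_def)
      also have "\<dots> \<le> count_between (E \<inter> (\<Union>k<k0. X k)) s N + count_between (\<Union>k\<in>{k0..N}. E \<inter> X k) s N"
        by (rule count_between_Un_le)
      also have "count_between (\<Union>k\<in>{k0..N}. E \<inter> X k) s N \<le> (\<Sum>k\<in>{k0..N}. count_between (E \<inter> X k) s N)"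
        by (rule count_between_UN_le) simp
      also have "\<dots> \<le> (\<Sum>k\<in>{k0..N}. count_between (E \<inter> X k) 0 N)"
        by (intro sum_mono count_between_mono) auto
      also have "\<dots> \<le> (\<Sum>k\<in>{k0..N}. \<mu> k * count_between E 0 N)" by (intro sum_mono global)
      also have "\<dots> = (\<Sum>k\<in>{k0..N}. \<mu> k) * count_between E 0 N" by (simp add: sum_distrib_right)
      also have "\<dots> \<le> \<kappa> / 2 * count_between E 0 N"
        using k0[of k0 N] by (intro mult_right_mono) auto
      also have "count_between (E \<inter> (\<Union>k<k0. X k)) s N \<le> \<delta> * count_between E s N + \<kappa> / 2 * count_between E 0 N"
        using elim \<open>s \<le> N\<close> by blast
      finally show "count_between (E \<inter> (\<Union>k. X k)) s N \<le> \<delta> * count_between E s N + \<kappa> * count_between E 0 N"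
        by simp
    qed
  qed
qed

section \<open>Primes in intervals\<close>

abbreviation nat_primes :: "nat set" where
  "nat_primes \<equiv> {p. prime p}"

lemma card_prime_powers_le:
  assumes "N \<ge> 1"
  shows "real (card {n. n \<le> N \<and> primepow n \<and> \<not> prime n}) \<le> sqrt (real N) * log 2 (real N)"
proof -
  define a where "a = nat \<lfloor>sqrt (real N)\<rfloor>"
  define b where "b = nat \<lfloor>log 2 (real N)\<rfloor>"
  have "{n. n \<le> N \<and> primepow n \<and> \<not> prime n} \<subseteq> (\<lambda>(p,k). p ^ k) ` ({1..a} \<times> {1..b})"
  proof
    fix n assume "n \<in> {n. n \<le> N \<and> primepow n \<and> \<not> prime n}"
    then obtain p k where pk: "prime p" "k > 0" "n = p ^ k" "n \<le> N" "\<not> prime n" by (auto simp: primepow_def)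
    then have k2: "k \<ge> 2" by (cases "k = 1") auto
    have p2: "p \<ge> 2" using pk prime_ge_2_nat by blast
    have "p ^ 2 \<le> p ^ k" using k2 p2 by (intro power_increasing) auto
    then have "(real p)\<^sup>2 \<le> real N" using pk by (metis of_nat_le_iff of_nat_power order_trans)
    then have "real p \<le> sqrt (real N)" by (rule real_le_rsqrt)
    then have "p \<le> a" unfolding a_def by linarith
    have "2 ^ k \<le> p ^ k" using p2 by (intro power_mono) auto
    then have "2 ^ k \<le> N" using pk by linarith
    then have "(2::real) ^ k \<le> real N" by (metis of_nat_le_iff of_nat_numeral of_nat_power)
    then have "real k \<le> log 2 (real N)" using assms by (simp add: le_log_iff powr_realpow)
    then have "k \<le> b" unfolding b_def by linarith
    show "n \<in> (\<lambda>(p,k). p ^ k) ` ({1..a} \<times> {1..b})"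
      using pk \<open>p \<le> a\<close> \<open>k \<le> b\<close> p2 by (intro image_eqI[of _ _ "(p, k)"]) auto
  qed
  then have "card {n. n \<le> N \<and> primepow n \<and> \<not> prime n} \<le> card ((\<lambda>(p,k). p ^ k :: nat) ` ({1..a} \<times> {1..b}))"
    by (intro card_mono) auto
  also have "\<dots> \<le> card ({1..a} \<times> {1..b})" by (rule card_image_le) auto
  also have "\<dots> = a * b" by simp
  finally have "real (card {n. n \<le> N \<and> primepow n \<and> \<not> prime n}) \<le> real a * real b"
    unfolding of_nat_mult[symmetric] by (rule of_nat_mono)
  also have "\<dots> \<le> sqrt (real N) * log 2 (real N)"
    unfolding a_def b_def using assms by (intro mult_mono) auto
  finally show ?thesis .
qed

lemma psi_diff_le_count_primes:
  assumes "s \<le> N" "N \<ge> 1"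
  shows "psi (real N) - psi (real s) \<le> (count_between nat_primes s N + sqrt (real N) * log 2 (real N)) * ln (real N)"
proof -
  let ?Q = "{n. n \<le> N \<and> primepow n \<and> \<not> prime n}"
  let ?S = "nat_primes \<inter> {s<..N} \<union> ?Q"
  have fin: "finite ?S" by (rule finite_subset[of _ "{..N}"]) auto
  have "psi (real N) - psi (real s) = (\<Sum>n\<in>{1..N} - {1..s}. mangoldt n)"
    using assms by (simp add: psi_diff nats_upto_of_nat)
  also have "\<dots> = (\<Sum>n\<in>({1..N} - {1..s}) \<inter> ?S. mangoldt n)"
    by (intro sum.mono_neutral_right) (auto simp: mangoldt_def)
  also have "\<dots> \<le> (\<Sum>n\<in>?S. mangoldt n)"
    using fin by (intro sum_mono2) (auto simp: mangoldt_nonneg)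
  also have "\<dots> \<le> (\<Sum>n\<in>?S. ln (real N))"
  proof (rule sum_mono)
    fix n assume "n \<in> ?S"
    then have "0 < n" "n \<le> N" by (auto simp: prime_gt_0_nat primepow_gt_0_nat)
    then show "mangoldt n \<le> ln (real N)" by (intro order_trans[OF mangoldt_le]) auto
  qed
  also have "\<dots> = real (card ?S) * ln (real N)" by simp
  also have "\<dots> \<le> (count_between nat_primes s N + sqrt (real N) * log 2 (real N)) * ln (real N)"
  proof (intro mult_right_mono)
    have "card ?S \<le> card (nat_primes \<inter> {s<..N}) + card ?Q" by (rule card_Un_le)
    then show "real (card ?S) \<le> count_between nat_primes s N + sqrt (real N) * log 2 (real N)"
      using card_prime_powers_le[OF assms(2)] unfolding count_between_def by linarith
  qed (use assms in auto)
  finally show ?thesis .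
qed

lemma count_primes_lower:
  fixes \<kappa> :: real
  assumes "\<kappa> > 0"
  shows "eventually (\<lambda>N. \<forall>s\<le>N. (real N - real s) / ln (real N) - \<kappa> * (real N / ln (real N))
    \<le> count_between nat_primes s N) sequentially"
proof -
  have "\<kappa> / 4 > 0" using assms by simp
  then obtain M where M: "M \<ge> 0" "\<And>s. s \<ge> 0 \<Longrightarrow> \<bar>psi s - s\<bar> \<le> M + \<kappa> / 4 * s"
    by (rule psi_minus_id_le) (rule that)
  have "((\<lambda>N::nat. sqrt (real N) * log 2 (real N) * ln (real N) / real N) \<longlongrightarrow> 0) sequentially" by real_asymp
  then have "eventually (\<lambda>N::nat. sqrt (real N) * log 2 (real N) * ln (real N) / real N < \<kappa> / 4) sequentially"
    using assms by (intro order_tendstoD) auto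
  moreover have "eventually (\<lambda>N::nat. real N \<ge> 8 * M / \<kappa>) sequentially"
    using filterlim_real_sequentially by (simp add: filterlim_at_top)
  ultimately show ?thesis using eventually_ge_at_top[of 2]
  proof eventually_elim
    case (elim N)
    have lN: "ln (real N) > 0" using elim by simp
    have powers: "sqrt (real N) * log 2 (real N) * ln (real N) \<le> \<kappa> / 4 * real N" using elim by (simp add: field_simps)
    have M_le: "2 * M \<le> \<kappa> / 4 * real N" using elim assms by (simp add: field_simps)
    show ?case
    proof (intro allI impI)
      fix s assume s: "s \<le> N"
      have "real N - real s - 2 * M - \<kappa> / 4 * real N - \<kappa> / 4 * real s \<le> psi (real N) - psi (real s)"
        using M(2)[of "real N"] M(2)[of "real s"] by (simp add: abs_le_iff)
      moreover have "\<kappa> / 4 * real s \<le> \<kappa> / 4 * real N" using s assms by simp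
      moreover have "psi (real N) - psi (real s)
          \<le> count_between nat_primes s N * ln (real N) + sqrt (real N) * log 2 (real N) * ln (real N)"
        using psi_diff_le_count_primes[OF s] elim by (simp add: distrib_right)
      ultimately have "real N - real s - \<kappa> * real N \<le> count_between nat_primes s N * ln (real N)"
        using powers M_le by linarith
      then have "(real N - real s - \<kappa> * real N) / ln (real N) \<le> count_between nat_primes s N"
        using lN by (simp add: field_simps)
      then show "(real N - real s) / ln (real N) - \<kappa> * (real N / ln (real N)) \<le> count_between nat_primes s N"
        by (simp add: diff_divide_distrib)
    qed
  qed
qed

lemma count_primes_ge_half: "eventually (\<lambda>N. real N / (2 * ln (real N)) \<le> count_between nat_primes 0 N) sequentially"
  using count_primes_lower[of "1/2", OF half_gt_zero[OF zero_less_one]]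
proof eventually_elim
  case (elim N)
  then have "(real N - real 0) / ln (real N) - 1/2 * (real N / ln (real N)) \<le> count_between nat_primes 0 N" by blast
  then show ?case by (simp add: field_simps)
qed

lemma sieve_level_exists:
  fixes Q :: nat and b \<kappa> :: real
  assumes "Q > 0" "\<kappa> > 0"
  shows "eventually (\<lambda>N. \<exists>D>Q. ln (real N) / 10 \<le> ln (real D / real Q)
    \<and> real D ^ 4 + real D + b \<le> \<kappa> * (real N / ln (real N))) sequentially"
proof -
  have "filterlim (\<lambda>N::nat. (real N powr (1/8) - 1) / real N powr (1/10)) at_top sequentially" by real_asymp
  then have "eventually (\<lambda>N::nat. (real N powr (1/8) - 1) / real N powr (1/10) \<ge> real Q) sequentially"
    by (simp add: filterlim_at_top)
  moreover have "((\<lambda>N::nat. (real N powr (1/2) + real N powr (1/8) + b) * ln (real N) / real N) \<longlongrightarrow> 0) sequentially"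
    by real_asymp
  then have "eventually (\<lambda>N::nat. (real N powr (1/2) + real N powr (1/8) + b) * ln (real N) / real N < \<kappa>)
      sequentially"
    using assms(2) by (intro order_tendstoD) auto
  ultimately show ?thesis using eventually_ge_at_top[of 2]
  proof eventually_elim
    case (elim N)
    define D where "D = nat \<lfloor>real N powr (1/8)\<rfloor>"
    have p10: "real N powr (1/10) > 1" using elim by (intro gr_one_powr) auto
    have "real Q * real N powr (1/10) \<le> real N powr (1/8) - 1" using elim p10 by (simp add: field_simps)
    also have "\<dots> \<le> real D" unfolding D_def by linarith
    finally have DQ: "real N powr (1/10) \<le> real D / real Q" using assms(1) by (simp add: field_simps)
    then have "1 < real D / real Q" using p10 by linarith
    then have "D > Q" using assms(1) by (simp add: less_divide_eq)
    have "ln (real N powr (1/10)) \<le> ln (real D / real Q)"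
      using DQ p10 \<open>D > Q\<close> assms(1) \<open>2 \<le> N\<close> by (subst ln_le_cancel_iff) auto
    then have lnD: "ln (real N) / 10 \<le> ln (real D / real Q)" using elim by (simp add: ln_powr)
    have Dle: "real D \<le> real N powr (1/8)" unfolding D_def by simp
    then have "real D ^ 4 \<le> (real N powr (1/8)) ^ 4" by (intro power_mono) auto
    also have "\<dots> = real N powr (1/2)" using elim by (simp add: powr_powr flip: powr_numeral)
    finally have "real D ^ 4 + real D + b \<le> real N powr (1/2) + real N powr (1/8) + b" using Dle by simp
    also have "\<dots> \<le> \<kappa> * (real N / ln (real N))" using elim by (simp add: field_simps)
    finally show ?case using \<open>D > Q\<close> lnD by blast
  qed
qed

lemma count_primes_avoiding_upper:
  fixes \<delta> \<kappa> :: real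
  assumes B: "finite B" "\<And>q. q \<in> B \<Longrightarrow> prime q \<and> q > 3" and "\<delta> > 0" "\<kappa> > 0"
    and large: "10 / \<delta> \<le> euler_product B"
  shows "eventually (\<lambda>N. \<forall>s\<le>N. count_between (nat_primes \<inter> avoiding B) s N
     \<le> \<delta> * ((real N - real s) / ln (real N)) + \<kappa> * (real N / ln (real N))) sequentially"
proof -
  have "\<Prod>B > 0" using B by (auto intro!: prod_pos simp: prime_gt_0_nat)
  from sieve_level_exists[OF this \<open>\<kappa> > 0\<close>, of "real (card B)"] show ?thesis
    using eventually_ge_at_top[of 2]
  proof eventually_elim
    case (elim N)
    then obtain D where D: "D > \<Prod>B" and lnD: "ln (real N) / 10 \<le> ln (real D / real (\<Prod>B))"
      and error: "real D ^ 4 + real D + real (card B) \<le> \<kappa> * (real N / ln (real N))" by blast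
    have lN: "ln (real N) > 0" using elim by simp
    show ?case
    proof (intro allI impI)
      fix s assume s: "s \<le> N"
      have "nat_primes \<inter> avoiding B \<inter> {s<..N} = {p\<in>{Suc s..<Suc s + (N - s)}. prime p \<and> p \<in> avoiding B}"
        using s by auto
      then have "count_between (nat_primes \<inter> avoiding B) s N
          \<le> real (N - s) / (euler_product B * ln (real D / real (\<Prod>B))) + real D ^ 4 + real D + real (card B)"
        using card_primes_avoiding_le[OF B D, of "Suc s" "N - s"] by (simp add: count_between_def)
      also have "real (N - s) / (euler_product B * ln (real D / real (\<Prod>B)))
          \<le> real (N - s) / (10 / \<delta> * (ln (real N) / 10))"
      proof (rule divide_left_mono)
        have "0 < 10 / \<delta>" "0 < ln (real N) / 10" using \<open>\<delta> > 0\<close> lN by simp_all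
        then show "10 / \<delta> * (ln (real N) / 10) \<le> euler_product B * ln (real D / real (\<Prod>B))"
          "0 < euler_product B * ln (real D / real (\<Prod>B)) * (10 / \<delta> * (ln (real N) / 10))"
          using large lnD by (intro mult_mono mult_pos_pos; linarith)+
      qed simp
      also have "\<dots> = \<delta> * ((real N - real s) / ln (real N))" using s \<open>\<delta> > 0\<close> lN by (simp add: of_nat_diff field_simps)
      finally show "count_between (nat_primes \<inter> avoiding B) s N
          \<le> \<delta> * ((real N - real s) / ln (real N)) + \<kappa> * (real N / ln (real N))"
        using error by linarith
    qed
  qed
qed

lemma sparse_in_primes_avoiding:
  fixes \<delta> :: real
  assumes B: "finite B" "\<And>q. q \<in> B \<Longrightarrow> prime q \<and> q > 3" and \<delta>: "\<delta> > 0" and large: "10 / \<delta> \<le> euler_product B"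
  shows "sparse_in nat_primes \<delta> (avoiding B)"
  unfolding sparse_in_def
proof (intro allI impI)
  fix \<kappa> :: real assume \<kappa>: "\<kappa> > 0"
  define \<kappa>' where "\<kappa>' = \<kappa> / (2 * (\<delta> + 1))"
  have \<kappa>': "\<kappa>' > 0" "2 * (\<delta> + 1) * \<kappa>' = \<kappa>" using \<kappa> \<delta> by (auto simp: \<kappa>'_def)
  have "eventually (\<lambda>N. \<forall>s\<le>N. count_between (nat_primes \<inter> avoiding B) s N
     \<le> \<delta> * ((real N - real s) / ln (real N)) + \<kappa>' * (real N / ln (real N))) sequentially"
    using B \<delta> \<kappa>'(1) large by (rule count_primes_avoiding_upper)
  then show "eventually (\<lambda>N. \<forall>s\<le>N. count_between (nat_primes \<inter> avoiding B) s N
     \<le> \<delta> * count_between nat_primes s N + \<kappa> * count_between nat_primes 0 N) sequentially"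
    using count_primes_lower[OF \<kappa>'(1)] count_primes_ge_half
  proof eventually_elim
    case (elim N)
    define r where "r = real N / ln (real N)"
    have "r \<le> 2 * count_between nat_primes 0 N" using elim(3) by (simp add: r_def)
    then have "(\<delta> + 1) * \<kappa>' * r \<le> (\<delta> + 1) * \<kappa>' * (2 * count_between nat_primes 0 N)"
      using \<delta> \<kappa>' by (intro mult_left_mono) auto
    also have "\<dots> = \<kappa> * count_between nat_primes 0 N" unfolding \<kappa>'(2)[symmetric] by simp
    finally have r_le: "(\<delta> + 1) * \<kappa>' * r \<le> \<kappa> * count_between nat_primes 0 N" .
    show ?case
    proof (intro allI impI)
      fix s assume s: "s \<le> N"
      have "(real N - real s) / ln (real N) \<le> count_between nat_primes s N + \<kappa>' * r"
        using elim(2) s by (auto simp: r_def algebra_simps)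
      then have "\<delta> * ((real N - real s) / ln (real N)) \<le> \<delta> * (count_between nat_primes s N + \<kappa>' * r)"
        using \<delta> by (intro mult_left_mono) auto
      moreover have "count_between (nat_primes \<inter> avoiding B) s N \<le> \<delta> * ((real N - real s) / ln (real N)) + \<kappa>' * r"
        using elim(1) s by (auto simp: r_def)
      ultimately show "count_between (nat_primes \<inter> avoiding B) s N
          \<le> \<delta> * count_between nat_primes s N + \<kappa> * count_between nat_primes 0 N"
        using r_le by (simp add: algebra_simps)
    qed
  qed
qed

section \<open>The discarded primes\<close>

lemma disjoint_sparse_blocks:
  fixes \<delta> :: real and k :: nat
  assumes "\<delta> > 0"
  shows "\<exists>B. (\<forall>i<k. finite (B i) \<and> (\<forall>q\<in>B i. prime q) \<and> sparse_in nat_primes \<delta> (avoiding (B i)))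
           \<and> disjoint_family_on B {..<k}"
proof (induction k)
  case (Suc k)
  then obtain B where B: "\<forall>i<k. finite (B i) \<and> (\<forall>q\<in>B i. prime q) \<and> sparse_in nat_primes \<delta> (avoiding (B i))"
    and disj: "disjoint_family_on B {..<k}" by blast
  have "finite (\<Union>i<k. B i)" using B by auto
  then obtain y where y: "\<And>q. q \<in> (\<Union>i<k. B i) \<Longrightarrow> q \<le> y" using finite_nat_set_iff_bounded_le by meson
  obtain C where C: "finite C" "\<And>q. q \<in> C \<Longrightarrow> prime q \<and> q > max y 3" "10 / \<delta> \<le> euler_product C"
    by (rule euler_product_unbounded) (rule that)
  have sparse: "sparse_in nat_primes \<delta> (avoiding C)"
    using C assms by (intro sparse_in_primes_avoiding) auto
  have new: "B i \<inter> C = {}" if "i < k" for i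
  proof -
    have False if "q \<in> B i" "q \<in> C" for q
      using y[of q] C(2)[of q] that \<open>i < k\<close> by force
    then show ?thesis by blast
  qed
  show ?case
  proof (intro exI[of _ "B(k := C)"] conjI allI impI)
    fix i assume "i < Suc k"
    then show "finite ((B(k := C)) i)" "\<forall>q\<in>(B(k := C)) i. prime q" "sparse_in nat_primes \<delta> (avoiding ((B(k := C)) i))"
      using B C sparse by (auto simp: less_Suc_eq)
  next
    show "disjoint_family_on (B(k := C)) {..<Suc k}"
      unfolding disjoint_family_on_def
    proof (intro ballI impI)
      fix i j assume "i \<in> {..<Suc k}" "j \<in> {..<Suc k}" "i \<noteq> j"
      then show "(B(k := C)) i \<inter> (B(k := C)) j = {}"
        using disjoint_family_onD[OF disj, of i j] new[of i] new[of j] by (auto simp: less_Suc_eq)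
    qed
  qed
qed (auto simp: disjoint_family_on_def)

lemma residue_class_simultaneous_dvd:
  fixes R :: "(nat \<times> nat) set"
  assumes "finite R" "inj_on fst R" and prime: "\<And>q c. (q, c) \<in> R \<Longrightarrow> prime q"
  obtains n0 W where "W > 0" "\<And>n q c. [n = n0] (mod W) \<Longrightarrow> (q, c) \<in> R \<Longrightarrow> q dvd n + c \<and> q \<le> W"
proof -
  have "\<forall>z\<in>R. \<forall>z'\<in>R. z \<noteq> z' \<longrightarrow> coprime (fst z) (fst z')"
    using prime assms(2) by (auto intro!: primes_coprime dest: inj_onD)
  then obtain n0 where n0: "\<forall>z\<in>R. [n0 = snd z * (fst z - 1)] (mod fst z)"
    using chinese_remainder_nat[OF assms(1), of fst "\<lambda>z. snd z * (fst z - 1)"] by blast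
  define W where "W = (\<Prod>z\<in>R. fst z)"
  have "W > 0" unfolding W_def using prime prime_gt_0_nat by (intro prod_pos) auto
  have dvd_W: "q dvd W" if "(q, c) \<in> R" for q c
    unfolding W_def using dvd_prodI[OF assms(1) that, of fst] by simp
  show ?thesis
  proof (rule that[OF \<open>W > 0\<close>])
    fix n q c assume n: "[n = n0] (mod W)" and R: "(q, c) \<in> R"
    have "[n = n0] (mod q)" using n dvd_W[OF R] by (rule cong_dvd_modulus_nat)
    also have "[n0 = c * (q - 1)] (mod q)" using n0 R by force
    finally have "[n + c = c * (q - 1) + c] (mod q)" by (rule cong_add) simp
    moreover have "c * (q - 1) + c = c * q" using prime_gt_0_nat[OF prime[OF R]] by (cases q) auto
    ultimately have "q dvd n + c" by (metis cong_dvd_iff dvd_triv_right)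
    then show "q dvd n + c \<and> q \<le> W" using dvd_imp_le[OF dvd_W[OF R] \<open>W > 0\<close>] by simp
  qed
qed

definition shift_composite :: "nat set \<Rightarrow> nat \<Rightarrow> bool" where
  "shift_composite U k \<longleftrightarrow> (\<exists>n0 W. W > 0 \<and>
     (\<forall>n>W. [n = n0] (mod W) \<longrightarrow> (\<forall>i<k. \<forall>a. prime a \<and> a \<notin> U \<longrightarrow> \<not> prime (n + i + a))))"

lemma shift_composite_mono: "shift_composite U k \<Longrightarrow> U \<subseteq> V \<Longrightarrow> shift_composite V k"
  unfolding shift_composite_def by blast

lemma prime_shift_system_exists:
  fixes B :: "nat \<Rightarrow> nat set"
  assumes B: "\<And>i. i < k \<Longrightarrow> finite (B i)" "\<And>i q. i < k \<Longrightarrow> q \<in> B i \<Longrightarrow> prime q"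
    and disj: "disjoint_family_on B {..<k}"
  obtains R where "finite R" "inj_on fst R" "\<And>q c. (q, c) \<in> R \<Longrightarrow> prime q"
    "\<And>i q. i < k \<Longrightarrow> q \<in> B i \<Longrightarrow> (q, i + 1) \<in> R" "\<And>j. j \<le> m \<Longrightarrow> \<exists>q. (q, j) \<in> R"
proof -
  have "finite (\<Union>i<k. B i)" using B by auto
  then have "infinite ({p. prime p} - (\<Union>i<k. B i))"
    using primes_infinite by (rule Diff_infinite_finite)
  then obtain r :: "nat \<Rightarrow> nat" where r: "inj r" "range r \<subseteq> {p. prime p} - (\<Union>i<k. B i)"
    using infinite_countable_subset by blast
  define R where "R = (\<Union>i<k. (\<lambda>q. (q, i + 1)) ` B i) \<union> (\<lambda>j. (r j, j)) ` {..m}"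
  have shift_unique: "c = c'" if R: "(q, c) \<in> R" "(q, c') \<in> R" for q c c'
  proof (cases "q \<in> (\<Union>i<k. B i)")
    case True
    then have "q \<notin> range r" using r(2) by blast
    then obtain i i' where "i < k" "q \<in> B i" "c = i + 1" "i' < k" "q \<in> B i'" "c' = i' + 1"
      using R unfolding R_def by blast
    then show ?thesis using disjoint_family_onD[OF disj, of i i'] by (cases "i = i'") auto
  next
    case False
    then have "q = r c" "q = r c'" using R unfolding R_def by blast+
    then show ?thesis using injD[OF r(1)] by simp
  qed
  show ?thesis
  proof (rule that)
    show "finite R" using B by (auto simp: R_def)
    show "inj_on fst R" using shift_unique by (auto simp: inj_on_def)
    show "prime q" if "(q, c) \<in> R" for q c
      using that B r(2) unfolding R_def by blast
  qed (auto simp: R_def)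
qed

text \<open>A prime \<open>a > M\<close> outside the set below is 1 modulo some \<open>q\<close> in each \<open>B i\<close>, and \<open>n\<close> is chosen so that
  \<open>q\<close> divides \<open>n + i + 1\<close>. The finitely many \<open>a \<le> M\<close> are handled by one auxiliary prime for each value of
  \<open>i + a\<close>.\<close>

lemma shift_composite_avoiding:
  fixes B :: "nat \<Rightarrow> nat set"
  assumes B: "\<And>i. i < k \<Longrightarrow> finite (B i)" "\<And>i q. i < k \<Longrightarrow> q \<in> B i \<Longrightarrow> prime q"
    and disj: "disjoint_family_on B {..<k}"
  shows "shift_composite ((\<Union>i<k. avoiding (B i)) \<inter> {M<..}) k"
proof -
  obtain R where R: "finite R" "inj_on fst R" "\<And>q c. (q, c) \<in> R \<Longrightarrow> prime q"
    and block: "\<And>i q. i < k \<Longrightarrow> q \<in> B i \<Longrightarrow> (q, i + 1) \<in> R" and small: "\<And>j. j \<le> M + k \<Longrightarrow> \<exists>q. (q, j) \<in> R"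
    by (rule prime_shift_system_exists[OF B disj, where m = "M + k"]) (assumption | rule that)+
  obtain n0 W where "W > 0" and dvd: "\<And>n q c. [n = n0] (mod W) \<Longrightarrow> (q, c) \<in> R \<Longrightarrow> q dvd n + c \<and> q \<le> W"
    using R by (rule residue_class_simultaneous_dvd) (assumption, rule that)
  have "\<not> prime (n + i + a)" if n: "W < n" "[n = n0] (mod W)" and "i < k" and a: "prime a"
    "a \<notin> (\<Union>i<k. avoiding (B i)) \<inter> {M<..}" for n i a
  proof -
    have "\<exists>q c. (q, c) \<in> R \<and> q dvd n + i + a"
    proof (cases "a > M")
      case True
      then obtain q where q: "q \<in> B i" "a mod q = 1" using a \<open>i < k\<close> by (auto simp: avoiding_def)
      have "q dvd n + (i + 1)" using dvd[OF n(2) block[OF \<open>i < k\<close> q(1)]] by blast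
      moreover have "q dvd a - 1" using q(2) by (metis dvd_minus_mod)
      ultimately have "q dvd n + (i + 1) + (a - 1)" by (rule dvd_add)
      moreover have "n + (i + 1) + (a - 1) = n + i + a" using prime_gt_0_nat[OF a(1)] by simp
      ultimately show ?thesis using block[OF \<open>i < k\<close> q(1)] by auto
    next
      case False
      then obtain q where "(q, i + a) \<in> R" using small[of "i + a"] \<open>i < k\<close> by auto
      then show ?thesis using dvd[OF n(2)] by (auto simp: add.assoc)
    qed
    then obtain q c where q: "(q, c) \<in> R" "q dvd n + i + a" by blast
    then have "q \<le> W" using dvd[OF n(2)] by blast
    then have "q \<noteq> n + i + a" using n(1) by simp
    then show ?thesis using q(2) primes_dvd_imp_eq[OF R(3)[OF q(1)]] by blast
  qed
  then show ?thesis unfolding shift_composite_def using \<open>W > 0\<close> by blast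
qed

lemma sparse_shift_composite:
  fixes \<delta> :: real and k :: nat
  assumes "\<delta> > 0"
  shows "\<exists>X. sparse_in nat_primes \<delta> X \<and> shift_composite X k \<and> (\<forall>x\<in>X. k < x)
     \<and> (\<forall>N. count_between (nat_primes \<inter> X) 0 N \<le> 2 * \<delta> * count_between nat_primes 0 N)"
proof -
  have "\<delta> / (real k + 1) > 0" using assms by (simp add: add_nonneg_pos)
  from disjoint_sparse_blocks[OF this, of k] obtain B where
    B: "\<forall>i<k. finite (B i) \<and> (\<forall>q\<in>B i. prime q) \<and> sparse_in nat_primes (\<delta> / (real k + 1)) (avoiding (B i))"
    and disj: "disjoint_family_on B {..<k}" by blast
  define Y where "Y = (\<Union>i<k. avoiding (B i))"
  have "sparse_in nat_primes (\<Sum>i<k. \<delta> / (real k + 1)) Y" unfolding Y_def using B by (intro sparse_in_UN) auto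
  moreover have "(\<Sum>i<k. \<delta> / (real k + 1)) \<le> \<delta>" using assms by (simp add: field_simps)
  ultimately have Y: "sparse_in nat_primes \<delta> Y" by (rule sparse_in_mono) simp
  obtain M where M: "M \<ge> k"
    "\<And>N. count_between (nat_primes \<inter> (Y \<inter> {M<..})) 0 N \<le> 2 * \<delta> * count_between nat_primes 0 N"
    using Y assms by (rule sparse_in_truncate) (rule that)
  have "sparse_in nat_primes \<delta> (Y \<inter> {M<..})" using Y by (rule sparse_in_mono) auto
  moreover have "shift_composite (Y \<inter> {M<..}) k"
    unfolding Y_def using B disj by (intro shift_composite_avoiding) auto
  ultimately show ?thesis using M by (intro exI[of _ "Y \<inter> {M<..}"]) auto
qed

lemma discard_set_exists:
  fixes \<epsilon> :: real
  assumes "\<epsilon> > 0"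
  obtains U where "sparse_in nat_primes \<epsilon> U" "\<And>k. shift_composite U k"
proof -
  define \<eta> where "\<eta> = (\<lambda>k. \<epsilon> * (1/2) ^ Suc k)"
  have \<eta>: "\<eta> k > 0" for k using assms by (simp add: \<eta>_def)
  have sums: "\<eta> sums \<epsilon>" unfolding \<eta>_def using sums_mult[OF power_half_series, of \<epsilon>] by simp
  have "\<forall>k. \<exists>X. sparse_in nat_primes (\<eta> k) X \<and> shift_composite X k \<and> (\<forall>x\<in>X. k < x)
     \<and> (\<forall>N. count_between (nat_primes \<inter> X) 0 N \<le> 2 * \<eta> k * count_between nat_primes 0 N)"
    using sparse_shift_composite[OF \<eta>] by blast
  then obtain X where X: "\<And>k. sparse_in nat_primes (\<eta> k) (X k)" "\<And>k. shift_composite (X k) k"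
    "\<And>k x. x \<in> X k \<Longrightarrow> k < x"
    "\<And>k N. count_between (nat_primes \<inter> X k) 0 N \<le> 2 * \<eta> k * count_between nat_primes 0 N"
    by metis
  have "sparse_in nat_primes \<epsilon> (\<Union>k. X k)"
  proof (rule sparse_in_UN_infinite[where \<mu> = "\<lambda>k. 2 * \<eta> k"])
    show "(\<Sum>k<n. \<eta> k) \<le> \<epsilon>" for n
      using sum_le_suminf[of \<eta> "{..<n}"] sums \<eta> by (simp add: sums_iff less_imp_le)
    show "summable (\<lambda>k. 2 * \<eta> k)" using sums by (intro summable_mult) (simp add: sums_iff)
  qed (use X in auto)
  moreover have "shift_composite (\<Union>k. X k) k" for k
    using X(2)[of k] by (rule shift_composite_mono) blast
  ultimately show ?thesis by (rule that)
qed

section \<open>Greedy choice of a set with given density\<close>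

lemma count_between_at_top:
  assumes "infinite E"
  shows "filterlim (\<lambda>N. count_between E 0 N) at_top sequentially"
  unfolding filterlim_at_top
proof
  fix Z :: real
  obtain m :: nat where m: "Z \<le> real m" using real_arch_simple by blast
  have "infinite (E - {0})" using assms by simp
  then obtain T where T: "finite T" "card T = m" "T \<subseteq> E - {0}" using infinite_arbitrarily_large by blast
  have "Z \<le> count_between E 0 N" if "N \<ge> Max (insert 0 T)" for N
  proof -
    have "T \<subseteq> E \<inter> {0<..N}" using T that by auto
    then have "card T \<le> card (E \<inter> {0<..N})" by (intro card_mono) auto
    then show ?thesis using m T(2) by (simp add: count_between_def)
  qed
  then show "eventually (\<lambda>N. Z \<le> count_between E 0 N) sequentially"
    unfolding eventually_sequentially by blast
qed

context
  fixes E U :: "nat set" and c :: real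
begin

primrec greedy_count :: "nat \<Rightarrow> nat" where
  "greedy_count 0 = 0"
| "greedy_count (Suc n) = (if Suc n \<in> E - U \<and> real (greedy_count n) + 1 \<le> c * count_between E 0 (Suc n)
     then greedy_count n + 1 else greedy_count n)"

definition greedy_set :: "nat set" where
  "greedy_set = {p \<in> E - U. p > 0 \<and> real (greedy_count (p - 1)) + 1 \<le> c * count_between E 0 p}"

lemma count_between_greedy_set: "count_between greedy_set 0 N = real (greedy_count N)"
proof (induction N)
  case (Suc N)
  show ?case
  proof (cases "Suc N \<in> greedy_set")
    case True
    then have "greedy_set \<inter> {0<..Suc N} = insert (Suc N) (greedy_set \<inter> {0<..N})" by auto
    then show ?thesis using True Suc by (simp add: count_between_def greedy_set_def)
  next
    case False
    then have "greedy_set \<inter> {0<..Suc N} = greedy_set \<inter> {0<..N}" by (auto simp: le_Suc_eq)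
    then show ?thesis using False Suc by (simp add: count_between_def greedy_set_def)
  qed
qed (simp add: count_between_def)

lemma greedy_count_upper:
  assumes "c \<ge> 0"
  shows "real (greedy_count N) \<le> c * count_between E 0 N"
proof (induction N)
  case (Suc N)
  have "count_between E 0 N \<le> count_between E 0 (Suc N)"
    unfolding count_between_def by (intro of_nat_mono card_mono) auto
  then have "c * count_between E 0 N \<le> c * count_between E 0 (Suc N)"
    using assms by (intro mult_left_mono) auto
  then show ?case using Suc by auto
qed (use assms in simp)

text \<open>Counting from the last element that was refused for being too many.\<close>

lemma greedy_last_refusal:
  "\<exists>s\<le>N. c * count_between E 0 s - 1 \<le> real (greedy_count s)
     \<and> real (greedy_count N) = real (greedy_count s) + count_between (E - U) s N"
proof (induction N)
  case 0
  show ?case by (simp add: count_between_def)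
next
  case (Suc N)
  then obtain s where s: "s \<le> N" "c * count_between E 0 s - 1 \<le> real (greedy_count s)"
    "real (greedy_count N) = real (greedy_count s) + count_between (E - U) s N" by blast
  consider (excluded) "Suc N \<notin> E - U"
    | (taken) "Suc N \<in> E - U" "real (greedy_count N) + 1 \<le> c * count_between E 0 (Suc N)"
    | (refused) "Suc N \<in> E - U" "\<not> real (greedy_count N) + 1 \<le> c * count_between E 0 (Suc N)" by blast
  then show ?case
  proof cases
    case excluded
    then have "(E - U) \<inter> {s<..Suc N} = (E - U) \<inter> {s<..N}" by (auto simp: le_Suc_eq)
    then show ?thesis using s excluded by (intro exI[of _ s]) (auto simp: count_between_def)
  next
    case taken
    then have "(E - U) \<inter> {s<..Suc N} = insert (Suc N) ((E - U) \<inter> {s<..N})" using s(1) by (auto simp: le_Suc_eq)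
    then have "count_between (E - U) s (Suc N) = count_between (E - U) s N + 1" by (simp add: count_between_def)
    then show ?thesis using s taken by (intro exI[of _ s]) simp
  next
    case refused
    then show ?thesis by (intro exI[of _ "Suc N"]) (auto simp: count_between_def)
  qed
qed

lemma greedy_count_lower:
  assumes U: "sparse_in E (1 - c) U" and "\<kappa> > 0"
  shows "eventually (\<lambda>N. c * count_between E 0 N - \<kappa> * count_between E 0 N - 1 \<le> real (greedy_count N)) sequentially"
  using sparse_inD[OF assms]
proof eventually_elim
  case (elim N)
  obtain s where s: "s \<le> N" "c * count_between E 0 s - 1 \<le> real (greedy_count s)"
    "real (greedy_count N) = real (greedy_count s) + count_between (E - U) s N"
    using greedy_last_refusal[of N] by blast
  have "c * count_between E s N - \<kappa> * count_between E 0 N \<le> count_between (E - U) s N"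
    using elim s(1) by (auto simp: count_between_Diff algebra_simps)
  moreover have "c * count_between E 0 N = c * count_between E 0 s + c * count_between E s N"
    by (simp add: count_between_split[OF s(1)] distrib_left)
  ultimately show ?case using s by linarith
qed

lemma greedy_set_density:
  assumes "infinite E" and U: "sparse_in E (1 - c) U" and "c \<ge> 0"
  shows "(\<lambda>N. count_between greedy_set 0 N / count_between E 0 N) \<longlonglongrightarrow> c"
proof (rule tendstoI)
  fix e :: real assume e: "e > 0"
  then have "e / 3 > 0" by simp
  have "eventually (\<lambda>N. max 1 (3 / e) \<le> count_between E 0 N) sequentially"
    using count_between_at_top[OF assms(1)] unfolding filterlim_at_top by blast
  with greedy_count_lower[OF U \<open>e / 3 > 0\<close>]
  show "eventually (\<lambda>N. dist (count_between greedy_set 0 N / count_between E 0 N) c < e) sequentially"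
  proof eventually_elim
    case (elim N)
    define P where "P = count_between E 0 N"
    define g where "g = count_between greedy_set 0 N"
    have P: "P \<ge> 1" "P \<ge> 3 / e" using elim by (auto simp: P_def)
    have "c - e / 3 - 1 / P = (c * P - e / 3 * P - 1) / P" using P by (simp add: field_simps)
    also have "\<dots> \<le> g / P"
      using elim P by (intro divide_right_mono) (auto simp: P_def g_def count_between_greedy_set)
    finally have "c - e / 3 - 1 / P \<le> g / P" .
    moreover have "1 / P \<le> e / 3" using P e by (simp add: field_simps)
    moreover have "g / P \<le> c"
      using greedy_count_upper[OF \<open>c \<ge> 0\<close>, of N] P by (simp add: P_def g_def count_between_greedy_set field_simps)
    ultimately have "\<bar>g / P - c\<bar> < e" using e by linarith
    then show ?case by (simp add: P_def g_def dist_real_def)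
  qed
qed

end

lemma exists_subset_with_density:
  assumes "infinite E" "sparse_in E \<epsilon> U" "\<epsilon> \<le> 1"
  obtains A where "A \<subseteq> E - U" "(\<lambda>N. count_between A 0 N / count_between E 0 N) \<longlonglongrightarrow> 1 - \<epsilon>"
proof (rule that)
  show "greedy_set E U (1 - \<epsilon>) \<subseteq> E - U" by (auto simp: greedy_set_def)
  show "(\<lambda>N. count_between (greedy_set E U (1 - \<epsilon>)) 0 N / count_between E 0 N) \<longlonglongrightarrow> 1 - \<epsilon>"
    using assms by (intro greedy_set_density) auto
qed

lemma has_rel_density_int_image:
  assumes "A \<subseteq> E" and lim: "(\<lambda>N. count_between A 0 N / count_between E 0 N) \<longlonglongrightarrow> d"
  shows "has_rel_density (int ` E) (int ` A) d"
proof -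
  have "card (int ` S \<inter> {1..int N}) = card (S \<inter> {0<..N})" for S N
  proof -
    have "int ` S \<inter> {1..int N} = int ` (S \<inter> {0<..N})" by auto
    then show ?thesis by (simp add: card_image)
  qed
  moreover have "int ` A \<inter> int ` E = int ` A" using assms(1) by auto
  ultimately have "(\<lambda>N. ereal (real (card (int ` A \<inter> int ` E \<inter> {1..int N}))
      / real (card (int ` E \<inter> {1..int N})))) \<longlonglongrightarrow> ereal d"
    using lim by (simp add: count_between_def)
  then show ?thesis unfolding has_rel_density_def upper_rel_density_def lower_rel_density_def
    by (auto intro!: lim_imp_Limsup lim_imp_Liminf)
qed

section \<open>Syndetic sets and prime differences\<close>

lemma syndetic_iff_bounded_gaps: "syndetic S \<longleftrightarrow> (\<exists>c. \<forall>n>0. \<exists>s\<in>S. 0 < s \<and> \<bar>s - n\<bar> \<le> c)"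
proof
  assume "syndetic S"
  then obtain F where F: "finite F" "pos_ints \<subseteq> diff_set (S \<inter> pos_ints) F" unfolding syndetic_def by blast
  have "\<exists>s\<in>S. 0 < s \<and> \<bar>s - n\<bar> \<le> Max (abs ` F)" if "n > 0" for n
  proof -
    have "n \<in> diff_set (S \<inter> pos_ints) F" using F(2) that by (auto simp: pos_ints_def)
    then obtain s f where "s \<in> S" "s > 0" "f \<in> F" "n = s - f" by (auto simp: diff_set_def pos_ints_def)
    then show ?thesis using F(1) by (intro bexI[of _ s]) auto
  qed
  then show "\<exists>c. \<forall>n>0. \<exists>s\<in>S. 0 < s \<and> \<bar>s - n\<bar> \<le> c" by blast
next
  assume "\<exists>c. \<forall>n>0. \<exists>s\<in>S. 0 < s \<and> \<bar>s - n\<bar> \<le> c"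
  then obtain c where c: "\<forall>n>0. \<exists>s\<in>S. 0 < s \<and> \<bar>s - n\<bar> \<le> c" by blast
  have "n \<in> diff_set (S \<inter> pos_ints) {-c..c}" if "n \<in> pos_ints" for n
  proof -
    obtain s where "s \<in> S" "0 < s" "\<bar>s - n\<bar> \<le> c" using c \<open>n \<in> pos_ints\<close> by (auto simp: pos_ints_def)
    then show ?thesis unfolding diff_set_def pos_ints_def
      by (intro CollectI exI[of _ s] exI[of _ "s - n"]) auto
  qed
  then show "syndetic S" unfolding syndetic_def by blast
qed

lemma syndetic_mono: "syndetic S \<Longrightarrow> S \<subseteq> T \<Longrightarrow> syndetic T"
  unfolding syndetic_iff_bounded_gaps by blast

lemma syndetic_residue_class:
  fixes N r W :: int
  assumes "W > 0"
  shows "syndetic {n. N < n \<and> [n = r] (mod W)}"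
  unfolding syndetic_iff_bounded_gaps
proof (intro exI allI impI)
  fix n :: int assume "n > 0"
  define m where "m = n + \<bar>N\<bar> + 1"
  define s where "s = m + (r - m) mod W"
  have "0 \<le> (r - m) mod W" "(r - m) mod W < W" using assms by simp_all
  moreover have "[s = r] (mod W)" by (simp add: s_def unique_euclidean_semiring_class.cong_def mod_simps)
  ultimately show "\<exists>s\<in>{n. N < n \<and> [n = r] (mod W)}. 0 < s \<and> \<bar>s - n\<bar> \<le> \<bar>N\<bar> + 1 + W"
    using \<open>n > 0\<close> by (intro bexI[of _ s]) (auto simp: s_def m_def)
qed

lemma thickly_syndeticI:
  assumes "\<And>k::nat. syndetic {n. {n..<n + int k} \<subseteq> S}"
  shows "thickly_syndetic S"
  unfolding thickly_syndetic_def
proof (intro allI impI)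
  fix B assume "B \<subseteq> pos_ints \<and> piecewise_syndetic B"
  then obtain T R where B: "thick T" "syndetic R" "B \<inter> pos_ints = T \<inter> R"
    unfolding piecewise_syndetic_def by blast
  obtain c where c: "\<forall>n>0. \<exists>r\<in>R. 0 < r \<and> \<bar>r - n\<bar> \<le> c"
    using B(2) unfolding syndetic_iff_bounded_gaps by blast
  define k where "k = nat (2 * c + 1)"
  have "c \<ge> 0" using c[rule_format, of 1] by fastforce
  then have k: "int k = 2 * c + 1" by (simp add: k_def)
  obtain w where w: "\<forall>n>0. \<exists>s\<in>{n. {n..<n + int k} \<subseteq> S}. 0 < s \<and> \<bar>s - n\<bar> \<le> w"
    using assms[of k] unfolding syndetic_iff_bounded_gaps by blast
  have "w \<ge> 0" using w[rule_format, of 1] by fastforce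
  obtain a where a: "{a + 1..a + int (nat (2 * w + 2 * c + 1))} \<subseteq> T \<inter> pos_ints"
    using B(1) unfolding thick_def by blast
  then have T: "{a + 1..a + 2 * w + 2 * c + 1} \<subseteq> T \<inter> pos_ints" using \<open>c \<ge> 0\<close> \<open>w \<ge> 0\<close> by (simp add: add.assoc)
  then have "a + 1 \<in> pos_ints" using \<open>c \<ge> 0\<close> \<open>w \<ge> 0\<close> by (force simp: subset_iff)
  then have "a + 1 + w > 0" using \<open>w \<ge> 0\<close> by (simp add: pos_ints_def)
  then obtain s where s: "{s..<s + int k} \<subseteq> S" "0 < s" "\<bar>s - (a + 1 + w)\<bar> \<le> w" using w by blast
  have "s + c > 0" using s(2) \<open>c \<ge> 0\<close> by simp
  then obtain r where r: "r \<in> R" "\<bar>r - (s + c)\<bar> \<le> c" using c by blast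
  have "r \<in> {s..<s + int k}" using r(2) k by auto
  then have "r \<in> S" using s(1) by blast
  moreover have "r \<in> {a + 1..a + 2 * w + 2 * c + 1}" using r(2) s(3) by auto
  then have "r \<in> T \<inter> pos_ints" using T by blast
  ultimately show "S \<inter> pos_ints \<inter> B \<noteq> {}" using r(1) B(3) by blast
qed

lemma not_piecewise_syndetic_if_thickly_syndetic_complement:
  assumes "thickly_syndetic (pos_ints - S)"
  shows "\<not> piecewise_syndetic S"
proof
  assume "piecewise_syndetic S"
  then have "piecewise_syndetic (S \<inter> pos_ints)" by (simp add: piecewise_syndetic_def)
  then have "(pos_ints - S) \<inter> pos_ints \<inter> (S \<inter> pos_ints) \<noteq> {}"
    using assms unfolding thickly_syndetic_def by blast
  then show False by blast
qed

lemma primes_eq_int_image: "primes = int ` nat_primes"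
proof -
  have "x \<in> int ` nat_primes" if "prime x" for x :: int
    using that prime_gt_0_int[OF that] by (intro image_eqI[of _ _ "nat x"]) auto
  then show ?thesis by (auto simp: primes_def)
qed

lemma thickly_syndetic_complement_prime_differences:
  assumes "A \<subseteq> nat_primes - U" and U: "\<And>k. shift_composite U k"
  shows "thickly_syndetic (pos_ints - diff_set primes (int ` A))"
proof (rule thickly_syndeticI)
  fix k :: nat
  obtain n0 W where "W > 0"
    and composite: "\<And>n i a. W < n \<Longrightarrow> [n = n0] (mod W) \<Longrightarrow> i < k \<Longrightarrow> prime a \<Longrightarrow> a \<notin> U \<Longrightarrow> \<not> prime (n + i + a)"
    using U[of k] unfolding shift_composite_def by blast
  have "m \<notin> diff_set primes (int ` A)"
    if n: "int W < n" "[n = int n0] (mod int W)" and m: "n \<le> m" "m < n + int k" for n m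
  proof
    assume "m \<in> diff_set primes (int ` A)"
    then obtain p a where pa: "m = int p - int a" "prime p" "a \<in> A"
      by (auto simp: diff_set_def primes_eq_int_image)
    have "[nat n = n0] (mod W)" using n by (simp add: cong_int_iff[symmetric])
    moreover have "W < nat n" "nat (m - n) < k" using n(1) m by linarith+
    moreover have "prime a" "a \<notin> U" using pa(3) assms(1) by auto
    ultimately have "\<not> prime (nat n + nat (m - n) + a)" by (intro composite)
    moreover have "p = nat n + nat (m - n) + a" using n(1) m(1) pa(1) by linarith
    ultimately show False using pa(2) by simp
  qed
  then have residue_class: "{n. int W < n \<and> [n = int n0] (mod int W)}
      \<subseteq> {n. {n..<n + int k} \<subseteq> pos_ints - diff_set primes (int ` A)}"
    by (auto simp: pos_ints_def)
  have "syndetic {n. int W < n \<and> [n = int n0] (mod int W)}"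
    using \<open>W > 0\<close> by (intro syndetic_residue_class) simp
  then show "syndetic {n. {n..<n + int k} \<subseteq> pos_ints - diff_set primes (int ` A)}"
    using residue_class by (rule syndetic_mono)
qed

theorem theoremC:
  fixes \<epsilon> :: real
  assumes "\<epsilon> > 0"
  shows "\<exists>A. A \<subseteq> primes
           \<and> (\<exists>d. has_rel_density primes A d \<and> d \<ge> 1 - \<epsilon>)
           \<and> \<not> piecewise_syndetic (diff_set primes A)
           \<and> thickly_syndetic (pos_ints - diff_set primes A)
           \<and> \<not> prime_intersective (pos_ints - diff_set primes A)"
proof -
  define \<delta> where "\<delta> = min \<epsilon> (1/2)"
  have \<delta>: "0 < \<delta>" "\<delta> \<le> 1/2" "\<delta> \<le> \<epsilon>" using assms by (auto simp: \<delta>_def)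
  obtain U where U: "sparse_in nat_primes \<delta> U" "\<And>k. shift_composite U k"
    by (rule discard_set_exists[OF \<delta>(1)]) (rule that)
  obtain G where G: "G \<subseteq> nat_primes - U" "(\<lambda>N. count_between G 0 N / count_between nat_primes 0 N) \<longlonglongrightarrow> 1 - \<delta>"
    using primes_infinite U(1) by (rule exists_subset_with_density) (use \<delta> in simp, rule that)
  define A where "A = int ` G"
  have A: "A \<subseteq> primes" using G(1) by (auto simp: A_def primes_eq_int_image)
  have density: "has_rel_density primes A (1 - \<delta>)"
    unfolding A_def primes_eq_int_image using G by (intro has_rel_density_int_image) auto
  have thickly: "thickly_syndetic (pos_ints - diff_set primes A)"
    unfolding A_def using G(1) U(2) by (rule thickly_syndetic_complement_prime_differences)
  have "upper_rel_density primes A > 0" using density \<delta> by (simp add: has_rel_density_def)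
  moreover have "(pos_ints - diff_set primes A) \<inter> diff_set A A = {}" using A by (auto simp: diff_set_def)
  ultimately have "\<not> prime_intersective (pos_ints - diff_set primes A)"
    using A unfolding prime_intersective_def by blast
  moreover have "\<not> piecewise_syndetic (diff_set primes A)"
    using thickly by (rule not_piecewise_syndetic_if_thickly_syndetic_complement)
  ultimately show ?thesis using A density \<delta>(3) thickly by (intro exI[of _ A]) auto
qed

end
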